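(* Let $T$ be a Calderón--Zygmund operator on $\mathbb{R}^n$, let $\Phi=\{\phi_\alpha\}_{\alpha\in\mathcal{I}}$ be a family of real-valued measurable functions indexed by an arbitrary set $\mathcal{I}$, and let $T^{\Phi}g(x)=\sup_{\alpha\in\mathcal{I}}|T(e^{2\pi i\phi_\alpha}g)(x)|$. For a sequence of functions $f=(f_j)_{j\in\mathbb{N}}$ put $\bar T^\Phi f=(T^\Phi f_j)_{j\in\mathbb{N}}$. Let $q\ge1$ and write $|f(x)|_q=\big(\sum_{j=1}^\infty|f_j(x)|^q\big)^{1/q}$. Assume that for some $r_0>1$ the operator $\bar T^\Phi$ satisfies the a priori weak-type inequalities $$\|\bar T^{\Phi}f\|_{L^{r,\infty}(\ell^q)}\lesssim\psi(r)\,\|f\|_{L^r(\ell^q)},\qquad 1<r\le r_0,$$ where $\psi(r)$ is a function that captures the dependence of the operator norm on $r$. Let $1<p<\infty$, $\frac1p+\frac1{p'}=1$, and suppose that $A$ is a doubling Young function satisfying $$\int_c^\infty\Big(\frac{t}{A(t)}\Big)^{p'-1}\frac{dt}{t}<\infty\quad\text{for some }c>0.$$ Then there is a constant $C<\infty$, independent of $f$ and $w$, such that for any weight $w$ $$\int_{\mathbb{R}^n}|\bar T^{\Phi}f(x)|_q^p\,w(x)\,dx\le C\int_{\mathbb{R}^n}|f(x)|_q^p\,M_Aw(x)\,dx .$$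
   Context: A weight is a non-negative locally integrable function. $X\lesssim Y$ means $X\le cY$ for a constant $c$ that is, in particular, independent of $f$. The norms are $\|f\|_{L^r(\ell^q)}=\|\,|f|_q\,\|_{L^r(\mathbb{R}^n)}$ and $\|f\|_{L^{r,\infty}(\ell^q)}=\|\,|f|_q\,\|_{L^{r,\infty}(\mathbb{R}^n)}$. A Young function is a continuous, convex, increasing function $A:[0,\infty)\to[0,\infty)$ with $A(0)=0$ and $A(t)\to\infty$ as $t\to\infty$; it is doubling if there is a positive constant $C'$ with $A(2t)\le C'A(t)$ for $t>0$. For a cube $Q\subset\mathbb{R}^n$, $\|g\|_{A,Q}=\inf\{\lambda>0:\frac1{|Q|}\int_QA(|g(y)|/\lambda)\,dy\le1\}$, and $M_Ag(x)=\sup_{Q\ni x}\|g\|_{A,Q}$, the supremum being over all cubes $Q$ in $\mathbb{R}^n$ containing $x$. A Calderón--Zygmund operator $T$ on $\mathbb{R}^n$ is an $L^2$-bounded linear operator represented as $Tg(x)=\int_{\mathbb{R}^n}K(x,y)g(y)\,dy$ for $x\notin\operatorname{supp}g$, where the kernel $K$ satisfies, for some constant $c_K$: (i) $|K(x,y)|\le c_K|x-y|^{-n}$ for all $x\ne y$; (ii) $|K(x,y)-K(x',y)|+|K(y,x)-K(y,x')|\le c_K\frac{|x-x'|^\delta}{|x-y|^{n+\delta}}$ for some $0<\delta\le1$ when $|x-x'|<|x-y|/2$. *)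

theory Defs
  imports "HOL-Analysis.Analysis"
begin

text \<open>
  Throughout, \<open>\<real>\<^sup>n\<close> is \<^typ>\<open>real ^ 'n\<close>, and measurability and integrals refer to
  \<^const>\<open>lebesgue\<close>. Sizes, norms and maximal functions take values in \<^typ>\<open>ennreal\<close>, so that
  every supremum, series and integral exists.
\<close>

text \<open>The power of an extended nonnegative number; used for exponents \<open>a > 0\<close> only.\<close>

definition epowr :: "ennreal \<Rightarrow> real \<Rightarrow> ennreal" where
  "epowr x a = (if x = top then top else ennreal (enn2real x powr a))"

definition lq_norm :: "real \<Rightarrow> (nat \<Rightarrow> ennreal) \<Rightarrow> ennreal" where
  "lq_norm q a = epowr (\<Sum>j. epowr (a j) q) (1 / q)"

definition Lr_norm :: "real \<Rightarrow> (real ^ 'n \<Rightarrow> ennreal) \<Rightarrow> ennreal" where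
  "Lr_norm r F = epowr (\<integral>\<^sup>+x. epowr (F x) r \<partial>lebesgue) (1 / r)"

text \<open>
  Meaningful for measurable \<open>F\<close> only: \<^const>\<open>emeasure\<close> is 0 on nonmeasurable sets.
\<close>

definition weak_Lr_norm :: "real \<Rightarrow> (real ^ 'n \<Rightarrow> ennreal) \<Rightarrow> ennreal" where
  "weak_Lr_norm r F =
     (SUP t\<in>{0<..}. ennreal t * epowr (emeasure lebesgue {x. ennreal t < F x}) (1 / r))"

definition L2_functions :: "(real ^ 'n \<Rightarrow> complex) set" where
  "L2_functions = {g \<in> borel_measurable lebesgue. Lr_norm 2 (\<lambda>x. ennreal (norm (g x))) < top}"

definition weight :: "(real ^ 'n \<Rightarrow> real) \<Rightarrow> bool" where
  "weight w \<longleftrightarrow> (\<forall>x. 0 \<le> w x) \<and> (\<forall>S. compact S \<longrightarrow> w absolutely_integrable_on S)"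

definition young_function :: "(real \<Rightarrow> real) \<Rightarrow> bool" where
  "young_function A \<longleftrightarrow>
     continuous_on {0..} A \<and> convex_on {0..} A \<and> mono_on {0..} A \<and> A 0 = 0 \<and>
     filterlim A at_top at_top"

definition doubling :: "(real \<Rightarrow> real) \<Rightarrow> bool" where
  "doubling A \<longleftrightarrow> (\<exists>C'>0. \<forall>t>0. A (2 * t) \<le> C' * A t)"

definition cubes :: "(real ^ 'n) set set" where
  "cubes = {cbox a (a + (\<chi> i. l)) | a l. 0 < l}"

text \<open>The infimum is infinite when no \<open>s\<close> is admissible.\<close>

definition luxemburg_norm :: "(real \<Rightarrow> real) \<Rightarrow> (real ^ 'n) set \<Rightarrow> (real ^ 'n \<Rightarrow> real) \<Rightarrow> ennreal" where
  "luxemburg_norm A Q g =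
     Inf {ennreal s | s. 0 < s \<and>
       (\<integral>\<^sup>+y\<in>Q. ennreal (A (\<bar>g y\<bar> / s)) \<partial>lebesgue) / emeasure lebesgue Q \<le> 1}"

definition orlicz_maximal :: "(real \<Rightarrow> real) \<Rightarrow> (real ^ 'n \<Rightarrow> real) \<Rightarrow> real ^ 'n \<Rightarrow> ennreal" where
  "orlicz_maximal A g x = (SUP Q\<in>{Q \<in> cubes. x \<in> Q}. luxemburg_norm A Q g)"

definition cz_kernel :: "(real ^ 'n \<Rightarrow> real ^ 'n \<Rightarrow> complex) \<Rightarrow> bool" where
  "cz_kernel K \<longleftrightarrow> (\<exists>c \<delta>. 0 < \<delta> \<and> \<delta> \<le> 1 \<and>
     (\<forall>x y. x \<noteq> y \<longrightarrow> norm (K x y) \<le> c / norm (x - y) ^ CARD('n)) \<and>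
     (\<forall>x x' y. norm (x - x') < norm (x - y) / 2 \<longrightarrow>
        norm (K x y - K x' y) + norm (K y x - K y x')
          \<le> c * (norm (x - x') powr \<delta> / norm (x - y) powr (real CARD('n) + \<delta>))))"

text \<open>
  A Calderon-Zygmund operator is bounded on \<open>L\<^sup>2\<close>, but is commonly also applied to functions
  outside \<open>L\<^sup>2\<close> (for instance in another \<open>L\<^sup>s\<close>). The set \<open>D\<close> of functions to which \<open>T\<close> is applied is
  therefore a parameter: a space of measurable functions which contains \<open>L\<^sup>2\<close> and is closed under
  multiplication by bounded measurable functions, such as \<open>exp (2 \<pi> i \<phi>)\<close>. The smallest choice
  is \<open>L\<^sup>2\<close> itself.
\<close>

definition cz_domain :: "(real ^ 'n \<Rightarrow> complex) set \<Rightarrow> bool" where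
  "cz_domain D \<longleftrightarrow>
     L2_functions \<subseteq> D \<and> D \<subseteq> borel_measurable lebesgue \<and>
     (\<forall>g\<in>D. \<forall>h\<in>D. (\<lambda>x. g x + h x) \<in> D) \<and>
     (\<forall>b\<in>borel_measurable lebesgue. bounded (range b) \<longrightarrow> (\<forall>g\<in>D. (\<lambda>x. b x * g x) \<in> D))"

text \<open>
  \<open>T\<close> acts on functions, and linearity and the kernel representation hold at every point rather
  than almost everywhere: the supremum over an uncountable family of modulations depends on the
  values \<open>T g x\<close> themselves and not only on \<open>T g\<close> up to null sets. The bound on \<open>L\<^sup>2\<close> still makes
  \<open>T g\<close> and \<open>T h\<close> agree almost everywhere when \<open>g\<close> and \<open>h\<close> in \<open>L\<^sup>2\<close> do. Integrability is stated
  explicitly because the integral of a nonintegrable function is 0 by convention.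
\<close>

definition calderon_zygmund ::
  "(real ^ 'n \<Rightarrow> complex) set \<Rightarrow> ((real ^ 'n \<Rightarrow> complex) \<Rightarrow> real ^ 'n \<Rightarrow> complex) \<Rightarrow> bool" where
  "calderon_zygmund D T \<longleftrightarrow>
     cz_domain D \<and>
     (\<forall>g\<in>D. T g \<in> borel_measurable lebesgue) \<and>
     (\<forall>g\<in>D. \<forall>h\<in>D. \<forall>x. T (\<lambda>y. g y + h y) x = T g x + T h x) \<and>
     (\<forall>c. \<forall>g\<in>D. \<forall>x. T (\<lambda>y. c * g y) x = c * T g x) \<and>
     (\<exists>B::real. \<forall>g\<in>L2_functions.
        Lr_norm 2 (\<lambda>x. ennreal (norm (T g x))) \<le> ennreal B * Lr_norm 2 (\<lambda>x. ennreal (norm (g x)))) \<and>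
     (\<exists>K. cz_kernel K \<and>
        (\<forall>g\<in>D. \<forall>x. x \<notin> closure {y. g y \<noteq> 0} \<longrightarrow>
           integrable lebesgue (\<lambda>y. K x y * g y) \<and>
           T g x = (LINT y|lebesgue. K x y * g y)))"

definition modulated ::
  "((real ^ 'n \<Rightarrow> complex) \<Rightarrow> real ^ 'n \<Rightarrow> complex) \<Rightarrow> 'i set \<Rightarrow> ('i \<Rightarrow> real ^ 'n \<Rightarrow> real) \<Rightarrow>
     (real ^ 'n \<Rightarrow> complex) \<Rightarrow> real ^ 'n \<Rightarrow> ennreal" where
  "modulated T I \<phi> g x =
     (SUP \<alpha>\<in>I. ennreal (norm (T (\<lambda>y. exp (2 * of_real pi * \<i> * of_real (\<phi> \<alpha> y)) * g y) x)))"

text \<open>\<open>|f(x)|\<^sub>q\<close> and \<open>|T\<^sup>\<Phi> f(x)|\<^sub>q\<close> for a sequence \<open>f\<close> of functions\<close>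

definition seq_norm :: "real \<Rightarrow> (nat \<Rightarrow> real ^ 'n \<Rightarrow> complex) \<Rightarrow> real ^ 'n \<Rightarrow> ennreal" where
  "seq_norm q f x = lq_norm q (\<lambda>j. ennreal (norm (f j x)))"

definition modulated_seq_norm ::
  "real \<Rightarrow> ((real ^ 'n \<Rightarrow> complex) \<Rightarrow> real ^ 'n \<Rightarrow> complex) \<Rightarrow> 'i set \<Rightarrow>
     ('i \<Rightarrow> real ^ 'n \<Rightarrow> real) \<Rightarrow> (nat \<Rightarrow> real ^ 'n \<Rightarrow> complex) \<Rightarrow> real ^ 'n \<Rightarrow> ennreal" where
  "modulated_seq_norm q T I \<phi> f x = lq_norm q (\<lambda>j. modulated T I \<phi> (f j) x)"

text \<open>
  The inequality with constant \<open>B\<close>. Membership in weak \<open>L\<^sup>r\<close> includes measurability, which is not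
  automatic for a supremum over an arbitrary index set.
\<close>

definition weak_type_bound ::
  "(real ^ 'n \<Rightarrow> complex) set \<Rightarrow> real \<Rightarrow> ((real ^ 'n \<Rightarrow> complex) \<Rightarrow> real ^ 'n \<Rightarrow> complex) \<Rightarrow> 'i set \<Rightarrow>
     ('i \<Rightarrow> real ^ 'n \<Rightarrow> real) \<Rightarrow> real \<Rightarrow> real \<Rightarrow> bool" where
  "weak_type_bound D q T I \<phi> r B \<longleftrightarrow>
     (\<forall>f. (\<forall>j. f j \<in> D) \<and> Lr_norm r (seq_norm q f) < top \<longrightarrow>
        modulated_seq_norm q T I \<phi> f \<in> borel_measurable lebesgue \<and>
        weak_Lr_norm r (modulated_seq_norm q T I \<phi> f) \<le> ennreal B * Lr_norm r (seq_norm q f))"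

end

theory Submission
  imports Defs
begin

text \<open>
  Write \<open>F = |f|\<^sub>q\<close> and, for a triadic cell \<open>c\<close> inside a large ball \<open>B\<^sub>c\<close>, let \<open>G\<^sub>c\<close> be the \<open>q\<close>-norm of the
  modulated operator applied to \<open>f\<close> cut off to \<open>B\<^sub>c\<close>. Fix one exponent \<open>r\<close> with \<open>1 < r < p\<close> and \<open>r \<le> r\<^sub>0\<close>. By the weak
  type bounds for the operator and for the maximal function of \<open>F\<^sup>r\<close>, outside of disjoint cells
  \<open>d \<subseteq> c\<close> of at most half the measure, \<open>G\<^sub>c\<close> is at most a multiple of the \<open>L\<^sup>r\<close>-mean \<open>a\<^sub>c\<close> of \<open>F\<close> over \<open>B\<^sub>c\<close>,
  and on such a cell \<open>d\<close> it is at most \<open>G\<^sub>d\<close> plus a multiple of \<open>a\<^sub>c\<close>: the modulation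
  does not affect the size of the kernel differences, and one comparison point in \<open>d\<close> at which everything
  is small suffices. Iterating, \<open>\<integral> G\<^sub>c h\<close> is bounded by the integral over \<open>c\<close> of the bilinear maximal function
  \<open>sup a\<^sub>d \<langle>h\<rangle>\<^sub>d\<close>, without constructing a sparse family.

  For \<open>h = w\<^sup>1\<^sup>/\<^sup>p v\<close> a generalised Hoelder inequality on cells bounds \<open>\<langle>h\<rangle>\<^sub>d\<close> by \<open>\<parallel>w\<parallel>\<^sup>1\<^sup>/\<^sup>p\<close>, taken in the
  Luxemburg norm over a slightly larger cube, times a dual mean of \<open>v\<close>. The first factor is absorbed into \<open>a\<^sub>d\<close> as
  \<open>(M\<^sub>A w)\<^sup>1\<^sup>/\<^sup>p\<close>; the maximal function of the second is bounded on \<open>L\<^sup>p\<^sup>'\<close> exactly by the integral condition on \<open>A\<close>.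
  Choosing \<open>v = G\<^sup>p\<^sup>-\<^sup>1 w\<^sup>1\<^sup>/\<^sup>p\<^sup>'\<close>, with \<open>G\<close> truncated, and absorbing by Young's inequality proves the
  estimate on a cell, and the cells around the origin exhaust the space.
\<close>

section \<open>Powers in the extended nonnegative reals and the norm of sequences\<close>

text \<open>The sequence \<open>f\<close> is only known to lie in \<open>D\<close>, whereas the
  weak-type hypothesis speaks of sequences of finite norm and is also where measurability of suprema
  over \<open>I\<close> comes from. Hence everything is done with cut-offs to balls. They are
  admissible after two trivial cases: an infinite right-hand side, and a weight vanishing almost
  everywhere. Otherwise the Orlicz maximal function is bounded below on every ball, so a finite
  right-hand side puts F locally in L^p, hence in L^r. The uncut operator is recovered pointwise,
  because the kernel integral of each \<open>f j\<close> converges away from the point, and Fatou's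
  lemma is applied to the cut-off operators. The factor 1/2 in the measure of the stopping cells
  acts twice: what remains covered after all generations is null, and the uncovered part of a cell
  is large enough to carry its average. Absorption needs a finite left-hand side; this is the
  purpose of the truncation and of working on one bounded cell at a time. No constant depends on the
  size of that cell.\<close>

lemma epowr_ennreal: "0 \<le> x \<Longrightarrow> epowr (ennreal x) a = ennreal (x powr a)"
  by (simp add: epowr_def)

lemma epowr_top [simp]: "epowr top a = top"
  by (simp add: epowr_def)

lemma epowr_0 [simp]: "epowr 0 a = 0"
  by (simp add: epowr_def)

lemma epowr_1 [simp]: "epowr x 1 = x"
  by (cases x) (auto simp: epowr_ennreal)

lemma epowr_one [simp]: "epowr 1 a = 1"
  using epowr_ennreal[of 1 a] by simp

lemma epowr_eq_top_iff [simp]: "epowr x a = top \<longleftrightarrow> x = top"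
  by (simp add: epowr_def)

lemma epowr_less_top_iff [simp]: "epowr x a < top \<longleftrightarrow> x < top"
  by (simp add: less_top[symmetric])

lemma epowr_eq_0_iff [simp]: "epowr x a = 0 \<longleftrightarrow> x = 0"
  by (cases x) (auto simp: epowr_ennreal)

lemma epowr_mono: "x \<le> y \<Longrightarrow> 0 \<le> a \<Longrightarrow> epowr x a \<le> epowr y a"
  by (cases x; cases y) (auto simp: epowr_ennreal powr_mono2 top_unique)

lemma epowr_strict_mono: "x < y \<Longrightarrow> 0 < a \<Longrightarrow> epowr x a < epowr y a"
  by (cases x; cases y) (auto simp: epowr_ennreal ennreal_less_iff powr_less_mono2)

lemma epowr_epowr: "epowr (epowr x a) b = epowr x (a * b)"
  by (cases x) (auto simp: epowr_ennreal powr_powr)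

lemma epowr_inverse: "a \<noteq> 0 \<Longrightarrow> epowr (epowr x a) (1 / a) = x"
  "a \<noteq> 0 \<Longrightarrow> epowr (epowr x (1 / a)) a = x"
  by (simp_all add: epowr_epowr)

lemma epowr_mult: "0 < a \<Longrightarrow> epowr (x * y) a = epowr x a * epowr y a"
  by (cases x; cases y)
     (auto simp: epowr_ennreal ennreal_mult_top ennreal_top_mult powr_mult simp flip: ennreal_mult)

lemma epowr_add: "epowr x (a + b) = epowr x a * epowr x b"
  by (cases x) (auto simp: epowr_ennreal powr_add simp flip: ennreal_mult)

lemma measurable_epowr [measurable (raw)]:
  assumes [measurable]: "f \<in> borel_measurable M"
  shows "(\<lambda>x. epowr (f x) a) \<in> borel_measurable M"
  unfolding epowr_def by measurable

text \<open>Lower semicontinuity of the power: the exponent 1 / a turns a level below the power into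
  a level below the limit inferior itself, where the characterisation by eventual inequalities
  applies.\<close>

lemma epowr_Liminf_le:
  assumes "0 < a"
  shows "epowr (Liminf F u) a \<le> Liminf F (\<lambda>n. epowr (u n) a)"
  unfolding le_Liminf_iff
proof (intro allI impI)
  fix y assume "y < epowr (Liminf F u) a"
  with epowr_strict_mono[OF this, of "1 / a"] assms
  have "epowr y (1 / a) < Liminf F u" by (simp add: epowr_inverse)
  then have "eventually (\<lambda>n. epowr y (1 / a) < u n) F"
    using le_Liminf_iff[of "Liminf F u" F u] by simp
  then show "eventually (\<lambda>n. y < epowr (u n) a) F"
  proof eventually_elim
    case (elim n)
    from epowr_strict_mono[OF this, of a] assms show ?case by (simp add: epowr_inverse)
  qed
qed

lemma lq_norm_mono: "(\<And>j. a j \<le> b j) \<Longrightarrow> 0 < q \<Longrightarrow> lq_norm q a \<le> lq_norm q b"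
  unfolding lq_norm_def by (intro epowr_mono suminf_le) auto

lemma le_lq_norm: "0 < q \<Longrightarrow> a j \<le> lq_norm q a"
proof -
  assume q: "0 < q"
  have "sum (\<lambda>j. epowr (a j) q) {j} \<le> (\<Sum>j. epowr (a j) q)"
    by (rule sum_le_suminf) auto
  then have "epowr (epowr (a j) q) (1 / q) \<le> lq_norm q a"
    unfolding lq_norm_def using q by (intro epowr_mono) auto
  then show ?thesis using q by (simp add: epowr_inverse)
qed

lemma epowr_lq_norm: "0 < q \<Longrightarrow> epowr (lq_norm q a) q = (\<Sum>j. epowr (a j) q)"
  by (simp add: lq_norm_def epowr_inverse)

lemma lq_norm_0 [simp]: "lq_norm q (\<lambda>j. 0) = 0"
  by (simp add: lq_norm_def)

lemma lq_norm_cmult: "0 < q \<Longrightarrow> lq_norm q (\<lambda>j. c * a j) = c * lq_norm q a"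
  by (simp add: lq_norm_def epowr_mult epowr_inverse)

lemma measurable_lq_norm [measurable (raw)]:
  assumes [measurable]: "\<And>j. (\<lambda>x. f x j) \<in> borel_measurable M"
  shows "(\<lambda>x. lq_norm q (f x)) \<in> borel_measurable M"
  unfolding lq_norm_def by measurable

text \<open>Young's inequality with the second factor written as a power, so that q = 1, whose
  conjugate exponent is infinite, is included. There y = 0 is separate because 0 powr 0 = 0.\<close>

lemma Young_powr_le:
  fixes x y q :: real
  assumes "0 \<le> x" "0 \<le> y" "1 \<le> q"
  shows "x * y powr (q - 1) \<le> x powr q / q + (1 - 1 / q) * y powr q"
proof (cases "q = 1")
  case True
  then show ?thesis using assms by (cases "y = 0") auto
next
  case False
  have "x * y powr (q - 1) \<le> x powr q / q + (y powr (q - 1)) powr (q / (q - 1)) / (q / (q - 1))"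
    using assms False by (intro Youngs_inequality) (auto simp: field_simps)
  also have "(y powr (q - 1)) powr (q / (q - 1)) / (q / (q - 1)) = (1 - 1 / q) * y powr q"
    using assms False by (simp add: powr_powr divide_simps)
  finally show ?thesis .
qed

text \<open>Minkowski's integral inequality. The dual vector is built from the left-hand side
  itself: Young's inequality against it, applied pointwise and integrated, bounds a partial sum by a
  convex combination of 1 and that same sum, so it is at most 1.\<close>

lemma lq_norm_nn_integral_le:
  assumes q: "1 \<le> q" and [measurable]: "\<And>j. f j \<in> borel_measurable M"
  shows "lq_norm q (\<lambda>j. \<integral>\<^sup>+y. f j y \<partial>M) \<le> (\<integral>\<^sup>+y. lq_norm q (\<lambda>j. f j y) \<partial>M)"
proof -
  define F where "F y = lq_norm q (\<lambda>j. f j y)" for y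
  define a where "a j = (\<integral>\<^sup>+y. f j y \<partial>M)" for j
  have [measurable]: "F \<in> borel_measurable M" unfolding F_def by measurable
  have fF: "f j y \<le> F y" for j y unfolding F_def using q by (intro le_lq_norm) auto
  then have aF: "a j \<le> (\<integral>\<^sup>+y. F y \<partial>M)" for j
    unfolding a_def by (intro nn_integral_mono) auto
  consider "(\<integral>\<^sup>+y. F y \<partial>M) = top" | "(\<integral>\<^sup>+y. F y \<partial>M) = 0" | m where "0 < m" "(\<integral>\<^sup>+y. F y \<partial>M) = ennreal m"
    by (metis ennreal_cases ennreal_0 less_eq_real_def)
  then have "lq_norm q a \<le> (\<integral>\<^sup>+y. F y \<partial>M)"
  proof cases
    case 1 then show ?thesis by simp
  next
    case 2
    then have "a = (\<lambda>_. 0)" using aF by (simp add: fun_eq_iff)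
    then show ?thesis by simp
  next
    case 3
    \<comment> \<open>Normalised by the right-hand side, so that the claim becomes: the q-th powers
      of c sum to at most 1.\<close>
    define c where "c j = enn2real (a j) / m" for j
    have c0: "0 \<le> c j" for j unfolding c_def using 3 by simp
    have ac: "a j = ennreal (m * c j)" for j
    proof -
      have "a j < top" using aF[of j] 3 by (simp add: le_less_trans)
      then show ?thesis unfolding c_def using 3 by simp
    qed
    have "(\<Sum>j<N. epowr (a j) q) \<le> epowr (ennreal m) q" for N
    proof -
      \<comment> \<open>A partial sum is finite, which is what allows it to be absorbed at the
        end.\<close>
      define S where "S = (\<Sum>j<N. c j powr q)"
      have S0: "0 \<le> S" unfolding S_def by (intro sum_nonneg) auto
      have pt: "(\<Sum>j<N. f j y * ennreal (c j powr (q - 1))) \<le> F y * ennreal (1 / q + (1 - 1 / q) * S)"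
        if fin: "F y < top" for y
      proof (cases "F y = 0")
        case True
        then have "f j y = 0" for j using fF[of j y] by simp
        then show ?thesis by simp
      next
        case False
        then obtain b where b: "F y = ennreal b" "0 < b"
          using fin by (metis ennreal_cases ennreal_0 less_eq_real_def less_irrefl)
        define \<phi> where "\<phi> j = enn2real (f j y)" for j
        have f\<phi>: "f j y = ennreal (\<phi> j)" for j
          using fF[of j y] fin unfolding \<phi>_def by (simp add: le_less_trans)
        have \<phi>0: "0 \<le> \<phi> j" for j unfolding \<phi>_def by simp
        have "(\<Sum>j<N. epowr (f j y) q) \<le> (\<Sum>j. epowr (f j y) q)"
          by (rule sum_le_suminf) auto
        also have "\<dots> = epowr (F y) q" unfolding F_def using q by (simp add: epowr_lq_norm)
        finally have "ennreal (\<Sum>j<N. \<phi> j powr q) \<le> ennreal (b powr q)"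
          using b by (simp add: f\<phi> epowr_ennreal \<phi>0)
        then have s1: "(\<Sum>j<N. (\<phi> j / b) powr q) \<le> 1"
          using b \<phi>0 by (simp add: powr_divide field_simps flip: sum_divide_distrib)
        have "(\<Sum>j<N. \<phi> j / b * c j powr (q - 1))
            \<le> (\<Sum>j<N. (\<phi> j / b) powr q / q + (1 - 1 / q) * c j powr q)"
          using \<phi>0 b c0 q by (intro sum_mono Young_powr_le) auto
        also have "\<dots> = (\<Sum>j<N. (\<phi> j / b) powr q) / q + (1 - 1 / q) * S"
          by (simp add: sum.distrib S_def sum_distrib_left sum_divide_distrib)
        also have "\<dots> \<le> 1 / q + (1 - 1 / q) * S"
          using s1 q by (simp add: divide_right_mono)
        finally have "(\<Sum>j<N. \<phi> j / b * c j powr (q - 1)) * b \<le> (1 / q + (1 - 1 / q) * S) * b"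
          using b by (intro mult_right_mono) auto
        moreover have "(\<Sum>j<N. \<phi> j / b * c j powr (q - 1)) * b = (\<Sum>j<N. \<phi> j * c j powr (q - 1))"
          using b by (simp add: sum_distrib_right)
        ultimately have "(\<Sum>j<N. \<phi> j * c j powr (q - 1)) \<le> b * (1 / q + (1 - 1 / q) * S)"
          by (simp add: mult.commute)
        then show ?thesis
          using b q S0 by (simp add: f\<phi> \<phi>0 sum_nonneg ennreal_leI del: ennreal_plus flip: ennreal_mult)
      qed
      have "AE y in M. F y < top"
        using 3 nn_integral_PInf_AE[of F M] by (simp add: less_top)
      then have "(\<integral>\<^sup>+y. (\<Sum>j<N. f j y * ennreal (c j powr (q - 1))) \<partial>M)
          \<le> (\<integral>\<^sup>+y. F y * ennreal (1 / q + (1 - 1 / q) * S) \<partial>M)"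
        by (intro nn_integral_mono_AE) (auto intro: pt)
      then have "(\<Sum>j<N. a j * ennreal (c j powr (q - 1))) \<le> ennreal m * ennreal (1 / q + (1 - 1 / q) * S)"
        by (simp add: nn_integral_sum nn_integral_multc a_def 3)
      moreover have "m * c j * c j powr (q - 1) = m * c j powr q" for j
        using c0[of j] q by (cases "c j = 0") (auto simp: powr_diff)
      ultimately have "ennreal (m * S) \<le> ennreal (m * (1 / q + (1 - 1 / q) * S))"
        using 3 q S0 c0
        by (simp add: ac S_def sum_distrib_left sum_nonneg del: ennreal_plus flip: ennreal_mult)
      then have "m * S \<le> m * (1 / q + (1 - 1 / q) * S)"
        using 3 q S0 by (subst (asm) ennreal_le_iff) auto
      then have "S \<le> 1 / q + (1 - 1 / q) * S" using 3 by simp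
      then have "S \<le> 1" using q by (simp add: field_simps)
      then have "m powr q * S \<le> m powr q" by (simp add: mult_left_le)
      then show ?thesis
        using 3 c0
        by (simp add: ac epowr_ennreal S_def powr_mult sum_distrib_left sum_nonneg)
    qed
    then have "(\<Sum>j. epowr (a j) q) \<le> epowr (ennreal m) q"
      by (intro suminf_le_const) auto
    then have "epowr (\<Sum>j. epowr (a j) q) (1 / q) \<le> epowr (epowr (ennreal m) q) (1 / q)"
      using q by (intro epowr_mono) auto
    then show ?thesis using 3 q by (simp add: lq_norm_def epowr_inverse)
  qed
  then show ?thesis by (simp add: a_def[abs_def] F_def)
qed

text \<open>Minkowski's integral inequality over the counting measure on the two Booleans.\<close>

lemma lq_norm_triangle:
  assumes "1 \<le> q"
  shows "lq_norm q (\<lambda>j. a j + b j) \<le> lq_norm q a + lq_norm q b"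
  using lq_norm_nn_integral_le[of q "\<lambda>j c. if c then a j else b j" "count_space UNIV"] assms
  by (simp add: nn_integral_count_space_finite UNIV_bool add.commute)

section \<open>The uncentred maximal function\<close>

definition ball_maximal :: "('a::euclidean_space \<Rightarrow> ennreal) \<Rightarrow> 'a \<Rightarrow> ennreal" where
  "ball_maximal g x = (SUP (z, \<rho>)\<in>{(z, \<rho>). 0 < \<rho> \<and> x \<in> ball z \<rho>}.
     (\<integral>\<^sup>+y\<in>ball z \<rho>. g y \<partial>lebesgue) / emeasure lebesgue (ball z \<rho>))"

lemma emeasure_lebesgue_ball:
  fixes z :: "'a::euclidean_space"
  assumes "0 \<le> \<rho>"
  shows "emeasure lebesgue (ball z \<rho>) = ennreal (unit_ball_vol (DIM('a)) * \<rho> ^ DIM('a))"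
  using assms emeasure_ball[of \<rho> z] by simp

lemma ball_maximal_upper:
  assumes "0 < \<rho>" "x \<in> ball z \<rho>"
  shows "(\<integral>\<^sup>+y\<in>ball z \<rho>. g y \<partial>lebesgue) / emeasure lebesgue (ball z \<rho>) \<le> ball_maximal g x"
  unfolding ball_maximal_def using assms by (intro SUP_upper2[of "(z, \<rho>)"]) auto

lemma less_ball_maximal_iff:
  "c < ball_maximal g x \<longleftrightarrow> (\<exists>z \<rho>. 0 < \<rho> \<and> x \<in> ball z \<rho> \<and>
     c < (\<integral>\<^sup>+y\<in>ball z \<rho>. g y \<partial>lebesgue) / emeasure lebesgue (ball z \<rho>))"
  (is "_ \<longleftrightarrow> ?R")
proof
  assume "c < ball_maximal g x"
  then obtain i where "i \<in> {(z, \<rho>). 0 < \<rho> \<and> x \<in> ball z \<rho>}"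
    "c < (case i of (z, \<rho>) \<Rightarrow> (\<integral>\<^sup>+y\<in>ball z \<rho>. g y \<partial>lebesgue) / emeasure lebesgue (ball z \<rho>))"
    unfolding ball_maximal_def less_SUP_iff by blast
  then show ?R by (cases i) (intro exI[of _ "fst i"] exI[of _ "snd i"], simp)
next
  assume ?R
  then obtain z \<rho> where "0 < \<rho>" "x \<in> ball z \<rho>"
    "c < (\<integral>\<^sup>+y\<in>ball z \<rho>. g y \<partial>lebesgue) / emeasure lebesgue (ball z \<rho>)" by blast
  with ball_maximal_upper[of \<rho> x z g] show "c < ball_maximal g x" by (simp only: less_le_trans)
qed

text \<open>An open ball with large average lies entirely in the superlevel set. The maximal
  function is therefore Borel measurable whatever g is.\<close>

lemma open_less_ball_maximal: "open {x. c < ball_maximal g x}"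
proof -
  let ?av = "\<lambda>i. (\<integral>\<^sup>+y\<in>ball (fst i) (snd i). g y \<partial>lebesgue) / emeasure lebesgue (ball (fst i) (snd i))"
  have "{x. c < ball_maximal g x} = (\<Union>i\<in>{i. 0 < snd i \<and> c < ?av i}. ball (fst i) (snd i))"
    unfolding less_ball_maximal_iff set_eq_iff mem_Collect_eq UN_iff Bex_def split_paired_Ex fst_conv snd_conv
    by (intro allI, simp only: conj_ac)
  also have "open \<dots>" by auto
  finally show ?thesis .
qed

lemma measurable_ball_maximal [measurable]: "ball_maximal g \<in> borel_measurable borel"
proof (rule borel_measurableI_greater)
  fix c show "{x \<in> space borel. c < ball_maximal g x} \<in> sets borel"
    using open_less_ball_maximal[of c g] by simp
qed

lemma borel_measurable_lebesgueI:
  "f \<in> borel_measurable borel \<Longrightarrow> f \<in> borel_measurable (lebesgue :: 'a::euclidean_space measure)"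
  by (rule measurable_completion) simp

lemma measurable_ball_maximal_lebesgue [measurable]: "ball_maximal g \<in> borel_measurable lebesgue"
  by (intro borel_measurable_lebesgueI measurable_ball_maximal)

text \<open>Vitali covering: among the balls with average above c, disjoint ones are selected whose
  fivefold enlargements cover the level set. The enlargement accounts for
  \<open>5 ^ DIM('a)\<close>, and disjointness bounds the sum of the local integrals by the whole
  integral.\<close>

lemma ball_maximal_weak_type:
  fixes g :: "'a::euclidean_space \<Rightarrow> ennreal"
  assumes [measurable]: "g \<in> borel_measurable lebesgue" and c: "0 < c"
  shows "emeasure lebesgue {x. ennreal c < ball_maximal g x}
    \<le> ennreal (5 ^ DIM('a) / c) * (\<integral>\<^sup>+x. g x \<partial>lebesgue)"
proof (cases "(\<integral>\<^sup>+x. g x \<partial>lebesgue) = top")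
  case True
  then show ?thesis using c by (simp add: ennreal_mult_top)
next
  case False
  then obtain J where J: "0 \<le> J" "(\<integral>\<^sup>+x. g x \<partial>lebesgue) = ennreal J"
    by (metis ennreal_cases)
  let ?n = "DIM('a)" and ?u = "unit_ball_vol (DIM('a))"
  have u: "0 < ?u" by simp
  define K where "K = {(z::'a, \<rho>). 0 < \<rho> \<and> ennreal (c * (?u * \<rho> ^ ?n)) < (\<integral>\<^sup>+y\<in>ball z \<rho>. g y \<partial>lebesgue)}"
  have K_iff: "i \<in> K \<longleftrightarrow> 0 < snd i \<and>
      ennreal c < (\<integral>\<^sup>+y\<in>ball (fst i) (snd i). g y \<partial>lebesgue) / emeasure lebesgue (ball (fst i) (snd i))" for i
  proof (cases "0 < snd i")
    case True
    have "ennreal c < y / ennreal V \<longleftrightarrow> ennreal (c * V) < y" if "0 < V" for V y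
      using that c by (cases y) (auto simp: divide_ennreal ennreal_less_iff field_simps ennreal_top_divide)
    from this[of "?u * snd i ^ ?n"] True u show ?thesis
      by (simp add: K_def split_beta emeasure_ball)
  qed (simp add: K_def split_beta)
  \<comment> \<open>Vitali's lemma needs bounded radii: the total integral \<open>J\<close> bounds
    \<rho> ^ n, and \<rho> \<le> 1 + \<rho> ^ n.\<close>
  have rB: "0 < snd i \<and> snd i \<le> 1 + J / (c * ?u)" if "i \<in> K" for i
  proof -
    have "ennreal (c * (?u * snd i ^ ?n)) < (\<integral>\<^sup>+y\<in>ball (fst i) (snd i). g y \<partial>lebesgue)"
      using that by (auto simp: K_def)
    also have "\<dots> \<le> (\<integral>\<^sup>+x. g x \<partial>lebesgue)"
      by (intro nn_integral_mono) (auto split: split_indicator)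
    finally have "c * (?u * snd i ^ ?n) < J" using J c u that
      by (subst (asm) J(2), subst (asm) ennreal_less_iff) (auto simp: K_def)
    then have "snd i ^ ?n \<le> J / (c * ?u)" using c u by (simp add: field_simps)
    moreover have "snd i \<le> 1 + snd i ^ ?n"
    proof (cases "snd i \<le> 1")
      case True
      then show ?thesis using that by (intro add_increasing2) (auto simp: K_def)
    next
      case False
      then show ?thesis using self_le_power[of "snd i" ?n] by simp
    qed
    ultimately show ?thesis using that by (auto simp: K_def)
  qed
  obtain C where C: "countable C" "C \<subseteq> K"
     "pairwise (\<lambda>i j. disjnt (cball (fst i) (snd i)) (cball (fst j) (snd j))) C"
     "\<And>i. i \<in> K \<Longrightarrow> \<exists>j. j \<in> C \<and> \<not> disjnt (cball (fst i) (snd i)) (cball (fst j) (snd j)) \<and>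
                        cball (fst i) (snd i) \<subseteq> ball (fst j) (5 * snd j)"
    using Vitali_covering_lemma_cballs_balls[of K snd "1 + J / (c * ?u)" fst, OF rB] by blast
  have pos: "0 < snd i" if "i \<in> C" for i using C that rB by blast
  have disj: "disjoint_family_on (\<lambda>i. ball (fst i) (snd i)) C"
    using C(3) unfolding disjoint_family_on_def pairwise_def disjnt_def
    by (meson disjnt_def disjnt_subset1 disjnt_subset2 ball_subset_cball)
  have sub: "{x. ennreal c < ball_maximal g x} \<subseteq> (\<Union>i\<in>C. ball (fst i) (5 * snd i))"
  proof
    fix x assume "x \<in> {x. ennreal c < ball_maximal g x}"
    then obtain z \<rho> where "x \<in> ball z \<rho>" "(z, \<rho>) \<in> K"
      unfolding less_ball_maximal_iff K_iff by auto
    with C(4)[of "(z, \<rho>)"] show "x \<in> (\<Union>i\<in>C. ball (fst i) (5 * snd i))"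
      using ball_subset_cball[of z \<rho>] by fastforce
  qed
  have "emeasure lebesgue {x. ennreal c < ball_maximal g x}
      \<le> emeasure lebesgue (\<Union>i\<in>C. ball (fst i) (5 * snd i))"
    using C(1) by (intro emeasure_mono sub sets.countable_UN') auto
  also have "\<dots> = (\<integral>\<^sup>+x. indicator (\<Union>i\<in>C. ball (fst i) (5 * snd i)) x \<partial>lebesgue)"
    using C(1) by (intro nn_integral_indicator[symmetric] sets.countable_UN') auto
  also have "\<dots> \<le> (\<integral>\<^sup>+x. (\<integral>\<^sup>+i. indicator (ball (fst i) (5 * snd i)) x \<partial>count_space C) \<partial>lebesgue)"
  proof (intro nn_integral_mono)
    fix x
    show "indicator (\<Union>i\<in>C. ball (fst i) (5 * snd i)) x
        \<le> (\<integral>\<^sup>+i. indicator (ball (fst i) (5 * snd i)) x \<partial>count_space C)"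
    proof (cases "x \<in> (\<Union>i\<in>C. ball (fst i) (5 * snd i))")
      case True
      then obtain i where i: "i \<in> C" "x \<in> ball (fst i) (5 * snd i)" by auto
      show ?thesis
        using nn_integral_ge_point[OF i(1), of "\<lambda>i. indicator (ball (fst i) (5 * snd i)) x"] i
        by (auto simp: indicator_def split: if_splits)
    qed simp
  qed
  also have "\<dots> = (\<integral>\<^sup>+i. emeasure lebesgue (ball (fst i) (5 * snd i)) \<partial>count_space C)"
    using C(1) by (subst nn_integral_count_space_nn_integral) (auto intro!: nn_integral_cong borel_measurable_indicator)
  also have "\<dots> \<le> (\<integral>\<^sup>+i. ennreal (5 ^ ?n / c) * (\<integral>\<^sup>+y\<in>ball (fst i) (snd i). g y \<partial>lebesgue) \<partial>count_space C)"
  proof (intro nn_integral_mono)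
    fix i assume "i \<in> space (count_space C)"
    then have i: "i \<in> K" "0 < snd i" using C(2) pos by auto
    have "emeasure lebesgue (ball (fst i) (5 * snd i)) = ennreal (?u * (5 * snd i) ^ ?n)"
      using i by (intro emeasure_lebesgue_ball) simp
    also have "\<dots> = ennreal (5 ^ ?n / c) * ennreal (c * (?u * snd i ^ ?n))"
      using c u i by (simp add: power_mult_distrib flip: ennreal_mult)
    also have "\<dots> \<le> ennreal (5 ^ ?n / c) * (\<integral>\<^sup>+y\<in>ball (fst i) (snd i). g y \<partial>lebesgue)"
      using i by (intro mult_left_mono) (auto simp: K_def)
    finally show "emeasure lebesgue (ball (fst i) (5 * snd i))
      \<le> ennreal (5 ^ ?n / c) * (\<integral>\<^sup>+y\<in>ball (fst i) (snd i). g y \<partial>lebesgue)" .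
  qed
  also have "\<dots> = ennreal (5 ^ ?n / c) * (\<integral>\<^sup>+i. emeasure (density lebesgue g) (ball (fst i) (snd i)) \<partial>count_space C)"
    by (subst nn_integral_cmult) (auto simp: emeasure_density)
  also have "(\<integral>\<^sup>+i. emeasure (density lebesgue g) (ball (fst i) (snd i)) \<partial>count_space C)
      = emeasure (density lebesgue g) (\<Union>i\<in>C. ball (fst i) (snd i))"
    using C(1) disj by (intro emeasure_UN_countable[symmetric]) auto
  also have "\<dots> \<le> emeasure (density lebesgue g) UNIV"
    by (intro emeasure_mono) auto
  also have "\<dots> = (\<integral>\<^sup>+x. g x \<partial>lebesgue)" by (simp add: emeasure_density)
  finally show ?thesis by (simp add: mult_left_mono)
qed

section \<open>Layer-cake formula and interpolation from truncated weak-type bounds\<close>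

lemma nn_integral_powr_below:
  assumes s: "0 < s"
  shows "(\<integral>\<^sup>+t. ennreal (t powr (s - 1)) * indicator {t. 0 < t \<and> ennreal t < R} t \<partial>lborel)
    = epowr R s / ennreal s"
proof -
  have fin: "(\<integral>\<^sup>+t. ennreal (t powr (s - 1)) * indicator {t. 0 < t \<and> ennreal t < ennreal b} t \<partial>lborel)
    = epowr (ennreal b) s / ennreal s" if b: "0 \<le> b" for b
  proof -
    have "((\<lambda>t. t powr (s - 1)) has_integral (b powr (s - 1 + 1) / (s - 1 + 1))) {0..b}"
      using s b by (intro has_integral_powr_from_0) auto
    then have "((\<lambda>t. if t \<in> {0..b} then t powr (s - 1) else 0) has_integral (b powr s / s)) UNIV"
      unfolding has_integral_restrict_UNIV by simp
    also have "(\<lambda>t. if t \<in> {0..b} then t powr (s - 1) else 0) = (\<lambda>t. t powr (s - 1) * indicator {0..b} t)"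
      by (auto simp: fun_eq_iff)
    finally have "((\<lambda>t. t powr (s - 1) * indicator {0..b} t) has_integral (b powr s / s)) UNIV" .
    then have "(\<integral>\<^sup>+t. ennreal (t powr (s - 1) * indicator {0..b} t) \<partial>lborel) = ennreal (b powr s / s)"
      by (intro nn_integral_has_integral_lborel) auto
    moreover have "(\<integral>\<^sup>+t. ennreal (t powr (s - 1)) * indicator {t. 0 < t \<and> ennreal t < ennreal b} t \<partial>lborel)
        = (\<integral>\<^sup>+t. ennreal (t powr (s - 1) * indicator {0..b} t) \<partial>lborel)"
      using AE_lborel_singleton[of b] AE_lborel_singleton[of 0]
      by (intro nn_integral_cong_AE, eventually_elim)
         (auto simp: indicator_def ennreal_less_iff)
    ultimately show ?thesis using s b by (simp add: epowr_ennreal divide_ennreal)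
  qed
  show ?thesis
  proof (cases R)
    case (real b)
    then show ?thesis using fin by simp
  next
    case top
    \<comment> \<open>Every finite value b is already attained by truncating at
      \<open>(b * s) powr (1 / s)\<close>.\<close>
    have "y \<le> (\<integral>\<^sup>+t. ennreal (t powr (s - 1)) * indicator {t. 0 < t \<and> ennreal t < top} t \<partial>lborel)"
      if y: "y < top" for y
    proof -
      obtain b where b: "y = ennreal b" "0 \<le> b" using y by (cases y) auto
      have "y = epowr (ennreal ((b * s) powr (1 / s))) s / ennreal s"
        using b s by (simp add: epowr_ennreal powr_powr divide_ennreal)
      also have "\<dots> = (\<integral>\<^sup>+t. ennreal (t powr (s - 1)) *
          indicator {t. 0 < t \<and> ennreal t < ennreal ((b * s) powr (1 / s))} t \<partial>lborel)"
        by (rule fin[symmetric]) simp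
      also have "\<dots> \<le> (\<integral>\<^sup>+t. ennreal (t powr (s - 1)) * indicator {t. 0 < t \<and> ennreal t < top} t \<partial>lborel)"
        by (intro nn_integral_mono mult_left_mono) (auto split: split_indicator)
      finally show ?thesis .
    qed
    then have "(\<integral>\<^sup>+t. ennreal (t powr (s - 1)) * indicator {t. 0 < t \<and> ennreal t < top} t \<partial>lborel) = top"
      by (rule top_le[OF dense_le])
    then show ?thesis using top by (simp add: ennreal_top_divide)
  qed
qed

lemma sigma_finite_lebesgue: "sigma_finite_measure (lebesgue :: 'a::euclidean_space measure)"
proof
  obtain A :: "'a set set" where A: "countable A" "A \<subseteq> sets lborel" "\<Union>A = space lborel"
    "\<forall>a\<in>A. emeasure lborel a \<noteq> \<infinity>"
    using lborel.sigma_finite_countable by (elim exE conjE) rule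
  have "emeasure lebesgue a \<noteq> \<infinity>" if "a \<in> A" for a
  proof -
    from that A(2) have "a \<in> sets lborel" ..
    then have "emeasure lebesgue a = emeasure lborel a" by simp
    with that A(4) show ?thesis by simp
  qed
  moreover have "A \<subseteq> sets lebesgue" using A(2) sets_completionI_sets by blast
  ultimately show "\<exists>A::'a set set. countable A \<and> A \<subseteq> sets lebesgue \<and> \<Union>A = space lebesgue
      \<and> (\<forall>a\<in>A. emeasure lebesgue a \<noteq> \<infinity>)"
    using A by (intro exI[of _ A] conjI ballI) simp_all
qed

lemma Fubini_lborel_lebesgue:
  assumes "f \<in> borel_measurable (lborel \<Otimes>\<^sub>M (lebesgue :: 'a::euclidean_space measure))"
  shows "(\<integral>\<^sup>+y. (\<integral>\<^sup>+t. f (t, y) \<partial>(lborel :: real measure)) \<partial>lebesgue) = (\<integral>\<^sup>+t. (\<integral>\<^sup>+y. f (t, y) \<partial>lebesgue) \<partial>lborel)"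
proof -
  interpret L: sigma_finite_measure "lebesgue :: 'a measure" by (rule sigma_finite_lebesgue)
  interpret pair_sigma_finite "lborel :: real measure" "lebesgue :: 'a measure" ..
  show ?thesis using Fubini[OF assms] .
qed

text \<open>
  The level sets of \<open>S\<close> are controlled by a superposition of truncations of \<open>v / t\<close>: one truncation gives the
  strong type bound for the maximal function, countably many give the bound for Orlicz maximal functions.
\<close>

lemma strong_type_from_weak:
  fixes S v :: "'a::euclidean_space \<Rightarrow> ennreal" and c a :: "nat \<Rightarrow> real"
  assumes q: "1 < q" and [measurable]: "S \<in> borel_measurable lebesgue" "v \<in> borel_measurable lebesgue"
    and c: "\<And>j. 0 \<le> c j" and a: "\<And>j. 0 < a j"
    and weak: "\<And>t. 0 < t \<Longrightarrow> emeasure lebesgue {x. ennreal t < S x} \<le>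
      B * (\<integral>\<^sup>+x. (\<Sum>j. ennreal (c j) * (v x / ennreal t * indicator {x. ennreal (a j * t) < v x} x)) \<partial>lebesgue)"
  shows "(\<integral>\<^sup>+x. epowr (S x) q \<partial>lebesgue) \<le>
    B * (\<Sum>j. ennreal (c j * a j powr (1 - q))) * ennreal (q / (q - 1)) * (\<integral>\<^sup>+x. epowr (v x) q \<partial>lebesgue)"
proof -
  have a_iff: "ennreal (a j * t) < y \<longleftrightarrow> ennreal t < y / ennreal (a j)" if "0 < t" for j t y
    using a[of j] that
    by (cases y) (auto simp: divide_ennreal ennreal_less_iff field_simps ennreal_top_divide)
  have "(\<integral>\<^sup>+x. epowr (S x) q \<partial>lebesgue)
      = ennreal q * (\<integral>\<^sup>+x. epowr (S x) q / ennreal q \<partial>lebesgue)"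
    using q by (subst nn_integral_cmult[symmetric])
      (auto simp: ennreal_times_divide ennreal_mult_divide_eq mult.commute[of "ennreal q"])
  also have "(\<integral>\<^sup>+x. epowr (S x) q / ennreal q \<partial>lebesgue) =
      (\<integral>\<^sup>+x. (\<integral>\<^sup>+t. ennreal (t powr (q - 1)) * indicator {t. 0 < t \<and> ennreal t < S x} t \<partial>lborel) \<partial>lebesgue)"
    using q by (simp add: nn_integral_powr_below)
  also have "\<dots> = (\<integral>\<^sup>+t. (\<integral>\<^sup>+x. ennreal (t powr (q - 1)) * indicator {t. 0 < t \<and> ennreal t < S x} t \<partial>lebesgue) \<partial>lborel)"
    using Fubini_lborel_lebesgue[of "\<lambda>(t, x). ennreal (t powr (q - 1)) * indicator {t. 0 < t \<and> ennreal t < S x} t"]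
    by (simp add: indicator_def)
  also have "\<dots> = (\<integral>\<^sup>+t. ennreal (t powr (q - 1)) * (indicator {0<..} t * emeasure lebesgue {x. ennreal t < S x}) \<partial>lborel)"
  proof (intro nn_integral_cong)
    fix t :: real
    have "{x \<in> space lebesgue. ennreal t < S x} \<in> sets lebesgue" by measurable
    then have st: "{x. ennreal t < S x} \<in> sets lebesgue" by simp
    have "(\<integral>\<^sup>+x. ennreal (t powr (q - 1)) * indicator {t. 0 < t \<and> ennreal t < S x} t \<partial>lebesgue)
      = (\<integral>\<^sup>+x. ennreal (t powr (q - 1)) * (indicator {0<..} t * indicator {x. ennreal t < S x} x) \<partial>lebesgue)"
      by (intro nn_integral_cong) (auto simp: indicator_def)
    then show "(\<integral>\<^sup>+x. ennreal (t powr (q - 1)) * indicator {t. 0 < t \<and> ennreal t < S x} t \<partial>lebesgue)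
      = ennreal (t powr (q - 1)) * (indicator {0<..} t * emeasure lebesgue {x. ennreal t < S x})"
      by (simp add: nn_integral_cmult st nn_integral_indicator[OF st] del: nn_integral_indicator)
  qed
  also have "\<dots> \<le> (\<integral>\<^sup>+t. ennreal (t powr (q - 1)) * (indicator {0<..} t *
      (B * (\<integral>\<^sup>+x. (\<Sum>j. ennreal (c j) * (v x / ennreal t * indicator {x. ennreal (a j * t) < v x} x)) \<partial>lebesgue))) \<partial>lborel)"
  proof (rule nn_integral_mono, rule mult_left_mono)
    fix t :: real
    show "indicator {0<..} t * emeasure lebesgue {x. ennreal t < S x} \<le> indicator {0<..} t *
      (B * (\<integral>\<^sup>+x. (\<Sum>j. ennreal (c j) * (v x / ennreal t * indicator {x. ennreal (a j * t) < v x} x)) \<partial>lebesgue))"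
      using weak[of t] by (cases "0 < t") auto
  qed simp
  also have "\<dots> = (\<integral>\<^sup>+t. B * (\<integral>\<^sup>+x. (\<Sum>j. ennreal (c j) * v x *
      (ennreal (t powr (q - 1 - 1)) * indicator {t. 0 < t \<and> ennreal t < v x / ennreal (a j)} t)) \<partial>lebesgue) \<partial>lborel)"
  proof (intro nn_integral_cong)
    fix t :: real
    show "ennreal (t powr (q - 1)) * (indicator {0<..} t *
      (B * (\<integral>\<^sup>+x. (\<Sum>j. ennreal (c j) * (v x / ennreal t * indicator {x. ennreal (a j * t) < v x} x)) \<partial>lebesgue))) =
      B * (\<integral>\<^sup>+x. (\<Sum>j. ennreal (c j) * v x *
        (ennreal (t powr (q - 1 - 1)) * indicator {t. 0 < t \<and> ennreal t < v x / ennreal (a j)} t)) \<partial>lebesgue)"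
    proof (cases "0 < t")
      case True
      have e: "ennreal (t powr (q - 1)) = ennreal (t powr (q - 1 - 1)) * ennreal t"
        using True by (simp add: powr_diff power2_eq_square flip: ennreal_mult)
      have *: "ennreal (t powr (q - 1)) * (y / ennreal t) = y * ennreal (t powr (q - 1 - 1))" for y
      proof -
        have "ennreal t * (y / ennreal t) = y"
          using True by (simp add: ennreal_times_divide ennreal_mult_divide_eq mult.commute)
        then show ?thesis by (simp only: e mult.assoc mult.commute[of y])
      qed
      have "ennreal (t powr (q - 1)) * (\<integral>\<^sup>+x. (\<Sum>j. ennreal (c j) * (v x / ennreal t * indicator {x. ennreal (a j * t) < v x} x)) \<partial>lebesgue)
        = (\<integral>\<^sup>+x. (\<Sum>j. ennreal (c j) * ((ennreal (t powr (q - 1)) * (v x / ennreal t)) * indicator {x. ennreal (a j * t) < v x} x)) \<partial>lebesgue)"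
        by (subst nn_integral_cmult[symmetric])
           (auto simp: ennreal_suminf_cmult[symmetric] mult_ac simp del: ennreal_suminf_cmult)
      also have "\<dots> = (\<integral>\<^sup>+x. (\<Sum>j. ennreal (c j) * v x *
        (ennreal (t powr (q - 1 - 1)) * indicator {t. 0 < t \<and> ennreal t < v x / ennreal (a j)} t)) \<partial>lebesgue)"
        unfolding * using True by (simp add: a_iff indicator_def mult.assoc)
      finally show ?thesis using True by (simp add: mult.left_commute)
    qed (simp add: indicator_def)
  qed
  also have "\<dots> = B * (\<integral>\<^sup>+t. (\<integral>\<^sup>+x. (\<Sum>j. ennreal (c j) * v x *
      (ennreal (t powr (q - 1 - 1)) * indicator {t. 0 < t \<and> ennreal t < v x / ennreal (a j)} t)) \<partial>lebesgue) \<partial>lborel)"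
  proof (rule nn_integral_cmult)
    interpret L: sigma_finite_measure "lebesgue :: 'a measure" by (rule sigma_finite_lebesgue)
    show "(\<lambda>t. \<integral>\<^sup>+x. (\<Sum>j. ennreal (c j) * v x *
      (ennreal (t powr (q - 1 - 1)) * indicator {t. 0 < t \<and> ennreal t < v x / ennreal (a j)} t)) \<partial>lebesgue)
      \<in> borel_measurable lborel"
      unfolding indicator_def by measurable
  qed
  also have "(\<integral>\<^sup>+t. (\<integral>\<^sup>+x. (\<Sum>j. ennreal (c j) * v x *
      (ennreal (t powr (q - 1 - 1)) * indicator {t. 0 < t \<and> ennreal t < v x / ennreal (a j)} t)) \<partial>lebesgue) \<partial>lborel)
    = (\<integral>\<^sup>+x. (\<integral>\<^sup>+t. (\<Sum>j. ennreal (c j) * v x *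
      (ennreal (t powr (q - 1 - 1)) * indicator {t. 0 < t \<and> ennreal t < v x / ennreal (a j)} t)) \<partial>lborel) \<partial>lebesgue)"
    using Fubini_lborel_lebesgue[of "\<lambda>(t, x). \<Sum>j. ennreal (c j) * v x *
      (ennreal (t powr (q - 1 - 1)) * indicator {t. 0 < t \<and> ennreal t < v x / ennreal (a j)} t)"]
    by (simp add: indicator_def)
  \<comment> \<open>The inner integral in t is again a layer-cake integral, now with exponent q - 1:
    one power of t was spent on the quotient v / t.\<close>
  also have "\<dots> = (\<integral>\<^sup>+x. (\<Sum>j. ennreal (c j) * v x * (epowr (v x / ennreal (a j)) (q - 1) / ennreal (q - 1))) \<partial>lebesgue)"
  proof -
    have "(\<integral>\<^sup>+t. ennreal (t powr (q - 2)) * indicator {t. 0 < t \<and> ennreal t < R} t \<partial>lborel)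
        = epowr R (q - 1) / ennreal (q - 1)" for R
      using nn_integral_powr_below[of "q - 1" R] q by simp
    then show ?thesis by (subst nn_integral_suminf) (auto simp: nn_integral_cmult)
  qed
  also have "\<dots> = (\<integral>\<^sup>+x. (\<Sum>j. ennreal (c j * a j powr (1 - q))) * (epowr (v x) q / ennreal (q - 1)) \<partial>lebesgue)"
  proof (intro nn_integral_cong)
    fix x
    have "ennreal (c j) * v x * (epowr (v x / ennreal (a j)) (q - 1) / ennreal (q - 1))
        = ennreal (c j * a j powr (1 - q)) * (epowr (v x) q / ennreal (q - 1))" for j
    proof (cases "v x")
      case (real b)
      have "b * (b / a j) powr (q - 1) = a j powr (1 - q) * b powr q"
        using real a[of j] q by (cases "b = 0") (auto simp: powr_divide powr_diff field_simps)
      then show ?thesis using real a[of j] q c[of j]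
        by (simp add: divide_ennreal epowr_ennreal flip: ennreal_mult)
    next
      case top
      then show ?thesis using a[of j] q c[of j]
        by (cases "c j = 0") (simp_all add: ennreal_top_divide ennreal_mult_top)
    qed
    then show "(\<Sum>j. ennreal (c j) * v x * (epowr (v x / ennreal (a j)) (q - 1) / ennreal (q - 1)))
      = (\<Sum>j. ennreal (c j * a j powr (1 - q))) * (epowr (v x) q / ennreal (q - 1))"
      by simp
  qed
  also have "\<dots> = (\<Sum>j. ennreal (c j * a j powr (1 - q))) * ((\<integral>\<^sup>+x. epowr (v x) q \<partial>lebesgue) / ennreal (q - 1))"
    by (simp add: nn_integral_cmult nn_integral_divide)
  finally have "(\<integral>\<^sup>+x. epowr (S x) q \<partial>lebesgue) \<le> ennreal q * (B *
      ((\<Sum>j. ennreal (c j * a j powr (1 - q))) * ((\<integral>\<^sup>+x. epowr (v x) q \<partial>lebesgue) / ennreal (q - 1))))"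
    by (simp add: mult_left_mono)
  also have "\<dots> = B * (\<Sum>j. ennreal (c j * a j powr (1 - q))) * (ennreal q / ennreal (q - 1)) * (\<integral>\<^sup>+x. epowr (v x) q \<partial>lebesgue)"
    by (simp add: divide_ennreal_def mult_ac)
  finally show ?thesis using q by (simp add: divide_ennreal)
qed

section \<open>Triadic cells and stopping cells\<close>

text \<open>
  The grid is triadic, with cells centred at multiples of their side: the cells around the origin
  then exhaust the whole space, which dyadic cells do not.
\<close>

definition cell_index :: "real \<Rightarrow> real ^ 'n \<Rightarrow> int ^ 'n" where
  "cell_index s x = (\<chi> i. \<lfloor>x $ i / s + 1 / 2\<rfloor>)"

definition side :: "real \<Rightarrow> nat \<times> (int ^ 'n) \<Rightarrow> real" where
  "side L c = L / 3 ^ fst c"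

definition cell :: "real \<Rightarrow> nat \<times> (int ^ 'n) \<Rightarrow> (real ^ 'n) set" where
  "cell L c = {x. cell_index (side L c) x = snd c}"

definition center :: "real \<Rightarrow> nat \<times> (int ^ 'n) \<Rightarrow> real ^ 'n" where
  "center L c = (\<chi> i. side L c * of_int (snd c $ i))"

definition cell_at :: "real \<Rightarrow> nat \<Rightarrow> real ^ 'n \<Rightarrow> nat \<times> (int ^ 'n)" where
  "cell_at L k x = (k, cell_index (L / 3 ^ k) x)"

lemma side_pos: "0 < L \<Longrightarrow> 0 < side L c"
  by (simp add: side_def)

lemma fst_cell_at [simp]: "fst (cell_at L k x) = k"
  by (simp add: cell_at_def)

lemma mem_cell_iff: "x \<in> cell L c \<longleftrightarrow> cell_at L (fst c) x = c"
  by (cases c) (simp add: cell_def cell_at_def side_def)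

lemma mem_cell_at: "x \<in> cell L (cell_at L k x)"
  by (simp add: mem_cell_iff)

text \<open>The children of index k have the indices 3k - 1, 3k, 3k + 1 in each coordinate, hence
  the shift by one before the division. This makes cells centred at multiples of their side
  nest.\<close>

lemma cell_index_mult_3:
  fixes x :: "real ^ 'n"
  shows "cell_index (3 * s) x = (\<chi> i. (cell_index s x $ i + 1) div 3)"
proof -
  have "\<lfloor>x $ i / (3 * s) + 1 / 2\<rfloor> = (\<lfloor>x $ i / s + 1 / 2\<rfloor> + 1) div 3" for i
  proof -
    have "\<lfloor>x $ i / (3 * s) + 1 / 2\<rfloor> = \<lfloor>(x $ i / s + 1 / 2 + 1) / real_of_int 3\<rfloor>"
      by (rule arg_cong[of _ _ floor]) (simp add: add_divide_distrib)
    also have "\<dots> = \<lfloor>x $ i / s + 1 / 2 + 1\<rfloor> div 3"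
      by (rule floor_divide_real_eq_div) simp
    also have "\<lfloor>x $ i / s + 1 / 2 + 1\<rfloor> = \<lfloor>x $ i / s + 1 / 2\<rfloor> + 1" by linarith
    finally show ?thesis .
  qed
  then show ?thesis by (simp add: cell_index_def vec_eq_iff)
qed

lemma cell_at_eq_mono:
  fixes x y :: "real ^ 'n"
  assumes "cell_at L k x = cell_at L k y" "j \<le> k"
  shows "cell_at L j x = cell_at L j y"
  using assms(2,1)
proof (induction k rule: dec_induct)
  case (step k)
  have "cell_index (L / 3 ^ k) z = (\<chi> i. (cell_index (L / 3 ^ Suc k) z $ i + 1) div 3)" for z :: "real ^ 'n"
    using cell_index_mult_3[of "L / 3 ^ Suc k" z] by simp
  moreover have "cell_index (L / 3 ^ Suc k) x = cell_index (L / 3 ^ Suc k) y"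
    using step.prems unfolding cell_at_def prod.inject by (rule conjunct2)
  ultimately have "cell_at L k x = cell_at L k y" by (simp only: cell_at_def)
  then show ?case by (rule step.IH)
qed simp

lemma cell_subset_cell:
  assumes "x \<in> cell L c" "x \<in> cell L d" "fst c \<le> fst d"
  shows "cell L d \<subseteq> cell L c"
proof
  fix y assume "y \<in> cell L d"
  then have "cell_at L (fst d) y = cell_at L (fst d) x" using assms(2) by (simp add: mem_cell_iff)
  then have "cell_at L (fst c) y = cell_at L (fst c) x" using assms(3) by (rule cell_at_eq_mono)
  then show "y \<in> cell L c" using assms(1) by (simp add: mem_cell_iff)
qed

lemma mem_cell_component:
  assumes "0 < L" "x \<in> cell L c"
  shows "center L c $ i - side L c / 2 \<le> x $ i" "x $ i < center L c $ i + side L c / 2"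
proof -
  have "\<lfloor>x $ i / side L c + 1 / 2\<rfloor> = snd c $ i"
    using assms(2) by (simp add: cell_def cell_index_def vec_eq_iff)
  then have "of_int (snd c $ i) \<le> x $ i / side L c + 1 / 2" "x $ i / side L c + 1 / 2 < of_int (snd c $ i) + 1"
    by linarith+
  then show "center L c $ i - side L c / 2 \<le> x $ i" "x $ i < center L c $ i + side L c / 2"
    using side_pos[OF assms(1), of c] by (simp_all add: center_def field_simps)
qed

lemma mem_cellI:
  assumes "0 < L" "\<And>i. center L c $ i - side L c / 2 \<le> x $ i" "\<And>i. x $ i < center L c $ i + side L c / 2"
  shows "x \<in> cell L c"
proof -
  have "\<lfloor>x $ i / side L c + 1 / 2\<rfloor> = snd c $ i" for i
    using assms(2,3)[of i] side_pos[OF assms(1), of c]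
    by (intro floor_unique) (simp_all add: center_def field_simps)
  then show ?thesis by (simp add: cell_def cell_index_def vec_eq_iff)
qed

text \<open>The Euclidean norm is bounded by the sum of the coordinates, at the price of the factor
  n = \<open>CARD('n)\<close>; this is why the radii below are multiples of n times the
  side.\<close>

lemma dist_center_le:
  fixes x :: "real ^ 'n"
  assumes "0 < L" "x \<in> cell L c"
  shows "dist x (center L c) \<le> CARD('n) * side L c / 2"
proof -
  have "\<bar>(x - center L c) $ i\<bar> \<le> side L c / 2" for i
    using mem_cell_component[OF assms, of i] unfolding vector_minus_component by linarith
  then have "(\<Sum>i\<in>UNIV. \<bar>(x - center L c) $ i\<bar>) \<le> (\<Sum>i\<in>(UNIV :: 'n set). side L c / 2)"
    by (intro sum_mono)
  then show ?thesis using norm_le_l1_cart[of "x - center L c"] by (simp add: dist_norm)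
qed

lemma dist_cell_le:
  fixes x :: "real ^ 'n"
  assumes "0 < L" "x \<in> cell L c" "y \<in> cell L c"
  shows "dist x y \<le> CARD('n) * side L c"
  using dist_center_le[OF assms(1,2)] dist_center_le[OF assms(1,3)] dist_triangle2[of x y "center L c"]
  by simp

lemma sets_cell [measurable, simp]:
  fixes c :: "nat \<times> (int ^ 'n)"
  shows "cell L c \<in> sets borel"
proof -
  have "cell L c = (\<Inter>i\<in>UNIV. {x. \<lfloor>x $ i / side L c + 1 / 2\<rfloor> = snd c $ i})"
    by (auto simp: cell_def cell_index_def vec_eq_iff)
  also have "\<dots> \<in> sets borel"
  proof (intro sets.finite_INT)
    fix i :: 'n
    have "{x \<in> space borel. \<lfloor>(x :: real ^ 'n) $ i / side L c + 1 / 2\<rfloor> = snd c $ i} \<in> sets borel"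
      by measurable
    then show "{x. \<lfloor>x $ i / side L c + 1 / 2\<rfloor> = snd c $ i} \<in> sets borel" by simp
  qed auto
  finally show ?thesis .
qed

lemma emeasure_cbox_cube:
  fixes z :: "real ^ 'n"
  assumes "0 \<le> s"
  shows "emeasure lborel (cbox (z - (\<chi> i. s / 2)) (z + (\<chi> i. s / 2))) = ennreal (s ^ CARD('n))"
    and "emeasure lborel (box (z - (\<chi> i. s / 2)) (z + (\<chi> i. s / 2))) = ennreal (s ^ CARD('n))"
proof -
  have "(\<Prod>b\<in>Basis. ((z + (\<chi> i. s / 2)) - (z - (\<chi> i. s / 2))) \<bullet> b) = (\<Prod>b\<in>(Basis :: (real ^ 'n) set). s)"
    by (intro prod.cong) (auto simp: Basis_vec_def inner_axis)
  then have *: "(\<Prod>b\<in>Basis. ((z + (\<chi> i. s / 2)) - (z - (\<chi> i. s / 2))) \<bullet> b) = s ^ CARD('n)"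
    by simp
  have le: "(z - (\<chi> i. s / 2)) \<bullet> b \<le> (z + (\<chi> i. s / 2)) \<bullet> b" if "b \<in> Basis" for b
    using that assms by (auto simp: Basis_vec_def inner_axis)
  show "emeasure lborel (cbox (z - (\<chi> i. s / 2)) (z + (\<chi> i. s / 2))) = ennreal (s ^ CARD('n))"
    using emeasure_lborel_cbox[OF le] unfolding * .
  show "emeasure lborel (box (z - (\<chi> i. s / 2)) (z + (\<chi> i. s / 2))) = ennreal (s ^ CARD('n))"
    using emeasure_lborel_box[OF le] unfolding * .
qed

lemma emeasure_cell:
  fixes c :: "nat \<times> (int ^ 'n)"
  assumes "0 < L"
  shows "emeasure lborel (cell L c) = ennreal (side L c ^ CARD('n))"
proof (rule antisym)
  have s: "0 \<le> side L c" using side_pos[OF assms, of c] by simp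
  let ?h = "(\<chi> i. side L c / 2) :: real ^ 'n"
  have "cell L c \<subseteq> cbox (center L c - ?h) (center L c + ?h)"
  proof
    fix x assume x: "x \<in> cell L c"
    have "center L c $ i - side L c / 2 \<le> x $ i \<and> x $ i \<le> center L c $ i + side L c / 2" for i
      using mem_cell_component[OF assms x, of i] by simp
    then show "x \<in> cbox (center L c - ?h) (center L c + ?h)" by (simp add: mem_box_cart)
  qed
  then have "emeasure lborel (cell L c) \<le> emeasure lborel (cbox (center L c - ?h) (center L c + ?h))"
    by (rule emeasure_mono) simp
  then show "emeasure lborel (cell L c) \<le> ennreal (side L c ^ CARD('n))"
    by (simp only: emeasure_cbox_cube(1)[OF s])
  have "box (center L c - ?h) (center L c + ?h) \<subseteq> cell L c"
  proof
    fix x assume "x \<in> box (center L c - ?h) (center L c + ?h)"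
    then have "center L c $ i - side L c / 2 < x $ i \<and> x $ i < center L c $ i + side L c / 2" for i
      by (simp add: mem_box_cart)
    then show "x \<in> cell L c" using assms by (intro mem_cellI) (simp_all add: less_imp_le)
  qed
  then have "emeasure lborel (box (center L c - ?h) (center L c + ?h)) \<le> emeasure lborel (cell L c)"
    by (rule emeasure_mono) simp
  then show "ennreal (side L c ^ CARD('n)) \<le> emeasure lborel (cell L c)"
    by (simp only: emeasure_cbox_cube(2)[OF s])
qed

lemma cell_lmeasurable [simp]: "0 < L \<Longrightarrow> cell L c \<in> lmeasurable"
  by (simp add: fmeasurable_def emeasure_cell)

lemma measure_cell:
  fixes c :: "nat \<times> (int ^ 'n)"
  shows "0 < L \<Longrightarrow> measure lebesgue (cell L c) = side L c ^ CARD('n)"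
  using side_pos[of L c] by (simp add: measure_def emeasure_cell)

text \<open>Calderon-Zygmund decomposition of the indicator of U inside c at the density 1 / (2 * 3
  ^ n): the selected cells are the largest ones that exceed it. The factor 3 ^ n is lost between a
  selected cell and its parent, which does not exceed it. The density of U in c is at most half of
  the threshold, which yields the total measure of the selected cells.\<close>

lemma stopping_cells:
  fixes c :: "nat \<times> (int ^ 'n)"
  assumes L: "0 < L" and U: "open U"
    and small: "measure lebesgue (cell L c \<inter> U) \<le> measure lebesgue (cell L c) / (4 * 3 ^ CARD('n))"
  obtains P where "\<And>d. d \<in> P \<Longrightarrow> cell L d \<subseteq> cell L c" "\<And>d. d \<in> P \<Longrightarrow> fst c < fst d" "disjoint_family_on (cell L) P"
    "cell L c \<inter> U \<subseteq> (\<Union>d\<in>P. cell L d)"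
    "\<And>d. d \<in> P \<Longrightarrow> measure lebesgue (cell L d \<inter> U) \<le> measure lebesgue (cell L d) / 2"
    "emeasure lebesgue (\<Union>d\<in>P. cell L d) \<le> ennreal (measure lebesgue (cell L c) / 2)"
proof -
  let ?n = "CARD('n)"
  define bad where "bad d \<longleftrightarrow> measure lebesgue (cell L d) < 2 * 3 ^ ?n * measure lebesgue (cell L d \<inter> U)"
    for d :: "nat \<times> (int ^ 'n)"
  have V: "0 < measure lebesgue (cell L d)" for d :: "nat \<times> (int ^ 'n)"
    using side_pos[OF L, of d] unfolding measure_cell[OF L] by simp
  have Ubor [measurable]: "U \<in> sets borel" using U by simp
  have mI: "cell L d \<inter> U \<in> lmeasurable" for d :: "nat \<times> (int ^ 'n)"
    using U L by (intro fmeasurable_Int_fmeasurable) auto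
  have notbad: "\<not> bad c" using small V[of c] by (simp add: bad_def field_simps)
  define P where "P = {d. \<exists>x\<in>cell L c. cell_at L (fst d) x = d \<and> fst c < fst d \<and> bad d \<and>
      (\<forall>i. fst c \<le> i \<and> i < fst d \<longrightarrow> \<not> bad (cell_at L i x))}"
  have PD: "y \<in> cell L c" "fst c < fst d" "bad d" "\<And>i. fst c \<le> i \<Longrightarrow> i < fst d \<Longrightarrow> \<not> bad (cell_at L i y)"
    if dP: "d \<in> P" and yd: "y \<in> cell L d" for d y
  proof -
    obtain x where x: "x \<in> cell L c" "cell_at L (fst d) x = d" "fst c < fst d" "bad d"
      "\<And>i. fst c \<le> i \<Longrightarrow> i < fst d \<Longrightarrow> \<not> bad (cell_at L i x)"
      using dP unfolding P_def by blast
    have eq: "cell_at L i y = cell_at L i x" if "i \<le> fst d" for i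
      using cell_at_eq_mono[of L "fst d" y x i] that x(2) yd by (simp add: mem_cell_iff)
    show "y \<in> cell L c" using x(1,3) eq[of "fst c"] by (simp add: mem_cell_iff)
    show "fst c < fst d" "bad d" by fact+
    show "\<not> bad (cell_at L i y)" if "fst c \<le> i" "i < fst d" for i
      using x(5)[OF that] eq[of i] that by simp
  qed
  \<comment> \<open>As U is open, small cells around a point of U lie in U and are bad. So every
    point is covered, not merely almost every one, and no differentiation of integrals is
    involved.\<close>
  have cover: "\<exists>d\<in>P. x \<in> cell L d" if x: "x \<in> cell L c" "x \<in> U" for x
  proof -
    obtain \<epsilon> where \<epsilon>: "0 < \<epsilon>" "ball x \<epsilon> \<subseteq> U" using U x(2) open_contains_ball by blast
    have "(\<lambda>k. ?n * (L / 3 ^ k)) \<longlonglongrightarrow> ?n * (L * 0)"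
      using LIMSEQ_inverse_realpow_zero[of 3] unfolding divide_inverse
      by (intro tendsto_mult tendsto_const) (simp add: power_inverse)
    then have "eventually (\<lambda>k. ?n * (L / 3 ^ k) < \<epsilon>) sequentially"
      using \<epsilon>(1) by (simp add: order_tendstoD)
    then obtain k0 where k0: "\<And>k. k0 \<le> k \<Longrightarrow> ?n * (L / 3 ^ k) < \<epsilon>"
      unfolding eventually_sequentially by blast
    define k where "k = max k0 (fst c)"
    have "cell L (cell_at L k x) \<subseteq> ball x \<epsilon>"
    proof
      fix y assume "y \<in> cell L (cell_at L k x)"
      then have "dist x y \<le> ?n * side L (cell_at L k x)" using L mem_cell_at by (intro dist_cell_le)
      also have "\<dots> < \<epsilon>" using k0[of k] by (simp add: side_def k_def)
      finally show "y \<in> ball x \<epsilon>" by simp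
    qed
    then have "cell L (cell_at L k x) \<inter> U = cell L (cell_at L k x)" using \<epsilon> by blast
    moreover have "1 < 2 * (3::real) ^ ?n" using one_le_power[of "3::real" ?n] by linarith
    ultimately have "bad (cell_at L k x)" using V[of "cell_at L k x"] by (simp add: bad_def)
    then have ex: "fst c \<le> k \<and> bad (cell_at L k x)" by (simp add: k_def)
    define j where "j = (LEAST j. fst c \<le> j \<and> bad (cell_at L j x))"
    have j: "fst c \<le> j" "bad (cell_at L j x)"
      using LeastI[of "\<lambda>j. fst c \<le> j \<and> bad (cell_at L j x)", OF ex] by (auto simp: j_def)
    have "\<not> bad (cell_at L i x)" if "fst c \<le> i" "i < j" for i
      using not_less_Least[of i "\<lambda>j. fst c \<le> j \<and> bad (cell_at L j x)"] that by (auto simp: j_def)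
    moreover have "j \<noteq> fst c" using j notbad x(1) by (auto simp: mem_cell_iff)
    ultimately have "cell_at L j x \<in> P" using j x(1) unfolding P_def by auto
    then show ?thesis using mem_cell_at by blast
  qed
  show ?thesis
  proof (rule that[of P])
    show "cell L d \<subseteq> cell L c" if "d \<in> P" for d using PD(1) that by blast
    show "fst c < fst d" if d: "d \<in> P" for d
    proof -
      obtain y where "y \<in> cell L d" using d unfolding P_def by (auto simp: mem_cell_iff)
      then show ?thesis by (rule PD(2)[OF d])
    qed
    show disj: "disjoint_family_on (cell L) P"
      unfolding disjoint_family_on_def
    proof (intro ballI impI, rule ccontr)
      fix d e assume de: "d \<in> P" "e \<in> P" "d \<noteq> e" "cell L d \<inter> cell L e \<noteq> {}"
      then obtain y where y: "y \<in> cell L d" "y \<in> cell L e" by auto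
      have "fst d = fst e"
      proof (rule linorder_cases)
        assume "fst d < fst e"
        then have "\<not> bad (cell_at L (fst d) y)"
          using PD(2)[OF de(1) y(1)] by (intro PD(4)[OF de(2) y(2)]) auto
        then show ?thesis using PD(3)[OF de(1) y(1)] y by (simp add: mem_cell_iff)
      next
        assume "fst e < fst d"
        then have "\<not> bad (cell_at L (fst e) y)"
          using PD(2)[OF de(2) y(2)] by (intro PD(4)[OF de(1) y(1)]) auto
        then show ?thesis using PD(3)[OF de(2) y(2)] y by (simp add: mem_cell_iff)
      qed
      then show False using y de(3) by (simp add: mem_cell_iff)
    qed
    show "cell L c \<inter> U \<subseteq> (\<Union>d\<in>P. cell L d)" using cover by auto
    show "measure lebesgue (cell L d \<inter> U) \<le> measure lebesgue (cell L d) / 2" if d: "d \<in> P" for d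
    proof -
      obtain y where y: "y \<in> cell L d" using d unfolding P_def by (auto simp: mem_cell_iff)
      \<comment> \<open>The parent of d, which is not bad. Its measure is 3 ^ n times that of d, so
        density 1 / (2 * 3 ^ n) in the parent becomes density 1 / 2 in d.\<close>
      define e where "e = cell_at L (fst d - 1) y"
      have fd: "fst c < fst d" using PD(2)[OF d y] .
      then have nb: "\<not> bad e" unfolding e_def by (intro PD(4)[OF d y]) auto
      have "cell L d \<subseteq> cell L e"
        using cell_subset_cell[of y L e d] y by (simp add: e_def mem_cell_at)
      then have "measure lebesgue (cell L d \<inter> U) \<le> measure lebesgue (cell L e \<inter> U)"
        by (intro measure_mono_fmeasurable mI) auto
      moreover have "side L e = 3 * side L d"
        using fd by (cases "fst d") (auto simp: e_def side_def)
      then have "measure lebesgue (cell L e) = 3 ^ ?n * measure lebesgue (cell L d)"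
        unfolding measure_cell[OF L] by (simp add: power_mult_distrib)
      ultimately show ?thesis using nb by (simp add: bad_def)
    qed
    have cnt: "countable P" by simp
    have "emeasure lebesgue (\<Union>d\<in>P. cell L d) = (\<integral>\<^sup>+d. emeasure lebesgue (cell L d) \<partial>count_space P)"
      using disj cnt by (intro emeasure_UN_countable) auto
    also have "\<dots> \<le> (\<integral>\<^sup>+d. ennreal (2 * 3 ^ ?n) * emeasure lebesgue (cell L d \<inter> U) \<partial>count_space P)"
    proof (intro nn_integral_mono)
      fix d assume "d \<in> space (count_space P)"
      then have "d \<in> P" by simp
      moreover then obtain y where y: "y \<in> cell L d" unfolding P_def by (auto simp: mem_cell_iff)
      ultimately have "bad d" by (rule PD(3))
      then show "emeasure lebesgue (cell L d) \<le> ennreal (2 * 3 ^ ?n) * emeasure lebesgue (cell L d \<inter> U)"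
        using mI[of d] cell_lmeasurable[OF L, of d]
        by (simp add: emeasure_eq_measure2 bad_def ennreal_leI flip: ennreal_mult)
    qed
    also have "\<dots> = ennreal (2 * 3 ^ ?n) * (\<integral>\<^sup>+d. emeasure lebesgue (cell L d \<inter> U) \<partial>count_space P)"
      by (simp add: nn_integral_cmult)
    also have "(\<integral>\<^sup>+d. emeasure lebesgue (cell L d \<inter> U) \<partial>count_space P) = emeasure lebesgue (\<Union>d\<in>P. cell L d \<inter> U)"
    proof (intro emeasure_UN_countable[symmetric] cnt)
      show "disjoint_family_on (\<lambda>d. cell L d \<inter> U) P"
        using disj unfolding disjoint_family_on_def by blast
    qed (use Ubor in auto)
    also have "\<dots> \<le> emeasure lebesgue (cell L c \<inter> U)"
      using PD(1) Ubor by (intro emeasure_mono) auto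
    also have "\<dots> = ennreal (measure lebesgue (cell L c \<inter> U))"
      using mI[of c] by (rule emeasure_eq_measure2)
    also have "ennreal (2 * 3 ^ ?n) * \<dots> = ennreal (2 * 3 ^ ?n * measure lebesgue (cell L c \<inter> U))"
      by (simp add: ennreal_mult)
    also have "\<dots> \<le> ennreal (measure lebesgue (cell L c) / 2)"
      using small by (intro ennreal_leI) (simp add: field_simps)
    finally show "emeasure lebesgue (\<Union>d\<in>P. cell L d) \<le> ennreal (measure lebesgue (cell L c) / 2)"
      by (simp add: mult_left_mono)
  qed
qed

section \<open>Iteration over stopping cells\<close>

lemma nn_integral_disjoint_UN:
  assumes "countable I" "disjoint_family_on A I" and [measurable]: "f \<in> borel_measurable M"
    and "\<And>i. i \<in> I \<Longrightarrow> A i \<in> sets M"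
  shows "(\<integral>\<^sup>+i. (\<integral>\<^sup>+x\<in>A i. f x \<partial>M) \<partial>count_space I) = (\<integral>\<^sup>+x\<in>(\<Union>i\<in>I. A i). f x \<partial>M)"
proof -
  have "(\<integral>\<^sup>+i. (\<integral>\<^sup>+x\<in>A i. f x \<partial>M) \<partial>count_space I) = (\<integral>\<^sup>+i. emeasure (density M f) (A i) \<partial>count_space I)"
    using assms by (intro nn_integral_cong) (simp add: emeasure_density)
  also have "\<dots> = emeasure (density M f) (\<Union>i\<in>I. A i)"
    using assms by (intro emeasure_UN_countable[symmetric]) auto
  also have "\<dots> = (\<integral>\<^sup>+x\<in>(\<Union>i\<in>I. A i). f x \<partial>M)"
    using assms by (intro emeasure_density sets.countable_UN') auto
  finally show ?thesis .
qed

lemma nn_integral_Diff_add: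
  assumes [measurable]: "f \<in> borel_measurable M" "A \<in> sets M" "B \<in> sets M" and "B \<subseteq> A"
  shows "(\<integral>\<^sup>+x\<in>A - B. f x \<partial>M) + (\<integral>\<^sup>+x\<in>B. f x \<partial>M) = (\<integral>\<^sup>+x\<in>A. f x \<partial>M)"
  using \<open>B \<subseteq> A\<close> by (subst nn_integral_add[symmetric]) (auto intro!: nn_integral_cong split: split_indicator)

definition cell_average :: "real \<Rightarrow> (real ^ 'n \<Rightarrow> ennreal) \<Rightarrow> nat \<times> (int ^ 'n) \<Rightarrow> ennreal" where
  "cell_average L h c = (\<integral>\<^sup>+x\<in>cell L c. h x \<partial>lebesgue) / emeasure lebesgue (cell L c)"

definition cell_maximal ::
  "real \<Rightarrow> (nat \<times> (int ^ 'n) \<Rightarrow> ennreal) \<Rightarrow> real ^ 'n \<Rightarrow> ennreal" where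
  "cell_maximal L b x = (SUP c. b c * indicator (cell L c) x)"

lemma measurable_cell_maximal [measurable]: "cell_maximal L b \<in> borel_measurable borel"
proof -
  have "(\<lambda>x. SUP c. b c * indicator (cell L c) x) \<in> borel_measurable borel"
    by (intro borel_measurable_SUP) auto
  then show ?thesis by (simp add: cell_maximal_def[abs_def])
qed

lemma cell_maximal_upper: "x \<in> cell L c \<Longrightarrow> b c \<le> cell_maximal L b x"
  unfolding cell_maximal_def by (intro SUP_upper2[of c]) auto

lemma cell_maximal_least:
  assumes "\<And>c. x \<in> cell L c \<Longrightarrow> b c \<le> y"
  shows "cell_maximal L b x \<le> y"
  unfolding cell_maximal_def using assms by (intro SUP_least) (auto split: split_indicator)

lemma less_cell_maximal_iff: "y < cell_maximal L b x \<longleftrightarrow> (\<exists>c. x \<in> cell L c \<and> y < b c)"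
  unfolding cell_maximal_def less_SUP_iff by (auto split: split_indicator)

lemma ennreal_divide_mult_cancel: "0 < V \<Longrightarrow> y / ennreal V * ennreal V = y"
  by (cases y) (auto simp: divide_ennreal ennreal_top_divide ennreal_top_mult simp flip: ennreal_mult)

lemma cell_average_times:
  fixes c :: "nat \<times> (int ^ 'n)"
  assumes "0 < L"
  shows "cell_average L h c * emeasure lebesgue (cell L c) = (\<integral>\<^sup>+x\<in>cell L c. h x \<partial>lebesgue)"
proof -
  have "0 < side L c ^ CARD('n)" using side_pos[OF assms, of c] by simp
  moreover have "emeasure lebesgue (cell L c) = ennreal (side L c ^ CARD('n))"
    using emeasure_cell[OF assms, of c] by simp
  ultimately show ?thesis
    unfolding cell_average_def by (simp only: ennreal_divide_mult_cancel)
qed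

text \<open>The cost of a cell is \<open>K * a c\<close> times the integral of h, that is, a product
  of means times the measure of the cell. Charging it to the uncovered part at most doubles it, and
  since the uncovered parts of all generations are disjoint, the charges add up to a single integral
  of the maximal function.\<close>

lemma nn_integral_le_cell_maximal:
  fixes h :: "real ^ 'n \<Rightarrow> ennreal" and G :: "nat \<times> (int ^ 'n) \<Rightarrow> real ^ 'n \<Rightarrow> ennreal"
    and a :: "nat \<times> (int ^ 'n) \<Rightarrow> ennreal" and K :: ennreal
  assumes L: "0 < L" and [measurable]: "h \<in> borel_measurable lebesgue" "\<And>c. G c \<in> borel_measurable lebesgue"
    and zero: "\<And>c. a c = 0 \<Longrightarrow> AE x in lebesgue. G c x = 0"
    and step: "\<And>c. a c \<noteq> 0 \<Longrightarrow> \<exists>P. (\<forall>d\<in>P. cell L d \<subseteq> cell L c) \<and> disjoint_family_on (cell L) P \<and>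
      emeasure lebesgue (\<Union>d\<in>P. cell L d) \<le> ennreal (measure lebesgue (cell L c) / 2) \<and>
      (\<forall>x\<in>cell L c - (\<Union>d\<in>P. cell L d). G c x \<le> K * a c) \<and>
      (\<forall>d\<in>P. \<forall>x\<in>cell L d. G c x \<le> G d x + K * a c)"
  shows "(\<integral>\<^sup>+x\<in>cell L c. G c x * h x \<partial>lebesgue) \<le>
    2 * K * (\<integral>\<^sup>+x\<in>cell L c. cell_maximal L (\<lambda>c. a c * cell_average L h c) x \<partial>lebesgue)"
proof -
  define N where "N = cell_maximal L (\<lambda>c. a c * cell_average L h c)"
  have [measurable]: "N \<in> borel_measurable lebesgue" unfolding N_def by (intro borel_measurable_lebesgueI measurable_cell_maximal)
  have scell [measurable]: "cell L d \<in> sets lebesgue" for d :: "nat \<times> (int ^ 'n)" by simp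
  define good where "good c P \<longleftrightarrow> (\<forall>d\<in>P. cell L d \<subseteq> cell L c) \<and> disjoint_family_on (cell L) P \<and>
      emeasure lebesgue (\<Union>d\<in>P. cell L d) \<le> ennreal (measure lebesgue (cell L c) / 2) \<and>
      (\<forall>x\<in>cell L c - (\<Union>d\<in>P. cell L d). G c x \<le> K * a c) \<and>
      (\<forall>d\<in>P. \<forall>x\<in>cell L d. G c x \<le> G d x + K * a c)" for c P
  \<comment> \<open>A cell with \<open>a c = 0\<close> gets no children: \<open>step\<close> says
    nothing about it, and \<open>zero\<close> makes its contribution vanish.\<close>
  define Ch where "Ch c = (if a c = 0 then {} else (SOME P. good c P))" for c
  have good: "good c (Ch c)" if "a c \<noteq> 0" for c
  proof -
    have "\<exists>P. good c P" unfolding good_def by (rule step[OF that])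
    from someI_ex[OF this] that show ?thesis unfolding Ch_def by (simp only: if_False)
  qed
  have Ch_sub: "cell L d \<subseteq> cell L c" if "d \<in> Ch c" for c d
    using good[of c] that by (cases "a c = 0") (auto simp: Ch_def good_def)
  have Ch_disj: "disjoint_family_on (cell L) (Ch c)" for c
    using good[of c] by (cases "a c = 0") (auto simp: Ch_def good_def disjoint_family_on_def)
  have Ch_small: "emeasure lebesgue (\<Union>d\<in>Ch c. cell L d) \<le> ennreal (measure lebesgue (cell L c) / 2)" for c
    using good[of c] by (cases "a c = 0") (auto simp: Ch_def good_def)
  \<comment> \<open>The part of c that is still covered after k generations of children.\<close>
  define Om where "Om = rec_nat (cell L) (\<lambda>_ S c. \<Union>d\<in>Ch c. S d)"
  have Om0: "Om 0 c = cell L c" and OmS: "Om (Suc k) c = (\<Union>d\<in>Ch c. Om k d)" for k c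
    by (simp_all add: Om_def)
  have sOm [measurable]: "Om k c \<in> sets lebesgue" for k c
    by (induction k arbitrary: c) (auto simp: Om0 OmS intro!: sets.countable_UN')
  have Om_sub: "Om k c \<subseteq> cell L c" for k c
    by (induction k arbitrary: c) (use Ch_sub in \<open>fastforce simp: Om0 OmS\<close>)+
  have Om_anti: "Om (Suc k) c \<subseteq> Om k c" for k c
    by (induction k arbitrary: c) (use Ch_sub in \<open>fastforce simp: Om0 OmS\<close>)+
  have fin: "emeasure lebesgue (cell L d) = ennreal (measure lebesgue (cell L d))" for d :: "nat \<times> (int ^ 'n)"
    using cell_lmeasurable[OF L, of d] by (rule emeasure_eq_measure2)
  have Om_small: "emeasure lebesgue (Om k c) \<le> ennreal (measure lebesgue (cell L c) / 2 ^ k)" for k c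
  proof (induction k arbitrary: c)
    case 0
    then show ?case by (simp only: Om0 fin) simp
  next
    case (Suc k)
    have "emeasure lebesgue (Om (Suc k) c) = (\<integral>\<^sup>+d. emeasure lebesgue (Om k d) \<partial>count_space (Ch c))"
      unfolding OmS
    proof (intro emeasure_UN_countable)
      show "disjoint_family_on (Om k) (Ch c)"
        unfolding disjoint_family_on_def
      proof (intro ballI impI)
        fix d e assume "d \<in> Ch c" "e \<in> Ch c" "d \<noteq> e"
        then have "cell L d \<inter> cell L e = {}" using Ch_disj[of c] by (simp add: disjoint_family_on_def)
        then show "Om k d \<inter> Om k e = {}" using Om_sub[of k d] Om_sub[of k e] by blast
      qed
    qed (simp_all add: sOm)
    also have "\<dots> \<le> (\<integral>\<^sup>+d. ennreal (1 / 2 ^ k) * emeasure lebesgue (cell L d) \<partial>count_space (Ch c))"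
    proof (intro nn_integral_mono)
      fix d :: "nat \<times> (int ^ 'n)"
      have "ennreal (measure lebesgue (cell L d) / 2 ^ k) = ennreal (1 / 2 ^ k) * emeasure lebesgue (cell L d)"
        by (simp only: fin) (simp flip: ennreal_mult)
      with Suc.IH[of d] show "emeasure lebesgue (Om k d) \<le> ennreal (1 / 2 ^ k) * emeasure lebesgue (cell L d)"
        by (simp only:)
    qed
    also have "\<dots> = ennreal (1 / 2 ^ k) * (\<integral>\<^sup>+d. emeasure lebesgue (cell L d) \<partial>count_space (Ch c))"
      by (simp add: nn_integral_cmult)
    also have "(\<integral>\<^sup>+d. emeasure lebesgue (cell L d) \<partial>count_space (Ch c)) = emeasure lebesgue (\<Union>d\<in>Ch c. cell L d)"
      using Ch_disj by (intro emeasure_UN_countable[symmetric]) auto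
    also have "ennreal (1 / 2 ^ k) * \<dots> \<le> ennreal (1 / 2 ^ k) * ennreal (measure lebesgue (cell L c) / 2)"
      by (intro mult_left_mono Ch_small) simp
    also have "\<dots> = ennreal (measure lebesgue (cell L c) / 2 ^ Suc k)"
      by (simp add: field_simps flip: ennreal_mult)
    finally show ?case .
  qed
  \<comment> \<open>Each cell pays only for the part of it that its children leave uncovered, which has at least half its measure.\<close>
  have claim: "(\<integral>\<^sup>+x\<in>cell L c - Om k c. G c x * h x \<partial>lebesgue) \<le> 2 * K * (\<integral>\<^sup>+x\<in>cell L c. N x \<partial>lebesgue)" for k c
  proof (induction k arbitrary: c)
    case 0
    then show ?case by (simp add: Om0)
  next
    case (Suc k)
    show ?case
    proof (cases "a c = 0")
      case True
      have "(\<integral>\<^sup>+x\<in>cell L c - Om (Suc k) c. G c x * h x \<partial>lebesgue) = (\<integral>\<^sup>+x. 0 \<partial>(lebesgue :: (real ^ 'n) measure))"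
        using zero[OF True] by (intro nn_integral_cong_AE) auto
      then show ?thesis by simp
    next
      case False
      note g = good[OF False, unfolded good_def]
      let ?R = "\<Union>d\<in>Ch c. cell L d"
      have sR [measurable]: "?R \<in> sets lebesgue" by (intro sets.countable_UN') auto
      \<comment> \<open>At a point of a child d only the term of d matters; the whole sum over the
        children is kept so that it can be integrated term by term.\<close>
      have pt: "G c x * h x * indicator (cell L c - Om (Suc k) c) x \<le> K * a c * (h x * indicator (cell L c) x)
        + (\<integral>\<^sup>+d. G d x * h x * indicator (cell L d - Om k d) x \<partial>count_space (Ch c))" for x
      proof (cases "x \<in> cell L c - Om (Suc k) c")
        case xc: True
        show ?thesis
        proof (cases "x \<in> ?R")
          case True
          then obtain d where d: "d \<in> Ch c" "x \<in> cell L d" by auto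
          have "x \<notin> Om k d" using xc d OmS by auto
          then have "G d x * h x \<le> (\<integral>\<^sup>+d. G d x * h x * indicator (cell L d - Om k d) x \<partial>count_space (Ch c))"
            using nn_integral_ge_point[OF d(1), of "\<lambda>d. G d x * h x * indicator (cell L d - Om k d) x"] d
            by simp
          moreover have "G c x * h x \<le> K * a c * h x + G d x * h x"
            using g d mult_right_mono[of "G c x" "G d x + K * a c" "h x"] by (auto simp: distrib_right add.commute)
          ultimately show ?thesis using xc by (auto intro: order_trans add_left_mono)
        next
          case False
          then have "G c x \<le> K * a c" using g xc by auto
          then show ?thesis using xc by (intro add_increasing2) (auto intro: mult_right_mono)
        qed
      qed simp
      have N_ge: "a c * cell_average L h c \<le> N x" if "x \<in> cell L c" for x
        unfolding N_def using cell_maximal_upper[OF that, of "\<lambda>c. a c * cell_average L h c"] .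
      have half: "emeasure lebesgue (cell L c) \<le> 2 * emeasure lebesgue (cell L c - ?R)"
      proof -
        have sub: "?R \<subseteq> cell L c" using Ch_sub by blast
        have R: "?R \<in> lmeasurable"
          using sub sR cell_lmeasurable[OF L, of c] by (rule fmeasurableI2[rotated])
        have "measure lebesgue ?R \<le> measure lebesgue (cell L c) / 2"
          using g emeasure_eq_measure2[OF R] by (metis ennreal_le_iff half_gt_zero_iff measure_nonneg
            divide_nonneg_nonneg zero_le_numeral)
        then have "measure lebesgue (cell L c) \<le> 2 * measure lebesgue (cell L c - ?R)"
          using measurable_measure_Diff[OF cell_lmeasurable[OF L, of c] sR sub] by simp
        moreover have "cell L c - ?R \<in> lmeasurable" using R L by (intro fmeasurable.Diff) auto
        ultimately show ?thesis
          by (simp only: fin emeasure_eq_measure2 ennreal_mult''[symmetric] ennreal_numeral[symmetric]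
              measure_nonneg ennreal_leI zero_le_numeral)
      qed
      have "a c * (\<integral>\<^sup>+x\<in>cell L c. h x \<partial>lebesgue) = a c * cell_average L h c * emeasure lebesgue (cell L c)"
        by (simp only: cell_average_times[OF L] mult.assoc)
      also have "\<dots> \<le> a c * cell_average L h c * (2 * emeasure lebesgue (cell L c - ?R))"
        by (intro mult_left_mono half) simp
      also have "\<dots> = 2 * (\<integral>\<^sup>+x\<in>cell L c - ?R. a c * cell_average L h c \<partial>lebesgue)"
        by (subst nn_integral_cmult_indicator) (auto simp: mult_ac)
      also have "\<dots> \<le> 2 * (\<integral>\<^sup>+x\<in>cell L c - ?R. N x \<partial>lebesgue)"
        using N_ge by (intro mult_left_mono nn_integral_mono) (auto split: split_indicator)
      finally have first: "a c * (\<integral>\<^sup>+x\<in>cell L c. h x \<partial>lebesgue) \<le> 2 * (\<integral>\<^sup>+x\<in>cell L c - ?R. N x \<partial>lebesgue)" .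
      have "(\<integral>\<^sup>+x\<in>cell L c - Om (Suc k) c. G c x * h x \<partial>lebesgue) \<le> (\<integral>\<^sup>+x. K * a c * (h x * indicator (cell L c) x)
        + (\<integral>\<^sup>+d. G d x * h x * indicator (cell L d - Om k d) x \<partial>count_space (Ch c)) \<partial>lebesgue)"
        by (intro nn_integral_mono pt)
      also have "\<dots> = (\<integral>\<^sup>+x. K * a c * (h x * indicator (cell L c) x) \<partial>lebesgue)
        + (\<integral>\<^sup>+x. (\<integral>\<^sup>+d. G d x * h x * indicator (cell L d - Om k d) x \<partial>count_space (Ch c)) \<partial>lebesgue)"
      proof (intro nn_integral_add)
        interpret C: sigma_finite_measure "count_space (Ch c)" by (rule sigma_finite_measure_count_space_countable) simp
        have "(\<lambda>(d, x). G d x * h x * indicator (cell L d - Om k d) x) \<in> borel_measurable (count_space (Ch c) \<Otimes>\<^sub>M lebesgue)"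
          by (rule measurable_pair_measure_countable1) auto
        then have "(\<lambda>(x, d). G d x * h x * indicator (cell L d - Om k d) x) \<in> borel_measurable (lebesgue \<Otimes>\<^sub>M count_space (Ch c))"
          by (subst measurable_pair_swap_iff) simp
        then show "(\<lambda>x. \<integral>\<^sup>+d. G d x * h x * indicator (cell L d - Om k d) x \<partial>count_space (Ch c)) \<in> borel_measurable lebesgue"
          by (rule C.borel_measurable_nn_integral)
      qed measurable
      also have "(\<integral>\<^sup>+x. (\<integral>\<^sup>+d. G d x * h x * indicator (cell L d - Om k d) x \<partial>count_space (Ch c)) \<partial>lebesgue)
        = (\<integral>\<^sup>+d. (\<integral>\<^sup>+x\<in>cell L d - Om k d. G d x * h x \<partial>lebesgue) \<partial>count_space (Ch c))"
        by (subst nn_integral_count_space_nn_integral) auto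
      also have "\<dots> \<le> (\<integral>\<^sup>+d. 2 * K * (\<integral>\<^sup>+x\<in>cell L d. N x \<partial>lebesgue) \<partial>count_space (Ch c))"
        by (intro nn_integral_mono Suc.IH)
      also have "\<dots> = 2 * K * (\<integral>\<^sup>+d. (\<integral>\<^sup>+x\<in>cell L d. N x \<partial>lebesgue) \<partial>count_space (Ch c))"
        by (simp add: nn_integral_cmult)
      also have "(\<integral>\<^sup>+d. (\<integral>\<^sup>+x\<in>cell L d. N x \<partial>lebesgue) \<partial>count_space (Ch c)) = (\<integral>\<^sup>+x\<in>?R. N x \<partial>lebesgue)"
        using Ch_disj by (intro nn_integral_disjoint_UN) auto
      also have "(\<integral>\<^sup>+x. K * a c * (h x * indicator (cell L c) x) \<partial>lebesgue) = K * (a c * (\<integral>\<^sup>+x\<in>cell L c. h x \<partial>lebesgue))"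
        by (subst nn_integral_cmult) (auto simp: mult.assoc)
      also have "\<dots> \<le> K * (2 * (\<integral>\<^sup>+x\<in>cell L c - ?R. N x \<partial>lebesgue))"
        by (intro mult_left_mono first) simp
      finally have "(\<integral>\<^sup>+x\<in>cell L c - Om (Suc k) c. G c x * h x \<partial>lebesgue) \<le>
          2 * K * ((\<integral>\<^sup>+x\<in>cell L c - ?R. N x \<partial>lebesgue) + (\<integral>\<^sup>+x\<in>?R. N x \<partial>lebesgue))"
        by (simp add: distrib_left mult_ac add_right_mono)
      also have "(\<integral>\<^sup>+x\<in>cell L c - ?R. N x \<partial>lebesgue) + (\<integral>\<^sup>+x\<in>?R. N x \<partial>lebesgue) = (\<integral>\<^sup>+x\<in>cell L c. N x \<partial>lebesgue)"
      proof (intro nn_integral_Diff_add)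
        show "?R \<subseteq> cell L c" using Ch_sub by blast
      qed (simp_all add: sR)
      finally show ?thesis .
    qed
  qed
  \<comment> \<open>The bound on the covered part halves with each generation, so what survives all
    of them is null, and letting k tend to infinity in \<open>claim\<close> gives the integral over
    the whole cell.\<close>
  have null: "emeasure lebesgue (\<Inter>k. Om k c) = 0"
  proof -
    have "(\<lambda>k. ennreal (measure lebesgue (cell L c) / 2 ^ k)) \<longlonglongrightarrow> ennreal (measure lebesgue (cell L c) * 0)"
      using LIMSEQ_inverse_realpow_zero[of 2] unfolding divide_inverse
      by (intro tendsto_ennrealI tendsto_mult tendsto_const) (simp add: power_inverse)
    moreover have "emeasure lebesgue (\<Inter>k. Om k c) \<le> ennreal (measure lebesgue (cell L c) / 2 ^ k)" for k
      by (rule order_trans[OF emeasure_mono Om_small]) auto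
    ultimately have "emeasure lebesgue (\<Inter>k. Om k c) \<le> ennreal (measure lebesgue (cell L c) * 0)"
      by (intro LIMSEQ_le_const) auto
    then show ?thesis by simp
  qed
  have "(\<integral>\<^sup>+x\<in>cell L c. G c x * h x \<partial>lebesgue) = (\<integral>\<^sup>+x. (SUP k. G c x * h x * indicator (cell L c - Om k c) x) \<partial>lebesgue)"
  proof (rule nn_integral_cong_AE)
    have "AE x in lebesgue. x \<notin> (\<Inter>k. Om k c)"
      using null by (intro AE_not_in) (auto simp: null_sets_def)
    then show "AE x in lebesgue. G c x * h x * indicator (cell L c) x
        = (SUP k. G c x * h x * indicator (cell L c - Om k c) x)"
    proof eventually_elim
      case (elim x)
      then obtain k where k: "x \<notin> Om k c" by blast
      show ?case
      proof (rule antisym)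
        show "G c x * h x * indicator (cell L c) x \<le> (SUP k. G c x * h x * indicator (cell L c - Om k c) x)"
          using k by (intro SUP_upper2[of k]) (auto split: split_indicator)
        show "(SUP k. G c x * h x * indicator (cell L c - Om k c) x) \<le> G c x * h x * indicator (cell L c) x"
          by (intro SUP_least mult_left_mono) (auto split: split_indicator)
      qed
    qed
  qed
  also have "\<dots> = (SUP k. \<integral>\<^sup>+x\<in>cell L c - Om k c. G c x * h x \<partial>lebesgue)"
    using Om_anti[of _ c]
    by (intro nn_integral_monotone_convergence_SUP incseq_SucI le_funI mult_left_mono)
       (auto simp: indicator_def)
  also have "\<dots> \<le> 2 * K * (\<integral>\<^sup>+x\<in>cell L c. N x \<partial>lebesgue)"
    by (intro SUP_least claim)
  finally show ?thesis by (simp add: N_def)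
qed

section \<open>Modulated Calderon-Zygmund operators\<close>

lemma nth_le_suminf: "f j \<le> (\<Sum>k. f k :: ennreal)"
  using sum_le_suminf[of f "{j}"] by simp

definition cut :: "(real ^ 'n) set \<Rightarrow> (nat \<Rightarrow> real ^ 'n \<Rightarrow> complex) \<Rightarrow> nat \<Rightarrow> real ^ 'n \<Rightarrow> complex" where
  "cut B f j x = indicator B x * f j x"

lemma seq_norm_cut:
  assumes "0 < q"
  shows "seq_norm q (cut B f) x = seq_norm q f x * indicator B x"
  using lq_norm_cmult[OF assms, of "indicator B x" "\<lambda>j. ennreal (norm (f j x))"]
  by (auto simp: seq_norm_def cut_def norm_mult indicator_def)

text \<open>Majorises the differences of a standard kernel in its first variable near \<open>z\<close>, off the ball of radius \<open>3\<rho>\<close>.\<close>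

definition shell_kernel :: "real \<Rightarrow> real \<Rightarrow> real ^ 'n \<Rightarrow> real \<Rightarrow> real ^ 'n \<Rightarrow> ennreal" where
  "shell_kernel c \<delta> z \<rho> y =
     (\<Sum>k. ennreal (c * (1 / 2 powr \<delta>) ^ k / (2 ^ k * \<rho>) ^ CARD('n)) * indicator (ball z (6 * \<rho> * 2 ^ k)) y)"

lemma measurable_shell_kernel [measurable]: "shell_kernel c \<delta> z \<rho> \<in> borel_measurable lebesgue"
proof -
  have [measurable]: "(\<lambda>y. indicator (ball z (6 * \<rho> * 2 ^ k)) y :: ennreal) \<in> borel_measurable lebesgue" for k
    by (intro borel_measurable_indicator) simp
  show ?thesis unfolding shell_kernel_def[abs_def] by measurable
qed

text \<open>Only one term of the series is used, that of the dyadic shell containing y. There |x -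
  y| is at least 2 ^ j * \<rho> while x and x' differ by at most \<rho>, so smoothness of order
  \<delta> gains the factor 2 ^ (- \<delta> j).\<close>

lemma norm_kernel_diff_le_shell_kernel:
  fixes x x' y z :: "real ^ 'n"
  assumes c: "0 \<le> c" and d: "0 < \<delta>" and \<rho>: "0 < \<rho>"
    and K: "norm (x - x') < norm (x - y) / 2 \<Longrightarrow>
      norm k \<le> c * (norm (x - x') powr \<delta> / norm (x - y) powr (real CARD('n) + \<delta>))"
    and x: "dist x z \<le> \<rho> / 2" "dist x' z \<le> \<rho> / 2" and y: "y \<notin> ball z (3 * \<rho>)"
  shows "ennreal (norm k) \<le> shell_kernel c \<delta> z \<rho> y"
proof -
  let ?n = "CARD('n)"
  obtain m where m: "dist z y / (6 * \<rho>) < 2 ^ m" using real_arch_pow[of 2] by auto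
  \<comment> \<open>The index of the shell on which the distance lies between 3 * \<rho> * 2 ^ j and
    6 * \<rho> * 2 ^ j; for j = 0 the lower bound is the assumption on y.\<close>
  define j where "j = (LEAST j. dist z y < 6 * \<rho> * 2 ^ j)"
  have j: "dist z y < 6 * \<rho> * 2 ^ j"
    unfolding j_def by (rule LeastI[of _ m]) (use m \<rho> in \<open>simp add: field_simps\<close>)
  have j': "3 * \<rho> * 2 ^ j \<le> dist z y"
  proof (cases j)
    case 0
    then show ?thesis using y by simp
  next
    case (Suc i)
    then have "\<not> dist z y < 6 * \<rho> * 2 ^ i" unfolding j_def by (intro not_less_Least) simp
    then show ?thesis using Suc by simp
  qed
  have xx: "norm (x - x') \<le> \<rho>"
    using x dist_triangle2[of x x' z] by (simp add: dist_norm)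
  have "\<rho> * 1 \<le> \<rho> * 2 ^ j" using \<rho> by (intro mult_left_mono) auto
  moreover have "dist z y \<le> dist x z + norm (x - y)"
    using dist_triangle[of z y x] by (simp add: dist_norm norm_minus_commute)
  ultimately have xy: "5 / 2 * (\<rho> * 2 ^ j) \<le> norm (x - y)" "\<rho> \<le> \<rho> * 2 ^ j"
    using j' x(1) by simp_all
  have xy': "2 ^ j * \<rho> \<le> norm (x - y)" using xy \<rho> unfolding mult.commute[of "2 ^ j"] by linarith
  have "norm (x - x') < norm (x - y) / 2" using xx xy \<rho> by linarith
  then have "norm k \<le> c * (norm (x - x') powr \<delta> / norm (x - y) powr (real ?n + \<delta>))" by (rule K)
  also have "\<dots> \<le> c * (\<rho> powr \<delta> / (2 ^ j * \<rho>) powr (real ?n + \<delta>))"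
    using xx xy' \<rho> d c by (intro mult_left_mono frac_le powr_mono2) auto
  also have "\<dots> = c * (1 / 2 powr \<delta>) ^ j / (2 ^ j * \<rho>) ^ ?n"
  proof -
    have "(2 ^ j * \<rho>) powr (real ?n + \<delta>) = (2 ^ j * \<rho>) ^ ?n * ((2 powr \<delta>) ^ j * \<rho> powr \<delta>)"
      using \<rho> by (simp add: powr_add powr_mult powr_realpow powr_powr mult.commute flip: powr_realpow)
    then show ?thesis using \<rho> by (simp add: field_simps power_divide)
  qed
  finally have "ennreal (norm k) \<le> ennreal (c * (1 / 2 powr \<delta>) ^ j / (2 ^ j * \<rho>) ^ ?n) * indicator (ball z (6 * \<rho> * 2 ^ j)) y"
    using j by (simp add: ennreal_leI)
  also have "\<dots> \<le> shell_kernel c \<delta> z \<rho> y"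
    unfolding shell_kernel_def
    by (rule nth_le_suminf)
  finally show ?thesis .
qed

text \<open>Each term is an average over a ball containing x, up to the volume factor
  \<open>unit_ball_vol\<close> times 6 ^ n, and the coefficients form a geometric series in 2 ^ (-
  \<delta>).\<close>

lemma nn_integral_shell_kernel_le:
  fixes z x :: "real ^ 'n" and F :: "real ^ 'n \<Rightarrow> ennreal"
  assumes [measurable]: "F \<in> borel_measurable lebesgue" and c: "0 \<le> c" and d: "0 < \<delta>" and \<rho>: "0 < \<rho>"
    and x: "x \<in> ball z (6 * \<rho>)"
  shows "(\<integral>\<^sup>+y. shell_kernel c \<delta> z \<rho> y * F y \<partial>lebesgue)
    \<le> ennreal (c * unit_ball_vol (CARD('n)) * 6 ^ CARD('n) * (1 / (1 - 1 / 2 powr \<delta>))) * ball_maximal F x"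
proof -
  let ?n = "CARD('n)" and ?u = "unit_ball_vol (CARD('n))"
  let ?b = "1 / 2 powr \<delta>"
  have b: "0 < ?b" "?b < 1" using d by auto
  have tk: "ennreal (c * ?b ^ k / (2 ^ k * \<rho>) ^ ?n) * (\<integral>\<^sup>+y\<in>ball z (6 * \<rho> * 2 ^ k). F y \<partial>lebesgue)
      \<le> ennreal (c * ?u * 6 ^ ?n * ?b ^ k) * ball_maximal F x" for k
  proof -
    let ?J = "\<integral>\<^sup>+y\<in>ball z (6 * \<rho> * 2 ^ k). F y \<partial>lebesgue"
    let ?V = "?u * (6 * \<rho> * 2 ^ k) ^ ?n"
    have V: "0 < ?V" using \<rho> by simp
    have em: "emeasure lebesgue (ball z (6 * \<rho> * 2 ^ k)) = ennreal ?V"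
      using emeasure_lebesgue_ball[of "6 * \<rho> * 2 ^ k" z] \<rho> by simp
    have "\<rho> * 1 \<le> \<rho> * 2 ^ k" using \<rho> by (intro mult_left_mono) auto
    then have "x \<in> ball z (6 * \<rho> * 2 ^ k)" using x by simp
    then have "?J / ennreal ?V \<le> ball_maximal F x"
      using ball_maximal_upper[of "6 * \<rho> * 2 ^ k" x z F] \<rho> unfolding em by simp
    then have "ennreal (c * ?u * 6 ^ ?n * ?b ^ k) * (?J / ennreal ?V) \<le> ennreal (c * ?u * 6 ^ ?n * ?b ^ k) * ball_maximal F x"
      by (rule mult_left_mono) simp
    moreover have "ennreal (c * ?b ^ k / (2 ^ k * \<rho>) ^ ?n) * ?J = ennreal (c * ?u * 6 ^ ?n * ?b ^ k) * (?J / ennreal ?V)"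
    proof -
      have e: "ennreal (c * ?u * 6 ^ ?n * ?b ^ k) = ennreal (c * ?b ^ k / (2 ^ k * \<rho>) ^ ?n) * ennreal ?V"
        using c \<rho> b by (simp add: power_mult_distrib flip: ennreal_mult)
      have "ennreal ?V * (?J / ennreal ?V) = ?J"
        using ennreal_divide_mult_cancel[OF V, of ?J] by (subst mult.commute)
      then show ?thesis unfolding e by (subst mult.assoc) (rule arg_cong[OF sym])
    qed
    ultimately show ?thesis by simp
  qed
  have "(\<integral>\<^sup>+y. shell_kernel c \<delta> z \<rho> y * F y \<partial>lebesgue)
    = (\<integral>\<^sup>+y. (\<Sum>k. ennreal (c * ?b ^ k / (2 ^ k * \<rho>) ^ ?n) * (F y * indicator (ball z (6 * \<rho> * 2 ^ k)) y)) \<partial>lebesgue)"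
    unfolding shell_kernel_def ennreal_suminf_multc[symmetric]
    by (intro nn_integral_cong suminf_cong) (simp add: mult_ac)
  also have "\<dots> = (\<Sum>k. ennreal (c * ?b ^ k / (2 ^ k * \<rho>) ^ ?n) * (\<integral>\<^sup>+y\<in>ball z (6 * \<rho> * 2 ^ k). F y \<partial>lebesgue))"
  proof -
    have m: "(\<lambda>y. F y * indicator (ball z (6 * \<rho> * 2 ^ k)) y) \<in> borel_measurable lebesgue" for k
      by (intro borel_measurable_times_ennreal borel_measurable_indicator assms(1)) simp
    show ?thesis
      by (subst nn_integral_suminf, intro borel_measurable_times_ennreal borel_measurable_const m)
        (intro suminf_cong nn_integral_cmult m)
  qed
  also have "\<dots> \<le> (\<Sum>k. ennreal (c * ?u * 6 ^ ?n * ?b ^ k) * ball_maximal F x)"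
    by (intro suminf_le tk) auto
  also have "\<dots> = (\<Sum>k. ennreal (c * ?u * 6 ^ ?n * ?b ^ k)) * ball_maximal F x" by simp
  also have "(\<Sum>k. ennreal (c * ?u * 6 ^ ?n * ?b ^ k)) = ennreal (\<Sum>k. c * ?u * 6 ^ ?n * ?b ^ k)"
    using b c by (intro suminf_ennreal2 summable_mult summable_geometric) auto
  also have "(\<Sum>k. c * ?u * 6 ^ ?n * ?b ^ k) = c * ?u * 6 ^ ?n * (1 / (1 - ?b))"
    using b by (subst suminf_mult) (auto simp: suminf_geometric intro: summable_geometric)
  finally show ?thesis .
qed

section \<open>Pointwise estimates for the modulated operator on sequences\<close>

locale modulated_cz =
  fixes T :: "(real ^ 'n \<Rightarrow> complex) \<Rightarrow> real ^ 'n \<Rightarrow> complex" and D :: "(real ^ 'n \<Rightarrow> complex) set"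
    and I :: "'i set" and \<phi> :: "'i \<Rightarrow> real ^ 'n \<Rightarrow> real" and q :: real
    and K :: "real ^ 'n \<Rightarrow> real ^ 'n \<Rightarrow> complex" and c\<^sub>K \<delta> :: real
  assumes dom: "cz_domain D"
    and T_add: "\<And>g h x. g \<in> D \<Longrightarrow> h \<in> D \<Longrightarrow> T (\<lambda>y. g y + h y) x = T g x + T h x"
    and rep: "\<And>g x. g \<in> D \<Longrightarrow> x \<notin> closure {y. g y \<noteq> 0} \<Longrightarrow>
      integrable lebesgue (\<lambda>y. K x y * g y) \<and> T g x = (LINT y|lebesgue. K x y * g y)"
    and c_nonneg: "0 \<le> c\<^sub>K" and \<delta>_pos: "0 < \<delta>"
    and K_smooth: "\<And>x x' y. norm (x - x') < norm (x - y) / 2 \<Longrightarrow>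
      norm (K x y - K x' y) \<le> c\<^sub>K * (norm (x - x') powr \<delta> / norm (x - y) powr (real CARD('n) + \<delta>))"
    and \<phi>_meas: "\<And>\<alpha>. \<alpha> \<in> I \<Longrightarrow> \<phi> \<alpha> \<in> borel_measurable lebesgue"
    and q: "1 \<le> q"
begin

abbreviation e where "e \<alpha> y \<equiv> exp (2 * of_real pi * \<i> * of_real (\<phi> \<alpha> y))"

abbreviation G where "G f B \<equiv> modulated_seq_norm q T I \<phi> (cut B f)"

lemma norm_e [simp]: "norm (e \<alpha> y) = 1"
  by (simp add: norm_exp_eq_Re)

lemma D_measurable: "g \<in> D \<Longrightarrow> g \<in> borel_measurable lebesgue"
  using dom by (auto simp: cz_domain_def)

lemma bounded_mult_in_D:
  "b \<in> borel_measurable lebesgue \<Longrightarrow> bounded (range b) \<Longrightarrow> g \<in> D \<Longrightarrow> (\<lambda>x. b x * g x) \<in> D"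
  using dom by (auto simp: cz_domain_def)

lemma e_mult_in_D: "\<alpha> \<in> I \<Longrightarrow> g \<in> D \<Longrightarrow> (\<lambda>y. e \<alpha> y * g y) \<in> D"
proof (rule bounded_mult_in_D)
  assume "\<alpha> \<in> I"
  note [measurable] = \<phi>_meas[OF this]
  show "(\<lambda>y. e \<alpha> y) \<in> borel_measurable lebesgue"
    by (rule borel_measurable_continuous_onI[THEN measurable_compose_rev])
      (auto intro!: continuous_intros)
  show "bounded (range (\<lambda>y. e \<alpha> y))" by (auto intro!: boundedI[of _ 1])
qed

lemma cut_in_D: "B \<in> sets lebesgue \<Longrightarrow> f j \<in> D \<Longrightarrow> cut B f j \<in> D"
proof -
  assume "B \<in> sets lebesgue" "f j \<in> D"
  moreover have "bounded (range (indicator B :: real ^ 'n \<Rightarrow> complex))"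
    by (intro boundedI[of _ 1]) (auto simp: indicator_def)
  ultimately show ?thesis unfolding cut_def[abs_def] by (intro bounded_mult_in_D) auto
qed

lemma modulated_add_le:
  assumes "g \<in> D" "h \<in> D"
  shows "modulated T I \<phi> (\<lambda>y. g y + h y) x \<le> modulated T I \<phi> g x + modulated T I \<phi> h x"
  unfolding modulated_def
proof (rule SUP_least)
  fix \<alpha> assume \<alpha>: "\<alpha> \<in> I"
  have "T (\<lambda>y. e \<alpha> y * (g y + h y)) x = T (\<lambda>y. e \<alpha> y * g y) x + T (\<lambda>y. e \<alpha> y * h y) x"
    unfolding distrib_left using \<alpha> assms by (intro T_add e_mult_in_D)
  then have "ennreal (norm (T (\<lambda>y. e \<alpha> y * (g y + h y)) x))
      \<le> ennreal (norm (T (\<lambda>y. e \<alpha> y * g y) x)) + ennreal (norm (T (\<lambda>y. e \<alpha> y * h y) x))"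
    by (simp add: norm_triangle_ineq ennreal_leI flip: ennreal_plus)
  also have "\<dots> \<le> (SUP \<alpha>\<in>I. ennreal (norm (T (\<lambda>y. e \<alpha> y * g y) x))) + (SUP \<alpha>\<in>I. ennreal (norm (T (\<lambda>y. e \<alpha> y * h y) x)))"
    using \<alpha> by (intro add_mono SUP_upper)
  finally show "ennreal (norm (T (\<lambda>y. e \<alpha> y * (g y + h y)) x)) \<le> \<dots>" .
qed

lemma G_split:
  assumes f: "\<And>j. f j \<in> D" and B: "B1 \<in> sets lebesgue" "B2 \<in> sets lebesgue" "B1 \<inter> B2 = {}"
  shows "G f (B1 \<union> B2) x \<le> G f B1 x + G f B2 x"
proof -
  have "cut (B1 \<union> B2) f j = (\<lambda>y. cut B1 f j y + cut B2 f j y)" for j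
    using B(3) by (auto simp: fun_eq_iff cut_def indicator_def)
  then have "G f (B1 \<union> B2) x \<le> lq_norm q (\<lambda>j. modulated T I \<phi> (cut B1 f j) x + modulated T I \<phi> (cut B2 f j) x)"
    unfolding modulated_seq_norm_def using q f B
    by (intro lq_norm_mono) (auto intro!: modulated_add_le cut_in_D)
  also have "\<dots> \<le> G f B1 x + G f B2 x"
    unfolding modulated_seq_norm_def by (rule lq_norm_triangle[OF q])
  finally show ?thesis .
qed

lemma not_in_closure_support:
  assumes "x \<in> ball z \<rho>" "\<And>y. y \<in> ball z \<rho> \<Longrightarrow> g y = 0"
  shows "x \<notin> closure {y. g y \<noteq> 0}"
proof -
  have "closure {y. g y \<noteq> 0} \<subseteq> - ball z \<rho>"
    using assms(2) by (intro closure_minimal) (auto simp: closed_def)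
  then show ?thesis using assms(1) by blast
qed

text \<open>As g vanishes on the ball of radius 3 * \<rho>, the kernel representation holds at both
  points for every modulation. The resulting bound on the difference does not depend on \<alpha>, so
  it survives the supremum.\<close>

lemma modulated_diff_le:
  assumes g: "g \<in> D" and \<rho>: "0 < \<rho>" and x: "dist x z \<le> \<rho> / 2" "dist x' z \<le> \<rho> / 2"
    and supp: "\<And>y. y \<in> ball z (3 * \<rho>) \<Longrightarrow> g y = 0"
  shows "modulated T I \<phi> g x \<le> modulated T I \<phi> g x' + (\<integral>\<^sup>+y. shell_kernel c\<^sub>K \<delta> z \<rho> y * ennreal (norm (g y)) \<partial>lebesgue)"
  unfolding modulated_def
proof (rule SUP_least)
  fix \<alpha> assume \<alpha>: "\<alpha> \<in> I"
  let ?g = "\<lambda>y. e \<alpha> y * g y"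
  have gD: "?g \<in> D" using \<alpha> g by (rule e_mult_in_D)
  have cl: "w \<notin> closure {y. ?g y \<noteq> 0}" if "dist w z \<le> \<rho> / 2" for w
    using that \<rho> supp by (intro not_in_closure_support[of w z "3 * \<rho>"]) (auto simp: dist_commute)
  note r = rep[OF gD cl[OF x(1)]] and r' = rep[OF gD cl[OF x(2)]]
  have int: "integrable lebesgue (\<lambda>y. (K x y - K x' y) * ?g y)"
    using Bochner_Integration.integrable_diff[of lebesgue "\<lambda>y. K x y * ?g y" "\<lambda>y. K x' y * ?g y"] r r'
    by (simp add: left_diff_distrib)
  have "T ?g x - T ?g x' = (LINT y|lebesgue. (K x y - K x' y) * ?g y)"
    using r r' by (simp add: left_diff_distrib)
  then have "ennreal (norm (T ?g x - T ?g x')) \<le> (\<integral>\<^sup>+y. ennreal (norm ((K x y - K x' y) * ?g y)) \<partial>lebesgue)"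
    using integral_norm_bound_ennreal[OF int] by simp
  also have "\<dots> \<le> (\<integral>\<^sup>+y. shell_kernel c\<^sub>K \<delta> z \<rho> y * ennreal (norm (g y)) \<partial>lebesgue)"
  proof (intro nn_integral_mono)
    fix y
    show "ennreal (norm ((K x y - K x' y) * ?g y)) \<le> shell_kernel c\<^sub>K \<delta> z \<rho> y * ennreal (norm (g y))"
    proof (cases "y \<in> ball z (3 * \<rho>)")
      case True
      then show ?thesis using supp by simp
    next
      case False
      have "ennreal (norm (K x y - K x' y)) \<le> shell_kernel c\<^sub>K \<delta> z \<rho> y"
        by (rule norm_kernel_diff_le_shell_kernel[OF c_nonneg \<delta>_pos \<rho> K_smooth x False])
      then have "ennreal (norm (K x y - K x' y)) * ennreal (norm (g y)) \<le> shell_kernel c\<^sub>K \<delta> z \<rho> y * ennreal (norm (g y))"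
        by (rule mult_right_mono) simp
      then show ?thesis by (simp add: norm_mult ennreal_mult)
    qed
  qed
  finally have d: "ennreal (norm (T ?g x - T ?g x')) \<le> (\<integral>\<^sup>+y. shell_kernel c\<^sub>K \<delta> z \<rho> y * ennreal (norm (g y)) \<partial>lebesgue)" .
  have "norm (T ?g x) \<le> norm (T ?g x') + norm (T ?g x - T ?g x')"
    using norm_triangle_ineq[of "T ?g x'" "T ?g x - T ?g x'"] by simp
  then have "ennreal (norm (T ?g x)) \<le> ennreal (norm (T ?g x')) + ennreal (norm (T ?g x - T ?g x'))"
    by (simp add: ennreal_leI flip: ennreal_plus)
  also have "\<dots> \<le> (SUP \<alpha>\<in>I. ennreal (norm (T (\<lambda>y. e \<alpha> y * g y) x'))) + (\<integral>\<^sup>+y. shell_kernel c\<^sub>K \<delta> z \<rho> y * ennreal (norm (g y)) \<partial>lebesgue)"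
    using \<alpha> d by (intro add_mono SUP_upper)
  finally show "ennreal (norm (T ?g x)) \<le> \<dots>" .
qed

text \<open>The constant of \<open>nn_integral_shell_kernel_le\<close>; the last factor is the sum
  of the geometric series.\<close>

definition "C\<^sub>K = c\<^sub>K * unit_ball_vol (CARD('n)) * 6 ^ CARD('n) * (1 / (1 - 1 / 2 powr \<delta>))"

lemma C\<^sub>K_nonneg: "0 \<le> C\<^sub>K"
proof -
  have "1 < 2 powr \<delta>" using \<delta>_pos by simp
  then show ?thesis unfolding C\<^sub>K_def using c_nonneg by simp
qed

text \<open>The kernel bound of \<open>modulated_diff_le\<close> is the same for all indices.
  Minkowski's integral inequality therefore moves the q-norm under the integral, where it falls on
  the sequence alone.\<close>

lemma G_diff_le:
  assumes f: "\<And>j. f j \<in> D" and E: "E \<in> sets lebesgue" "E \<inter> ball z (3 * \<rho>) = {}" and \<rho>: "0 < \<rho>"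
    and x: "dist x z \<le> \<rho> / 2" "dist x' z \<le> \<rho> / 2"
  shows "G f E x \<le> G f E x' + ennreal C\<^sub>K * ball_maximal (\<lambda>y. seq_norm q f y * indicator E y) x'"
proof -
  have [measurable]: "cut E f j \<in> borel_measurable lebesgue" for j
    by (intro D_measurable cut_in_D E f)
  let ?k = "shell_kernel c\<^sub>K \<delta> z \<rho>"
  have meas: "(\<lambda>y. seq_norm q f y * indicator E y) \<in> borel_measurable lebesgue"
  proof -
    have "(\<lambda>y. seq_norm q (cut E f) y) \<in> borel_measurable lebesgue" unfolding seq_norm_def by measurable
    then show ?thesis using q by (simp add: seq_norm_cut)
  qed
  have "G f E x \<le> lq_norm q (\<lambda>j. modulated T I \<phi> (cut E f j) x' + (\<integral>\<^sup>+y. ?k y * ennreal (norm (cut E f j y)) \<partial>lebesgue))"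
    unfolding modulated_seq_norm_def using q f E \<rho> x
    by (intro lq_norm_mono modulated_diff_le cut_in_D) (auto simp: cut_def indicator_def)
  also have "\<dots> \<le> G f E x' + lq_norm q (\<lambda>j. \<integral>\<^sup>+y. ?k y * ennreal (norm (cut E f j y)) \<partial>lebesgue)"
    unfolding modulated_seq_norm_def by (rule lq_norm_triangle[OF q])
  also have "lq_norm q (\<lambda>j. \<integral>\<^sup>+y. ?k y * ennreal (norm (cut E f j y)) \<partial>lebesgue)
      \<le> (\<integral>\<^sup>+y. lq_norm q (\<lambda>j. ?k y * ennreal (norm (cut E f j y))) \<partial>lebesgue)"
    by (intro lq_norm_nn_integral_le q) measurable
  also have "\<dots> = (\<integral>\<^sup>+y. ?k y * (seq_norm q f y * indicator E y) \<partial>lebesgue)"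
    using q by (simp add: lq_norm_cmult seq_norm_cut[unfolded seq_norm_def] seq_norm_def)
  also have "\<dots> \<le> ennreal C\<^sub>K * ball_maximal (\<lambda>y. seq_norm q f y * indicator E y) x'"
    unfolding C\<^sub>K_def using \<rho> x
    by (intro nn_integral_shell_kernel_le meas c_nonneg \<delta>_pos) (auto simp: dist_commute)
  finally show ?thesis by (simp add: add_left_mono)
qed

end

section \<open>The stopping step\<close>

text \<open>Otherwise the simplifier replaces \<^const>\<open>lebesgue\<close> by \<^const>\<open>lborel\<close> on the \<^const>\<open>main_part\<close> of a set.\<close>

declare emeasure_completion [simp del]

text \<open>With \<rho> = n * side the cell lies within \<rho> / 2 of its centre and the radius is 3
  * \<rho>, as \<open>G_diff_le\<close> requires.\<close>

definition bigball :: "real \<Rightarrow> nat \<times> (int ^ 'n) \<Rightarrow> (real ^ 'n) set" where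
  "bigball L c = ball (center L c) (3 * (CARD('n) * side L c))"

lemma bigball_lebesgue [simp]: "bigball L c \<in> sets lebesgue"
  by (simp add: bigball_def)

lemma cell_subset_bigball:
  fixes c :: "nat \<times> (int ^ 'n)"
  assumes "0 < L" shows "cell L c \<subseteq> bigball L c"
proof
  fix x assume "x \<in> cell L c"
  then have "dist x (center L c) \<le> CARD('n) * side L c / 2" by (rule dist_center_le[OF assms])
  moreover have "0 < CARD('n) * side L c" using side_pos[OF assms, of c] by simp
  ultimately show "x \<in> bigball L c" by (simp add: bigball_def dist_commute)
qed

lemma center_in_cell:
  assumes "0 < L" shows "center L c \<in> cell L c"
  using side_pos[OF assms, of c] by (intro mem_cellI[OF assms]) auto

text \<open>There is room to spare: a strictly finer cell has a ball of at most a third of the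
  radius, centred within n * side / 2 of the centre of c.\<close>

lemma bigball_subset:
  fixes c d :: "nat \<times> (int ^ 'n)"
  assumes L: "0 < L" and "cell L d \<subseteq> cell L c" "fst c < fst d"
  shows "bigball L d \<subseteq> bigball L c"
proof -
  have s: "3 * side L d \<le> side L c"
  proof -
    have "(3::real) ^ (fst c + 1) \<le> 3 ^ fst d" using assms(3) by (intro power_increasing) auto
    then show ?thesis using L by (simp add: side_def field_simps)
  qed
  have n: "3 * (CARD('n) * side L d) \<le> CARD('n) * side L c"
    using mult_left_mono[OF s, of "CARD('n)"] by (simp add: mult_ac)
  have dc: "dist (center L d) (center L c) \<le> CARD('n) * side L c / 2"
    using center_in_cell[OF L, of d] assms(2) by (intro dist_center_le[OF L]) auto
  have pos: "0 < CARD('n) * side L c" using side_pos[OF L, of c] by simp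
  show ?thesis
  proof
    fix x assume "x \<in> bigball L d"
    then have "dist (center L d) x < 3 * (CARD('n) * side L d)" by (simp add: bigball_def)
    moreover have "dist (center L c) x \<le> dist (center L d) (center L c) + dist (center L d) x"
      using dist_triangle[of "center L c" x "center L d"] by (simp add: dist_commute)
    ultimately have "dist (center L c) x < 3 * (CARD('n) * side L c)" using n dc pos by linarith
    then show "x \<in> bigball L c" by (simp add: bigball_def)
  qed
qed

text \<open>The volume of \<open>bigball\<close> relative to its cell. It depends on the dimension
  only, which the type argument carries.\<close>

definition ball_ratio :: "'n itself \<Rightarrow> real" where
  "ball_ratio _ = unit_ball_vol (CARD('n)) * (3 * CARD('n)) ^ CARD('n)"

lemma ball_ratio_pos: "0 < ball_ratio TYPE('n::finite)"
  by (simp add: ball_ratio_def)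

lemma emeasure_bigball:
  fixes c :: "nat \<times> (int ^ 'n)"
  assumes "0 < L"
  shows "emeasure lebesgue (bigball L c) = ennreal (ball_ratio TYPE('n) * side L c ^ CARD('n))"
  unfolding bigball_def using side_pos[OF assms, of c]
  by (subst emeasure_lebesgue_ball) (auto simp: ball_ratio_def power_mult_distrib mult.assoc)

definition ball_mean :: "real \<Rightarrow> (real ^ 'n \<Rightarrow> ennreal) \<Rightarrow> real \<Rightarrow> nat \<times> (int ^ 'n) \<Rightarrow> ennreal" where
  "ball_mean L F r c =
     epowr ((\<integral>\<^sup>+x\<in>bigball L c. epowr (F x) r \<partial>lebesgue) / emeasure lebesgue (bigball L c)) (1 / r)"

lemma ball_mean_powr:
  fixes c :: "nat \<times> (int ^ 'n)"
  assumes "0 < L" "0 < r"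
  shows "(\<integral>\<^sup>+x\<in>bigball L c. epowr (F x) r \<partial>lebesgue)
    = epowr (ball_mean L F r c) r * ennreal (ball_ratio TYPE('n) * side L c ^ CARD('n))"
proof -
  have "0 < ball_ratio TYPE('n) * side L c ^ CARD('n)"
    using ball_ratio_pos[where 'n = 'n] side_pos[OF assms(1), of c] by simp
  from ennreal_divide_mult_cancel[OF this] show ?thesis
    using assms by (simp add: ball_mean_def epowr_inverse emeasure_bigball)
qed

text \<open>Splitting at height t: a value y above t satisfies y \<le> t ^ (1 - r) * y ^ r. If the
  maximal function of the r-th power is of size t ^ r, the bound is a multiple of t.\<close>

lemma ball_maximal_le_power:
  fixes g :: "'a::euclidean_space \<Rightarrow> ennreal"
  assumes [measurable]: "g \<in> borel_measurable lebesgue" and t: "0 < t" and r: "1 < r"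
  shows "ball_maximal g x \<le> ennreal t + ennreal (t powr (1 - r)) * ball_maximal (\<lambda>y. epowr (g y) r) x"
  unfolding ball_maximal_def[of g]
proof (rule SUP_least, clarify)
  fix z \<rho> assume \<rho>: "0 < (\<rho>::real)" "x \<in> ball z \<rho>"
  have pt: "y \<le> ennreal t + ennreal (t powr (1 - r)) * epowr y r" for y
  proof (cases y)
    case (real b)
    show ?thesis
    proof (cases "b \<le> t")
      case True
      then show ?thesis using real by (intro add_increasing2) (auto intro: ennreal_leI)
    next
      case False
      have "b = b powr (1 - r) * b powr r" using False t by (simp flip: powr_add)
      also have "\<dots> \<le> t powr (1 - r) * b powr r"
        using False t r by (intro mult_right_mono powr_mono2') auto
      finally show ?thesis using real t False
        by (intro add_increasing) (auto simp: epowr_ennreal ennreal_leI simp flip: ennreal_mult)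
    qed
  next
    case top
    then show ?thesis using t by (simp add: ennreal_mult_top)
  qed
  define V where "V = unit_ball_vol (DIM('a)) * \<rho> ^ DIM('a)"
  have V: "0 < V" "emeasure lebesgue (ball z \<rho>) = ennreal V"
    using \<rho> emeasure_lebesgue_ball[of \<rho> z] by (simp_all add: V_def)
  have [measurable]: "(\<lambda>y. indicator (ball z \<rho>) y :: ennreal) \<in> borel_measurable lebesgue"
    by (intro borel_measurable_indicator) simp
  have "(\<integral>\<^sup>+y\<in>ball z \<rho>. g y \<partial>lebesgue) \<le> (\<integral>\<^sup>+y. ennreal t * indicator (ball z \<rho>) y
      + ennreal (t powr (1 - r)) * (epowr (g y) r * indicator (ball z \<rho>) y) \<partial>lebesgue)"
    using pt by (intro nn_integral_mono) (auto split: split_indicator)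
  also have "\<dots> = ennreal t * ennreal V + ennreal (t powr (1 - r)) * (\<integral>\<^sup>+y\<in>ball z \<rho>. epowr (g y) r \<partial>lebesgue)"
    using V by (subst nn_integral_add) (auto simp: nn_integral_cmult nn_integral_cmult_indicator)
  finally have "(\<integral>\<^sup>+y\<in>ball z \<rho>. g y \<partial>lebesgue) / ennreal V \<le>
    (ennreal t * ennreal V + ennreal (t powr (1 - r)) * (\<integral>\<^sup>+y\<in>ball z \<rho>. epowr (g y) r \<partial>lebesgue)) / ennreal V"
    by (rule divide_right_mono_ennreal)
  also have "\<dots> = ennreal t + ennreal (t powr (1 - r)) * ((\<integral>\<^sup>+y\<in>ball z \<rho>. epowr (g y) r \<partial>lebesgue) / ennreal V)"
    using V by (simp add: add_divide_distrib_ennreal ennreal_mult_divide_eq ennreal_times_divide)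
  also have "\<dots> \<le> ennreal t + ennreal (t powr (1 - r)) * ball_maximal (\<lambda>y. epowr (g y) r) x"
    using ball_maximal_upper[OF \<rho>, of "\<lambda>y. epowr (g y) r"] V by (intro add_left_mono mult_left_mono) auto
  finally show "(\<integral>\<^sup>+y\<in>ball z \<rho>. g y \<partial>lebesgue) / emeasure lebesgue (ball z \<rho>) \<le> \<dots>" using V by simp
qed

text \<open>Serves to discard the kernel tails. Values may be infinite, so an intermediate level
  between y and a supplies the margin that t has to beat.\<close>

lemma le_liminf_perturbation:
  fixes a :: ennreal
  assumes le: "eventually (\<lambda>n. a \<le> b n + t n) sequentially" and t: "t \<longlonglongrightarrow> 0"
  shows "a \<le> liminf b"
  unfolding le_Liminf_iff
proof (intro allI impI)
  fix y assume "y < a"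
  then obtain y' where y': "y < y'" "y' < a" using dense by blast
  then have "y' - y \<noteq> 0" using ennreal_minus_eq_0[of y' y] by auto
  then have "0 < y' - y" by (simp add: zero_less_iff_neq_zero)
  then have "eventually (\<lambda>n. t n < y' - y) sequentially" using t by (simp add: order_tendstoD)
  with le show "eventually (\<lambda>n. y < b n) sequentially"
  proof eventually_elim
    case (elim n)
    show ?case
    proof (rule ccontr)
      assume "\<not> y < b n"
      then have "b n + t n \<le> y + (y' - y)" using elim(2) by (intro add_mono) (auto simp: not_less)
      with elim(1) have "a \<le> y + (y' - y)" by (rule order_trans)
      also have "\<dots> = y'" using y' by (simp add: add_diff_inverse_ennreal less_imp_le)
      finally show False using y' by simp
    qed
  qed
qed

text \<open>Fatou's lemma for the counting measure on the indices, combined with lower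
  semicontinuity of the powers.\<close>

lemma lq_norm_liminf_le:
  assumes "0 < q"
  shows "lq_norm q (\<lambda>j. liminf (\<lambda>M. b M j)) \<le> liminf (\<lambda>M. lq_norm q (b M))"
proof -
  have "(\<Sum>j. epowr (liminf (\<lambda>M. b M j)) q) \<le> (\<Sum>j. liminf (\<lambda>M. epowr (b M j) q))"
    by (intro suminf_le epowr_Liminf_le assms) auto
  also have "\<dots> \<le> liminf (\<lambda>M. \<Sum>j. epowr (b M j) q)"
    using nn_integral_liminf[of "\<lambda>M j. epowr (b M j) q" "count_space UNIV"]
    by (simp add: nn_integral_count_space_nat)
  finally have "lq_norm q (\<lambda>j. liminf (\<lambda>M. b M j)) \<le> epowr (liminf (\<lambda>M. \<Sum>j. epowr (b M j) q)) (1 / q)"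
    unfolding lq_norm_def using assms by (intro epowr_mono) auto
  also have "\<dots> \<le> liminf (\<lambda>M. lq_norm q (b M))"
    unfolding lq_norm_def using assms by (intro epowr_Liminf_le) auto
  finally show ?thesis .
qed

context modulated_cz
begin

lemma modulated_le_add:
  assumes "g \<in> D" "h \<in> D"
  shows "modulated T I \<phi> g x \<le> modulated T I \<phi> (\<lambda>y. g y + h y) x + modulated T I \<phi> h x"
  unfolding modulated_def
proof (rule SUP_least)
  fix \<alpha> assume \<alpha>: "\<alpha> \<in> I"
  have "T (\<lambda>y. e \<alpha> y * (g y + h y)) x = T (\<lambda>y. e \<alpha> y * g y) x + T (\<lambda>y. e \<alpha> y * h y) x"
    unfolding distrib_left using \<alpha> assms by (intro T_add e_mult_in_D)
  then have "norm (T (\<lambda>y. e \<alpha> y * g y) x) \<le> norm (T (\<lambda>y. e \<alpha> y * (g y + h y)) x) + norm (T (\<lambda>y. e \<alpha> y * h y) x)"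
    using norm_triangle_ineq4[of "T (\<lambda>y. e \<alpha> y * (g y + h y)) x" "T (\<lambda>y. e \<alpha> y * h y) x"] by simp
  then have "ennreal (norm (T (\<lambda>y. e \<alpha> y * g y) x))
      \<le> ennreal (norm (T (\<lambda>y. e \<alpha> y * (g y + h y)) x)) + ennreal (norm (T (\<lambda>y. e \<alpha> y * h y) x))"
    by (simp add: ennreal_leI flip: ennreal_plus)
  also have "\<dots> \<le> (SUP \<alpha>\<in>I. ennreal (norm (T (\<lambda>y. e \<alpha> y * (g y + h y)) x))) + (SUP \<alpha>\<in>I. ennreal (norm (T (\<lambda>y. e \<alpha> y * h y) x)))"
    using \<alpha> by (intro add_mono SUP_upper2[OF \<alpha>]) auto
  finally show "ennreal (norm (T (\<lambda>y. e \<alpha> y * g y) x)) \<le> \<dots>" .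
qed

text \<open>Removing the piece \<open>B2\<close> costs at most its own contribution. This bounds the
  operator on a difference of balls at a point where both balls are under control.\<close>

lemma G_le_union:
  assumes f: "\<And>j. f j \<in> D" and B: "B1 \<in> sets lebesgue" "B2 \<in> sets lebesgue" "B1 \<inter> B2 = {}"
  shows "G f B1 x \<le> G f (B1 \<union> B2) x + G f B2 x"
proof -
  have "cut (B1 \<union> B2) f j = (\<lambda>y. cut B1 f j y + cut B2 f j y)" for j
    using B(3) by (auto simp: fun_eq_iff cut_def indicator_def)
  then have "G f B1 x \<le> lq_norm q (\<lambda>j. modulated T I \<phi> (cut (B1 \<union> B2) f j) x + modulated T I \<phi> (cut B2 f j) x)"
    unfolding modulated_seq_norm_def using q f B
    by (intro lq_norm_mono) (auto intro!: modulated_le_add cut_in_D)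
  also have "\<dots> \<le> G f (B1 \<union> B2) x + G f B2 x"
    unfolding modulated_seq_norm_def by (rule lq_norm_triangle[OF q])
  finally show ?thesis .
qed

lemma seq_norm_measurable:
  assumes "\<And>j. f j \<in> D"
  shows "seq_norm q f \<in> borel_measurable lebesgue"
proof -
  have [measurable]: "f j \<in> borel_measurable lebesgue" for j by (intro D_measurable assms)
  show ?thesis unfolding seq_norm_def[abs_def] by measurable
qed

text \<open>The cut-off makes the weak-type hypothesis applicable, with a local integral in place of
  the norm. The hypothesis also supplies measurability, which a supremum over an arbitrary
  \<open>I\<close> does not have by itself.\<close>

lemma G_weak_type:
  assumes f: "\<And>j. f j \<in> D" and B: "B \<in> sets lebesgue" and r: "0 < r" and b: "0 \<le> b"
    and weak: "weak_type_bound D q T I \<phi> r b"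
    and fin: "(\<integral>\<^sup>+x\<in>B. epowr (seq_norm q f x) r \<partial>lebesgue) < top"
  shows "G f B \<in> borel_measurable lebesgue"
    and "0 < t \<Longrightarrow> emeasure lebesgue {x. ennreal t < G f B x} \<le>
      ennreal ((b / t) powr r) * (\<integral>\<^sup>+x\<in>B. epowr (seq_norm q f x) r \<partial>lebesgue)"
proof -
  let ?J = "\<integral>\<^sup>+x\<in>B. epowr (seq_norm q f x) r \<partial>lebesgue"
  have "epowr (seq_norm q (cut B f) x) r = epowr (seq_norm q f x) r * indicator B x" for x
    using q by (simp add: seq_norm_cut indicator_def)
  then have N: "Lr_norm r (seq_norm q (cut B f)) = epowr ?J (1 / r)"
    unfolding Lr_norm_def by simp
  have *: "G f B \<in> borel_measurable lebesgue \<and> weak_Lr_norm r (G f B) \<le> ennreal b * epowr ?J (1 / r)"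
  proof -
    have "\<forall>j. cut B f j \<in> D" using f B cut_in_D by blast
    moreover have "Lr_norm r (seq_norm q (cut B f)) < top" using fin by (simp add: N)
    ultimately show ?thesis using weak unfolding weak_type_bound_def N[symmetric] by blast
  qed
  then show "G f B \<in> borel_measurable lebesgue" by simp
  assume t: "0 < t"
  have "ennreal t * epowr (emeasure lebesgue {x. ennreal t < G f B x}) (1 / r) \<le> weak_Lr_norm r (G f B)"
    unfolding weak_Lr_norm_def using t by (intro SUP_upper) auto
  also have "\<dots> \<le> ennreal b * epowr ?J (1 / r)" using * by simp
  finally have "epowr (ennreal t * epowr (emeasure lebesgue {x. ennreal t < G f B x}) (1 / r)) r
      \<le> epowr (ennreal b * epowr ?J (1 / r)) r"
    using r by (intro epowr_mono) auto
  then have "ennreal (t powr r) * emeasure lebesgue {x. ennreal t < G f B x} \<le> ennreal (b powr r) * ?J"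
    using r t b by (simp add: epowr_mult epowr_inverse epowr_ennreal)
  then have "ennreal (1 / t powr r) * (ennreal (t powr r) * emeasure lebesgue {x. ennreal t < G f B x})
      \<le> ennreal (1 / t powr r) * (ennreal (b powr r) * ?J)"
    by (rule mult_left_mono) simp
  then show "emeasure lebesgue {x. ennreal t < G f B x} \<le> ennreal ((b / t) powr r) * ?J"
    using t b by (simp add: powr_divide flip: mult.assoc ennreal_mult)
qed

text \<open>With norm zero the level set at each height 1 / (m + 1) is null, and these heights tend
  to 0.\<close>

lemma G_zero:
  assumes f: "\<And>j. f j \<in> D" and B: "B \<in> sets lebesgue" and r: "0 < r" and b: "0 \<le> b"
    and weak: "weak_type_bound D q T I \<phi> r b"
    and J: "(\<integral>\<^sup>+x\<in>B. epowr (seq_norm q f x) r \<partial>lebesgue) = 0"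
  shows "AE x in lebesgue. G f B x = 0"
proof -
  note w = G_weak_type[where f = f, OF f B r b weak]
  have [measurable]: "G f B \<in> borel_measurable lebesgue" using J by (intro w) simp
  have "AE x in lebesgue. \<not> ennreal (1 / Suc m) < G f B x" for m
  proof (rule AE_I')
    have "{x \<in> space lebesgue. ennreal (1 / Suc m) < G f B x} \<in> sets lebesgue" by measurable
    then show "{x. ennreal (1 / Suc m) < G f B x} \<in> null_sets lebesgue"
      using w(2)[where t = "1 / Suc m"] J by (auto simp: null_sets_def)
  qed auto
  then have "AE x in lebesgue. \<forall>m. \<not> ennreal (1 / Suc m) < G f B x"
    by (simp add: AE_all_countable)
  then show ?thesis
  proof eventually_elim
    case (elim x)
    show ?case
    proof (rule ccontr)
      assume "G f B x \<noteq> 0"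
      then have "0 < G f B x" by (simp add: zero_less_iff_neq_zero)
      moreover have "(\<lambda>m. ennreal (1 / Suc m)) \<longlonglongrightarrow> ennreal 0"
        using LIMSEQ_inverse_real_of_nat by (intro tendsto_ennrealI) (simp add: inverse_eq_divide)
      ultimately have "eventually (\<lambda>m. ennreal (1 / Suc m) < G f B x) sequentially"
        by (simp add: order_tendstoD)
      then show False using elim by (auto simp: eventually_sequentially)
    qed
  qed
qed

text \<open>
  \<open>\<theta>\<close> is the proportion of a cell that \<open>stopping_cells\<close> allows for the exceptional set; \<open>K1\<close> and \<open>K2\<close> are the
  heights at which the weak type bounds for the operator and for the maximal function yield \<open>\<theta> / 4\<close>.
\<close>

definition "\<theta> = 1 / (4 * 3 ^ CARD('n) :: real)"

definition "K1 r b = (1 + b) * (4 * ball_ratio TYPE('n) / \<theta>) powr (1 / r)"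

definition "K2 = 4 * 5 ^ CARD('n) * ball_ratio TYPE('n) / \<theta>"

text \<open>One summand for each term at the comparison point: the operator on the large ball, the
  operator on the small ball (whose mean is at most \<open>K2 powr (1 / r)\<close> times the large
  one), and the oscillation of the remainder.\<close>

definition "K3 r b = K1 r b + K1 r b * K2 powr (1 / r) + C\<^sub>K * (1 + K2)"

lemma \<theta>: "0 < \<theta>" "\<theta> \<le> 1 / 4"
  by (simp_all add: \<theta>_def)

lemma K_pos: "0 \<le> b \<Longrightarrow> 0 < K1 r b" "0 < K2" "0 \<le> b \<Longrightarrow> 0 < K3 r b"
proof -
  have v: "0 < ball_ratio TYPE('n)" by (rule ball_ratio_pos)
  show K1: "0 < K1 r b" if "0 \<le> b" for b using v \<theta> that by (simp add: K1_def add_pos_nonneg)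
  show K2: "0 < K2" using v \<theta> by (simp add: K2_def)
  show "0 \<le> b \<Longrightarrow> 0 < K3 r b" using K1[of b] K2 C\<^sub>K_nonneg
    by (simp add: K3_def add_pos_nonneg)
qed

text \<open>The height is proportional to the mean, so the mean cancels in the weak-type bound. The
  factor 1 + b in \<open>K1\<close> keeps the height positive for b = 0 and enters through b / (1 +
  b) \<le> 1.\<close>

lemma G_exceptional:
  assumes L: "0 < L" and f: "\<And>j. f j \<in> D" and r: "1 < r" and b: "0 \<le> b"
    and weak: "weak_type_bound D q T I \<phi> r b"
    and fin: "(\<integral>\<^sup>+x\<in>bigball L c. epowr (seq_norm q f x) r \<partial>lebesgue) < top"
  shows "emeasure lebesgue {x. ennreal (K1 r b) * ball_mean L (seq_norm q f) r c < G f (bigball L c) x}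
    \<le> ennreal (\<theta> / 4 * measure lebesgue (cell L c))"
proof -
  let ?a = "ball_mean L (seq_norm q f) r c" and ?J = "\<integral>\<^sup>+x\<in>bigball L c. epowr (seq_norm q f x) r \<partial>lebesgue"
  let ?V = "side L c ^ CARD('n)"
  have V: "0 < ?V" using side_pos[OF L, of c] by simp
  have J: "?J = epowr ?a r * ennreal (ball_ratio TYPE('n) * ?V)"
    using L r by (intro ball_mean_powr) auto
  have v: "0 < ball_ratio TYPE('n)" by (rule ball_ratio_pos)
  note w = G_weak_type[where f = f, OF f bigball_lebesgue _ b weak fin]
  have [measurable]: "G f (bigball L c) \<in> borel_measurable lebesgue" using r by (intro w) simp
  have afin: "?a < top" using fin r V v
    by (cases ?J) (auto simp: ball_mean_def emeasure_bigball[OF L] divide_ennreal)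
  show ?thesis
  proof (cases "?a = 0")
    case True
    \<comment> \<open>For mean 0 the height is 0 as well, and the weak-type estimate, stated for
      positive heights, is replaced by \<open>G_zero\<close>.\<close>
    then have "?J = 0" using J r by simp
    then have "AE x in lebesgue. G f (bigball L c) x = 0" using f r b weak by (intro G_zero) auto
    then have "AE x in lebesgue. \<not> ennreal (K1 r b) * ?a < G f (bigball L c) x"
      by eventually_elim simp
    moreover have "{x \<in> space lebesgue. ennreal (K1 r b) * ?a < G f (bigball L c) x} \<in> sets lebesgue"
      by measurable
    ultimately have "emeasure lebesgue {x. ennreal (K1 r b) * ?a < G f (bigball L c) x} = 0"
      using AE_iff_measurable[of _ lebesgue "\<lambda>x. \<not> ennreal (K1 r b) * ?a < G f (bigball L c) x"]
      by simp
    then show ?thesis by simp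
  next
    case False
    then obtain \<alpha> where \<alpha>: "?a = ennreal \<alpha>" "0 < \<alpha>"
      using afin by (metis ennreal_cases ennreal_0 less_eq_real_def less_irrefl)
    have K1: "0 < K1 r b" by (rule K_pos(1)[OF b])
    have "emeasure lebesgue {x. ennreal (K1 r b * \<alpha>) < G f (bigball L c) x}
      \<le> ennreal ((b / (K1 r b * \<alpha>)) powr r) * ?J"
      using r K1 \<alpha> by (intro w(2)) auto
    also have "\<dots> = ennreal ((b / (K1 r b * \<alpha>)) powr r * (\<alpha> powr r * (ball_ratio TYPE('n) * ?V)))"
      using \<alpha> v V by (simp add: J epowr_ennreal ennreal_mult)
    also have "\<dots> \<le> ennreal (\<theta> / 4 * ?V)"
    proof (rule ennreal_leI)
      have "b / K1 r b \<le> 1 / (4 * ball_ratio TYPE('n) / \<theta>) powr (1 / r)"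
      proof -
        have "b / (1 + b) * (1 / (4 * ball_ratio TYPE('n) / \<theta>) powr (1 / r)) \<le> 1 * (1 / (4 * ball_ratio TYPE('n) / \<theta>) powr (1 / r))"
          using b by (intro mult_right_mono) auto
        then show ?thesis by (simp add: K1_def)
      qed
      then have "(b / K1 r b) powr r \<le> (1 / (4 * ball_ratio TYPE('n) / \<theta>) powr (1 / r)) powr r"
        using b K1 r by (intro powr_mono2) auto
      also have "\<dots> = \<theta> / (4 * ball_ratio TYPE('n))"
        using r v \<theta> by (simp add: powr_divide powr_powr)
      finally have "(b / K1 r b) powr r * ball_ratio TYPE('n) \<le> \<theta> / 4"
        using v by (simp add: field_simps)
      then have "(b / K1 r b) powr r * ball_ratio TYPE('n) * ?V \<le> \<theta> / 4 * ?V"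
        using V by (intro mult_right_mono) auto
      moreover have "(b / (K1 r b * \<alpha>)) powr r * \<alpha> powr r = (b / K1 r b) powr r"
        using b K1 \<alpha> by (simp add: powr_divide powr_mult)
      ultimately show "(b / (K1 r b * \<alpha>)) powr r * (\<alpha> powr r * (ball_ratio TYPE('n) * ?V)) \<le> \<theta> / 4 * ?V"
        by (simp add: mult.assoc[symmetric])
    qed
    finally show ?thesis unfolding measure_cell[OF L] \<alpha>(1)
      using K1 \<alpha>(2) by (simp add: ennreal_mult)
  qed
qed

text \<open>The exceptional set is enlarged to an open set for \<open>stopping_cells\<close>:
  \<theta> / 4 for each of the two weak-type bounds and \<theta> / 2 for the enlargement add up to
  \<theta>. In a selected cell the open set leaves at least half of the measure, enough for a point
  that also avoids the exceptional set belonging to that cell.\<close>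

lemma stopping_step:
  fixes c :: "nat \<times> (int ^ 'n)"
  assumes L: "0 < L" and f: "\<And>j. f j \<in> D" and r: "1 < r" and b: "0 \<le> b"
    and weak: "weak_type_bound D q T I \<phi> r b"
    and fin: "\<And>c. (\<integral>\<^sup>+x\<in>bigball L c. epowr (seq_norm q f x) r \<partial>lebesgue) < top"
    and pos: "ball_mean L (seq_norm q f) r c \<noteq> 0"
  shows "\<exists>P. (\<forall>d\<in>P. cell L d \<subseteq> cell L c) \<and> disjoint_family_on (cell L) P \<and>
      emeasure lebesgue (\<Union>d\<in>P. cell L d) \<le> ennreal (measure lebesgue (cell L c) / 2) \<and>
      (\<forall>x\<in>cell L c - (\<Union>d\<in>P. cell L d). G f (bigball L c) x \<le> ennreal (K3 r b) * ball_mean L (seq_norm q f) r c) \<and>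
      (\<forall>d\<in>P. \<forall>x\<in>cell L d. G f (bigball L c) x \<le> G f (bigball L d) x + ennreal (K3 r b) * ball_mean L (seq_norm q f) r c)"
proof -
  define F where "F = seq_norm q f"
  define B where "B = bigball L c"
  define H where "H x = epowr (F x) r * indicator B x" for x
  have [measurable]: "F \<in> borel_measurable lebesgue" unfolding F_def by (rule seq_norm_measurable[OF f])
  have sB [measurable]: "B \<in> sets lebesgue" by (simp add: B_def)
  have [measurable]: "H \<in> borel_measurable lebesgue" unfolding H_def by measurable
  have K: "0 < K1 r b" "0 < K2" "0 < K3 r b" using K_pos b by auto
  have v: "0 < ball_ratio TYPE('n)" by (rule ball_ratio_pos)
  let ?V = "side L c ^ CARD('n)"
  have V: "0 < ?V" using side_pos[OF L, of c] by simp
  have "ball_mean L F r c < top"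
    using fin[of c] v V unfolding F_def[symmetric]
    by (cases "\<integral>\<^sup>+x\<in>bigball L c. epowr (F x) r \<partial>lebesgue")
       (auto simp: ball_mean_def emeasure_bigball[OF L] divide_ennreal)
  then obtain \<alpha> where \<alpha>: "ball_mean L F r c = ennreal \<alpha>" "0 < \<alpha>"
    using pos unfolding F_def[symmetric] by (metis ennreal_cases ennreal_0 less_eq_real_def less_irrefl)
  have JH: "(\<integral>\<^sup>+x. H x \<partial>lebesgue) = ennreal (\<alpha> powr r * (ball_ratio TYPE('n) * ?V))"
    using ball_mean_powr[OF L, of r F c] r \<alpha> v V by (simp add: H_def B_def epowr_ennreal ennreal_mult)
  define E where "E = {x. ennreal (K1 r b * \<alpha>) < G f B x} \<union> {x. ennreal (K2 * \<alpha> powr r) < ball_maximal H x}"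
  have [measurable]: "G f B \<in> borel_measurable lebesgue"
    unfolding B_def using r by (intro G_weak_type(1)[where f = f, OF f bigball_lebesgue _ b weak fin]) simp
  have "{x \<in> space lebesgue. ennreal (K1 r b * \<alpha>) < G f B x} \<union>
      {x \<in> space lebesgue. ennreal (K2 * \<alpha> powr r) < ball_maximal H x} \<in> sets lebesgue"
    by measurable
  then have sE: "E \<in> sets lebesgue" by (simp add: E_def)
  have E1: "emeasure lebesgue {x. ennreal (K1 r b * \<alpha>) < G f B x} \<le> ennreal (\<theta> / 4 * ?V)"
    using G_exceptional[where f = f, OF L f r b weak fin, of c] K \<alpha>
    unfolding F_def[symmetric] B_def[symmetric] measure_cell[OF L] by (simp add: ennreal_mult)
  have E2: "emeasure lebesgue {x. ennreal (K2 * \<alpha> powr r) < ball_maximal H x} \<le> ennreal (\<theta> / 4 * ?V)"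
  proof -
    have "emeasure lebesgue {x. ennreal (K2 * \<alpha> powr r) < ball_maximal H x}
      \<le> ennreal (5 ^ DIM(real ^ 'n) / (K2 * \<alpha> powr r)) * (\<integral>\<^sup>+x. H x \<partial>lebesgue)"
      using K \<alpha> by (intro ball_maximal_weak_type) auto
    also have "\<dots> = ennreal (5 ^ CARD('n) / (K2 * \<alpha> powr r) * (\<alpha> powr r * (ball_ratio TYPE('n) * ?V)))"
      unfolding JH using K \<alpha> v V by (subst ennreal_mult[symmetric]) (auto simp: less_imp_le)
    also have "5 ^ CARD('n) / (K2 * \<alpha> powr r) * (\<alpha> powr r * (ball_ratio TYPE('n) * ?V)) = \<theta> / 4 * ?V"
      using \<alpha> v \<theta> by (simp add: K2_def field_simps)
    finally show ?thesis .
  qed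
  have Esmall: "emeasure lebesgue E \<le> ennreal (\<theta> / 2 * ?V)"
  proof -
    have "emeasure lebesgue E \<le> ennreal (\<theta> / 4 * ?V) + ennreal (\<theta> / 4 * ?V)"
      unfolding E_def
    proof (rule order_trans[OF emeasure_subadditive add_mono[OF E1 E2]])
      have "{x \<in> space lebesgue. ennreal (K1 r b * \<alpha>) < G f B x} \<in> sets lebesgue" by measurable
      then show "{x. ennreal (K1 r b * \<alpha>) < G f B x} \<in> sets lebesgue" by simp
      have "{x \<in> space lebesgue. ennreal (K2 * \<alpha> powr r) < ball_maximal H x} \<in> sets lebesgue" by measurable
      then show "{x. ennreal (K2 * \<alpha> powr r) < ball_maximal H x} \<in> sets lebesgue" by simp
    qed
    also have "\<dots> = ennreal (\<theta> / 2 * ?V)"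
      using \<theta> V by (subst ennreal_plus[symmetric]) (auto simp: field_simps)
    finally show ?thesis .
  qed
  have "0 < \<theta> / 2 * ?V" using \<theta> V by simp
  then obtain U where U: "open U" "E \<subseteq> U" "emeasure lebesgue (U - E) < ennreal (\<theta> / 2 * ?V)"
    by (rule sets_lebesgue_outer_open[OF sE])
  have sU: "U \<in> sets lebesgue" using U(1) by (simp add: borel_open)
  have "emeasure lebesgue (cell L c \<inter> U) \<le> emeasure lebesgue U"
    using sU by (intro emeasure_mono) auto
  also have "\<dots> = emeasure lebesgue (E \<union> (U - E))" using U(2) by (simp add: Un_absorb1)
  also have "\<dots> \<le> emeasure lebesgue E + emeasure lebesgue (U - E)"
    using sE sU by (intro emeasure_subadditive) auto
  also have "\<dots> \<le> ennreal (\<theta> / 2 * ?V) + ennreal (\<theta> / 2 * ?V)"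
    using Esmall U(3) by (intro add_mono) auto
  also have "\<dots> = ennreal (\<theta> * ?V)"
    using \<theta> V by (subst ennreal_plus[symmetric]) (auto simp: field_simps)
  finally have "measure lebesgue (cell L c \<inter> U) \<le> \<theta> * ?V"
    unfolding measure_def using \<theta> V by (intro enn2real_leI) auto
  then have "measure lebesgue (cell L c \<inter> U) \<le> measure lebesgue (cell L c) / (4 * 3 ^ CARD('n))"
    unfolding measure_cell[OF L] by (simp add: \<theta>_def)
  then obtain P where
    P: "\<And>d. d \<in> P \<Longrightarrow> cell L d \<subseteq> cell L c" "\<And>d. d \<in> P \<Longrightarrow> fst c < fst d" "disjoint_family_on (cell L) P"
    "cell L c \<inter> U \<subseteq> (\<Union>d\<in>P. cell L d)"
    "\<And>d. d \<in> P \<Longrightarrow> measure lebesgue (cell L d \<inter> U) \<le> measure lebesgue (cell L d) / 2"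
    "emeasure lebesgue (\<Union>d\<in>P. cell L d) \<le> ennreal (measure lebesgue (cell L c) / 2)"
    by (rule stopping_cells[OF L U(1)]) blast
  have K13: "K1 r b \<le> K3 r b" using K C\<^sub>K_nonneg by (simp add: K3_def)
  have out: "G f B x \<le> ennreal (K3 r b) * ennreal \<alpha>" if "x \<in> cell L c - (\<Union>d\<in>P. cell L d)" for x
  proof -
    have "x \<notin> E" using that P(4) U(2) by auto
    then have "G f B x \<le> ennreal (K1 r b * \<alpha>)" by (simp add: E_def not_less)
    also have "\<dots> \<le> ennreal (K3 r b * \<alpha>)" using K13 \<alpha> by (intro ennreal_leI mult_right_mono) auto
    finally show ?thesis using K \<alpha> by (simp add: ennreal_mult)
  qed
  have inside: "G f B x \<le> G f (bigball L d) x + ennreal (K3 r b) * ennreal \<alpha>" if d: "d \<in> P" and x: "x \<in> cell L d" for d x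
  proof -
    define B' where "B' = bigball L d"
    have sB' [measurable]: "B' \<in> sets lebesgue" by (simp add: B'_def)
    have B'B: "B' \<subseteq> B" unfolding B'_def B_def by (intro bigball_subset L P d)
    let ?a = "ball_mean L F r d"
    let ?E' = "{x. ennreal (K1 r b) * ?a < G f B' x}"
    let ?Vd = "measure lebesgue (cell L d)"
    have Vd: "0 < ?Vd" using side_pos[OF L, of d] unfolding measure_cell[OF L] by simp
    have E': "emeasure lebesgue ?E' \<le> ennreal (\<theta> / 4 * ?Vd)"
      using G_exceptional[where f = f, OF L f r b weak fin, of d] by (simp only: F_def B'_def)
    have [measurable]: "G f B' \<in> borel_measurable lebesgue"
      unfolding B'_def using r by (intro G_weak_type(1)[where f = f, OF f bigball_lebesgue _ b weak fin]) simp
    have "{x \<in> space lebesgue. ennreal (K1 r b) * ?a < G f B' x} \<in> sets lebesgue" by measurable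
    then have sE': "?E' \<in> sets lebesgue" by simp
    have scU: "cell L d \<inter> U \<in> sets lebesgue" using sU by (intro sets.Int) simp_all
    \<comment> \<open>Otherwise the measure of the cell would be at most 1 / 2 + 1 / 16 of
      itself.\<close>
    have "\<not> cell L d \<subseteq> (cell L d \<inter> U) \<union> ?E'"
    proof
      assume "cell L d \<subseteq> (cell L d \<inter> U) \<union> ?E'"
      then have "emeasure lebesgue (cell L d) \<le> emeasure lebesgue ((cell L d \<inter> U) \<union> ?E')"
        by (rule emeasure_mono[OF _ sets.Un[OF scU sE']])
      also have "\<dots> \<le> emeasure lebesgue (cell L d \<inter> U) + emeasure lebesgue ?E'"
        by (rule emeasure_subadditive[OF scU sE'])
      also have "emeasure lebesgue (cell L d \<inter> U) = ennreal (measure lebesgue (cell L d \<inter> U))"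
        using sU L by (intro emeasure_eq_measure2 fmeasurable_Int_fmeasurable) auto
      also have "\<dots> + emeasure lebesgue ?E' \<le> ennreal (?Vd / 2) + ennreal (\<theta> / 4 * ?Vd)"
        using P(5)[OF d] E' by (intro add_mono ennreal_leI)
      also have "\<dots> = ennreal (?Vd / 2 + \<theta> / 4 * ?Vd)"
        using Vd \<theta> by (intro ennreal_plus[symmetric]) auto
      also have "emeasure lebesgue (cell L d) = ennreal ?Vd"
        using L by (intro emeasure_eq_measure2) simp
      finally have "?Vd \<le> ?Vd / 2 + \<theta> / 4 * ?Vd"
        using Vd \<theta> by (subst (asm) ennreal_le_iff) auto
      moreover have "\<theta> / 4 * ?Vd \<le> 1 / 16 * ?Vd" using Vd \<theta> by (intro mult_right_mono) auto
      ultimately show False using Vd by simp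
    qed
    \<comment> \<open>A comparison point for the tail of \<open>f\<close>: outside \<open>U\<close> both the operator and the maximal function are small.\<close>
    then obtain x' where x': "x' \<in> cell L d" "x' \<notin> U" "x' \<notin> ?E'" by blast
    have x'B': "x' \<in> B'" using x'(1) cell_subset_bigball[OF L, of d] by (auto simp: B'_def)
    have Gx': "G f B x' \<le> ennreal (K1 r b * \<alpha>)" and Hx': "ball_maximal H x' \<le> ennreal (K2 * \<alpha> powr r)"
    proof -
      have "x' \<notin> E" using x'(2) U(2) by blast
      then show "G f B x' \<le> ennreal (K1 r b * \<alpha>)" "ball_maximal H x' \<le> ennreal (K2 * \<alpha> powr r)"
        by (simp_all add: E_def not_less)
    qed
    have rd: "0 < 3 * (CARD('n) * side L d)" using side_pos[OF L, of d] by simp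
    \<comment> \<open>The ball of d contains x' and so competes in the maximal function at x'; its
      mean is controlled by that of the large ball.\<close>
    have "?a \<le> ennreal (K2 powr (1 / r) * \<alpha>)"
    proof -
      have "(\<integral>\<^sup>+x\<in>B'. epowr (F x) r \<partial>lebesgue) \<le> (\<integral>\<^sup>+x\<in>B'. H x \<partial>lebesgue)"
        using B'B by (intro nn_integral_mono) (auto simp: H_def split: split_indicator)
      then have "(\<integral>\<^sup>+x\<in>B'. epowr (F x) r \<partial>lebesgue) / emeasure lebesgue B' \<le> (\<integral>\<^sup>+x\<in>B'. H x \<partial>lebesgue) / emeasure lebesgue B'"
        by (rule divide_right_mono_ennreal)
      also have "\<dots> \<le> ball_maximal H x'"
        using x'B' rd unfolding B'_def bigball_def by (intro ball_maximal_upper)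
      also have "\<dots> \<le> ennreal (K2 * \<alpha> powr r)" by (rule Hx')
      finally have "?a \<le> epowr (ennreal (K2 * \<alpha> powr r)) (1 / r)"
        unfolding ball_mean_def B'_def using r by (intro epowr_mono) auto
      also have "\<dots> = ennreal (K2 powr (1 / r) * \<alpha>)"
        using K \<alpha> r by (simp add: epowr_ennreal powr_mult powr_powr)
      finally show ?thesis .
    qed
    then have "ennreal (K1 r b) * ?a \<le> ennreal (K1 r b) * ennreal (K2 powr (1 / r) * \<alpha>)"
      by (rule mult_left_mono) simp
    then have GB'x': "G f B' x' \<le> ennreal (K1 r b * (K2 powr (1 / r) * \<alpha>))"
      using x'(3) K \<alpha> by (simp add: not_less ennreal_mult)
    \<comment> \<open>Splitting at height \<alpha>, where the maximal function of the r-th power is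
      at most \<open>K2 * \<alpha> powr r\<close>.\<close>
    have Mx': "ball_maximal (\<lambda>y. F y * indicator (B - B') y) x' \<le> ennreal (\<alpha> * (1 + K2))"
    proof -
      have "ball_maximal (\<lambda>y. F y * indicator (B - B') y) x' \<le> ball_maximal (\<lambda>y. F y * indicator B y) x'"
        unfolding ball_maximal_def
        by (intro SUP_mono') (auto intro!: divide_right_mono_ennreal nn_integral_mono split: split_indicator)
      also have "\<dots> \<le> ennreal \<alpha> + ennreal (\<alpha> powr (1 - r)) * ball_maximal (\<lambda>y. epowr (F y * indicator B y) r) x'"
        using \<alpha> r by (intro ball_maximal_le_power) auto
      also have "(\<lambda>y. epowr (F y * indicator B y) r) = H"
        by (auto simp: H_def fun_eq_iff split: split_indicator)
      also have "ennreal \<alpha> + ennreal (\<alpha> powr (1 - r)) * ball_maximal H x' \<le> ennreal \<alpha> + ennreal (\<alpha> powr (1 - r)) * ennreal (K2 * \<alpha> powr r)"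
        by (intro add_left_mono mult_left_mono Hx') simp
      also have "\<dots> = ennreal (\<alpha> + \<alpha> powr (1 - r) * (K2 * \<alpha> powr r))"
        using K \<alpha> by (simp add: ennreal_mult)
      also have "\<alpha> + \<alpha> powr (1 - r) * (K2 * \<alpha> powr r) = \<alpha> * (1 + K2)"
        using \<alpha> by (simp add: powr_diff field_simps)
      finally show ?thesis .
    qed
    have BB: "B' \<union> (B - B') = B" "(B - B') \<union> B' = B" using B'B by auto
    have dd: "dist y (center L d) \<le> CARD('n) * side L d / 2" if "y \<in> cell L d" for y
      using dist_center_le[OF L that] .
    \<comment> \<open>Only the part of f outside \<open>B'\<close> is moved from x to x', where the
      kernel differences are under control. The part inside stays at x as \<open>G f B' x\<close>
      and is left to the next generation.\<close>
    have "G f B x \<le> G f B' x + G f (B - B') x"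
      using G_split[of f B' "B - B'" x] f unfolding BB by simp
    also have "G f (B - B') x \<le> G f (B - B') x' + ennreal C\<^sub>K * ball_maximal (\<lambda>y. F y * indicator (B - B') y) x'"
      unfolding F_def using dd[OF x] dd[OF x'(1)] rd
      by (intro G_diff_le[where z = "center L d" and \<rho> = "CARD('n) * side L d"] f) (auto simp: B'_def bigball_def)
    also have "G f (B - B') x' \<le> G f B x' + G f B' x'"
      using G_le_union[of f "B - B'" B' x'] f unfolding BB by (auto simp: sB sB')
    also have "G f B x' + G f B' x' + ennreal C\<^sub>K * ball_maximal (\<lambda>y. F y * indicator (B - B') y) x'
      \<le> ennreal (K1 r b * \<alpha>) + ennreal (K1 r b * (K2 powr (1 / r) * \<alpha>)) + ennreal C\<^sub>K * ennreal (\<alpha> * (1 + K2))"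
      by (intro add_mono mult_left_mono Gx' GB'x' Mx') simp
    also have "\<dots> = ennreal (K1 r b * \<alpha> + K1 r b * (K2 powr (1 / r) * \<alpha>) + C\<^sub>K * (\<alpha> * (1 + K2)))"
      using K \<alpha> C\<^sub>K_nonneg by (simp add: ennreal_mult)
    also have "K1 r b * \<alpha> + K1 r b * (K2 powr (1 / r) * \<alpha>) + C\<^sub>K * (\<alpha> * (1 + K2)) = K3 r b * \<alpha>"
      by (simp add: K3_def field_simps)
    finally show ?thesis using K \<alpha> by (simp add: B'_def ennreal_mult add_left_mono add_right_mono)
  qed
  show ?thesis
    unfolding F_def[symmetric] B_def[symmetric] \<alpha>(1)
    using P out inside by (intro exI[of _ P] conjI ballI) auto
qed

lemma nn_integral_G_le:
  assumes L: "0 < L" and f: "\<And>j. f j \<in> D" and r: "1 < r" and b: "0 \<le> b"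
    and weak: "weak_type_bound D q T I \<phi> r b"
    and fin: "\<And>c. (\<integral>\<^sup>+x\<in>bigball L c. epowr (seq_norm q f x) r \<partial>lebesgue) < top"
    and h: "h \<in> borel_measurable lebesgue"
  shows "(\<integral>\<^sup>+x\<in>cell L c. G f (bigball L c) x * h x \<partial>lebesgue) \<le> 2 * ennreal (K3 r b) *
    (\<integral>\<^sup>+x\<in>cell L c. cell_maximal L (\<lambda>c. ball_mean L (seq_norm q f) r c * cell_average L h c) x \<partial>lebesgue)"
proof (rule nn_integral_le_cell_maximal[OF L h])
  show "G f (bigball L c) \<in> borel_measurable lebesgue" for c
    using r by (intro G_weak_type(1)[where f = f, OF f bigball_lebesgue _ b weak fin]) simp
  show "AE x in lebesgue. G f (bigball L c) x = 0" if "ball_mean L (seq_norm q f) r c = 0" for c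
    using that ball_mean_powr[OF L, of r "seq_norm q f" c] r b weak f by (intro G_zero) auto
  show "\<exists>P. (\<forall>d\<in>P. cell L d \<subseteq> cell L c) \<and> disjoint_family_on (cell L) P \<and>
      emeasure lebesgue (\<Union>d\<in>P. cell L d) \<le> ennreal (measure lebesgue (cell L c) / 2) \<and>
      (\<forall>x\<in>cell L c - (\<Union>d\<in>P. cell L d). G f (bigball L c) x \<le> ennreal (K3 r b) * ball_mean L (seq_norm q f) r c) \<and>
      (\<forall>d\<in>P. \<forall>x\<in>cell L d. G f (bigball L c) x \<le> G f (bigball L d) x + ennreal (K3 r b) * ball_mean L (seq_norm q f) r c)"
    if "ball_mean L (seq_norm q f) r c \<noteq> 0" for c
    by (rule stopping_step[OF L f r b weak fin that])
qed

section \<open>From cut-offs to the full sequence\<close>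

lemma modulated_tail_le:
  assumes g: "g \<in> D" and x: "x \<in> ball z \<rho>" and supp: "\<And>y. y \<in> ball z \<rho> \<Longrightarrow> g y = 0"
  shows "modulated T I \<phi> g x \<le> (\<integral>\<^sup>+y. ennreal (norm (K x y * g y)) \<partial>lebesgue)"
  unfolding modulated_def
proof (rule SUP_least)
  fix \<alpha> assume \<alpha>: "\<alpha> \<in> I"
  have r: "integrable lebesgue (\<lambda>y. K x y * (e \<alpha> y * g y))"
    "T (\<lambda>y. e \<alpha> y * g y) x = (LINT y|lebesgue. K x y * (e \<alpha> y * g y))"
    using rep[OF e_mult_in_D[OF \<alpha> g] not_in_closure_support[OF x]] supp by auto
  have "ennreal (norm (T (\<lambda>y. e \<alpha> y * g y) x)) \<le> (\<integral>\<^sup>+y. ennreal (norm (K x y * (e \<alpha> y * g y))) \<partial>lebesgue)"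
    unfolding r(2) by (rule integral_norm_bound_ennreal[OF r(1)])
  then show "ennreal (norm (T (\<lambda>y. e \<alpha> y * g y) x)) \<le> (\<integral>\<^sup>+y. ennreal (norm (K x y * g y)) \<partial>lebesgue)"
    by (simp add: norm_mult)
qed

text \<open>At a fixed x the error of a cut-off is a tail of the integral of
  \<open>norm (K x y * f j y)\<close> over the complement of a ball about 0 containing x, and the
  kernel representation of the outer part makes this integral finite. The tails need not be uniform
  in j, since each index has its own limit before \<open>lq_norm_liminf_le\<close>.\<close>

lemma modulated_seq_norm_le_liminf:
  assumes f: "\<And>j. f j \<in> D" and R: "filterlim R at_top sequentially"
  shows "modulated_seq_norm q T I \<phi> f x \<le> liminf (\<lambda>m. G f (ball 0 (R m)) x)"
proof -
  have "modulated T I \<phi> (f j) x \<le> liminf (\<lambda>m. modulated T I \<phi> (cut (ball 0 (R m)) f j) x)" for j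
  proof (rule le_liminf_perturbation)
    define \<rho> where "\<rho> = norm x + 1"
    have x\<rho>: "x \<in> ball 0 \<rho>" by (simp add: \<rho>_def)
    define t where "t m = (\<integral>\<^sup>+y. ennreal (norm (K x y * cut (- ball 0 \<rho>) f j y)) * indicator (- ball 0 (R m)) y \<partial>lebesgue)" for m
    have compl: "cut (- ball 0 s) f j \<in> D" for s
      by (intro cut_in_D f) auto
    have int: "integrable lebesgue (\<lambda>y. K x y * cut (- ball 0 \<rho>) f j y)"
      using rep[OF compl not_in_closure_support[OF x\<rho>]] by (auto simp: cut_def)
    have [measurable]: "(\<lambda>y. K x y * cut (- ball 0 \<rho>) f j y) \<in> borel_measurable lebesgue"
      using int by (rule borel_measurable_integrable)
    have [measurable]: "(\<lambda>y. indicator (- ball 0 s) y :: ennreal) \<in> borel_measurable lebesgue" for s :: real and z :: "real ^ 'n"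
      by (intro borel_measurable_indicator) simp
    have fint: "(\<integral>\<^sup>+y. ennreal (norm (K x y * cut (- ball 0 \<rho>) f j y)) \<partial>lebesgue) < \<infinity>"
      using int by (simp add: integrable_iff_bounded)
    have "t \<longlonglongrightarrow> (\<integral>\<^sup>+y. 0 \<partial>(lebesgue :: (real ^ 'n) measure))"
      unfolding t_def
    proof (rule nn_integral_dominated_convergence[where w = "\<lambda>y. ennreal (norm (K x y * cut (- ball 0 \<rho>) f j y))"])
      show "AE y in lebesgue. (\<lambda>m. ennreal (norm (K x y * cut (- ball 0 \<rho>) f j y)) * indicator (- ball 0 (R m)) y) \<longlonglongrightarrow> 0"
      proof (intro AE_I2 tendsto_eventually)
        fix y :: "real ^ 'n"
        have "eventually (\<lambda>m. norm y < R m) sequentially"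
          using R by (auto simp: filterlim_at_top_dense)
        then show "eventually (\<lambda>m. ennreal (norm (K x y * cut (- ball 0 \<rho>) f j y)) * indicator (- ball 0 (R m)) y = 0) sequentially"
          by eventually_elim simp
      qed
    qed (use fint in \<open>auto split: split_indicator\<close>)
    then show "t \<longlonglongrightarrow> 0" by simp
    have "eventually (\<lambda>m. \<rho> \<le> R m) sequentially" using R by (auto simp: filterlim_at_top)
    then show "eventually (\<lambda>m. modulated T I \<phi> (f j) x \<le> modulated T I \<phi> (cut (ball 0 (R m)) f j) x + t m) sequentially"
    proof eventually_elim
      case (elim m)
      have eq: "f j = (\<lambda>y. cut (ball 0 (R m)) f j y + cut (- ball 0 (R m)) f j y)"
        by (auto simp: fun_eq_iff cut_def indicator_def)
      have inD: "cut (ball 0 (R m)) f j \<in> D" by (intro cut_in_D f) simp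
      have "modulated T I \<phi> (f j) x \<le> modulated T I \<phi> (cut (ball 0 (R m)) f j) x + modulated T I \<phi> (cut (- ball 0 (R m)) f j) x"
        by (subst eq) (rule modulated_add_le[OF inD compl])
      also have "modulated T I \<phi> (cut (- ball 0 (R m)) f j) x \<le> (\<integral>\<^sup>+y. ennreal (norm (K x y * cut (- ball 0 (R m)) f j y)) \<partial>lebesgue)"
        using elim x\<rho> by (intro modulated_tail_le[OF compl, of _ 0 "R m"]) (auto simp: cut_def)
      also have "\<dots> = t m"
        unfolding t_def using elim by (intro nn_integral_cong) (auto simp: cut_def split: split_indicator)
      finally show ?case by (simp add: add_left_mono)
    qed
  qed
  then have "modulated_seq_norm q T I \<phi> f x \<le> lq_norm q (\<lambda>j. liminf (\<lambda>m. modulated T I \<phi> (cut (ball 0 (R m)) f j) x))"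
    unfolding modulated_seq_norm_def using q by (intro lq_norm_mono) auto
  also have "\<dots> \<le> liminf (\<lambda>m. G f (ball 0 (R m)) x)"
    unfolding modulated_seq_norm_def using q by (intro lq_norm_liminf_le) auto
  finally show ?thesis .
qed

end

section \<open>Young functions\<close>

text \<open>Marcinkiewicz interpolation with the trivial L^\<infinity> bound: values of g up to t /
  2 add at most t / 2 to any average, so only the part above t / 2 enters the weak-type
  bound.\<close>

lemma ball_maximal_strong_type:
  fixes g :: "'a::euclidean_space \<Rightarrow> ennreal"
  assumes [measurable]: "g \<in> borel_measurable lebesgue" and s: "1 < s"
  shows "(\<integral>\<^sup>+x. epowr (ball_maximal g x) s \<partial>lebesgue)
    \<le> ennreal (2 * 5 ^ DIM('a) * (1 / 2) powr (1 - s) * (s / (s - 1))) * (\<integral>\<^sup>+x. epowr (g x) s \<partial>lebesgue)"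
proof -
  \<comment> \<open>A single truncation, placed at index 0 of the superposition.\<close>
  define c where "c j = (if j = 0 then 1 else 0 :: real)" for j :: nat
  have "(\<integral>\<^sup>+x. epowr (ball_maximal g x) s \<partial>lebesgue) \<le> ennreal (2 * 5 ^ DIM('a)) *
      (\<Sum>j. ennreal (c j * (1 / 2) powr (1 - s))) * ennreal (s / (s - 1)) * (\<integral>\<^sup>+x. epowr (g x) s \<partial>lebesgue)"
  proof (rule strong_type_from_weak[OF s])
    fix t :: real assume t: "0 < t"
    define g' where "g' x = g x * indicator {x. ennreal (1 / 2 * t) < g x} x" for x
    have [measurable]: "g' \<in> borel_measurable lebesgue"
      unfolding g'_def[abs_def] indicator_def by measurable
    have "{x. ennreal t < ball_maximal g x} \<subseteq> {x. ennreal (t / 2) < ball_maximal g' x}"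
    proof clarify
      fix x assume "ennreal t < ball_maximal g x"
      then obtain z \<rho> where z: "0 < \<rho>" "x \<in> ball z \<rho>"
        "ennreal t < (\<integral>\<^sup>+y\<in>ball z \<rho>. g y \<partial>lebesgue) / emeasure lebesgue (ball z \<rho>)"
        unfolding less_ball_maximal_iff by blast
      define V where "V = unit_ball_vol (DIM('a)) * \<rho> ^ DIM('a)"
      have V: "0 < V" "emeasure lebesgue (ball z \<rho>) = ennreal V"
        using z emeasure_lebesgue_ball[of \<rho> z] by (simp_all add: V_def)
      have [measurable]: "(\<lambda>y. indicator (ball z \<rho>) y :: ennreal) \<in> borel_measurable lebesgue"
        by (intro borel_measurable_indicator) simp
      have "(\<integral>\<^sup>+y\<in>ball z \<rho>. g y \<partial>lebesgue) \<le> (\<integral>\<^sup>+y. ennreal (t / 2) * indicator (ball z \<rho>) y + g' y * indicator (ball z \<rho>) y \<partial>lebesgue)"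
        by (intro nn_integral_mono) (auto simp: g'_def not_less split: split_indicator)
      also have "\<dots> = ennreal (t / 2) * ennreal V + (\<integral>\<^sup>+y\<in>ball z \<rho>. g' y \<partial>lebesgue)"
        using V by (subst nn_integral_add) (auto simp: nn_integral_cmult_indicator)
      finally have "(\<integral>\<^sup>+y\<in>ball z \<rho>. g y \<partial>lebesgue) / ennreal V \<le> (ennreal (t / 2) * ennreal V + (\<integral>\<^sup>+y\<in>ball z \<rho>. g' y \<partial>lebesgue)) / ennreal V"
        by (rule divide_right_mono_ennreal)
      also have "\<dots> = ennreal (t / 2) + (\<integral>\<^sup>+y\<in>ball z \<rho>. g' y \<partial>lebesgue) / ennreal V"
        using V by (simp add: add_divide_distrib_ennreal ennreal_mult_divide_eq)
      finally have "ennreal t < ennreal (t / 2) + (\<integral>\<^sup>+y\<in>ball z \<rho>. g' y \<partial>lebesgue) / ennreal V"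
        using z(3) V(2) by simp
      also have "ennreal t = ennreal (t / 2) + ennreal (t / 2)"
        using t by (simp flip: ennreal_plus)
      finally have "ennreal (t / 2) < (\<integral>\<^sup>+y\<in>ball z \<rho>. g' y \<partial>lebesgue) / ennreal V"
        by (simp add: ennreal_add_left_cancel_less)
      also have "\<dots> \<le> ball_maximal g' x" using ball_maximal_upper[OF z(1,2), of g'] V by simp
      finally show "ennreal (t / 2) < ball_maximal g' x" .
    qed
    moreover have "{x \<in> space lebesgue. ennreal (t / 2) < ball_maximal g' x} \<in> sets lebesgue" by measurable
    ultimately have "emeasure lebesgue {x. ennreal t < ball_maximal g x} \<le> emeasure lebesgue {x. ennreal (t / 2) < ball_maximal g' x}"
      by (intro emeasure_mono) auto
    also have "\<dots> \<le> ennreal (5 ^ DIM('a) / (t / 2)) * (\<integral>\<^sup>+x. g' x \<partial>lebesgue)"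
      using t by (intro ball_maximal_weak_type) auto
    also have "\<dots> = ennreal (2 * 5 ^ DIM('a)) * (\<integral>\<^sup>+x. g' x / ennreal t \<partial>lebesgue)"
    proof -
      have "ennreal (5 ^ DIM('a) / (t / 2)) = ennreal (2 * 5 ^ DIM('a)) * ennreal (1 / t)"
        using t by (simp flip: ennreal_mult)
      moreover have "y / ennreal t = ennreal (1 / t) * y" for y
        using t by (simp add: divide_ennreal_def inverse_ennreal inverse_eq_divide mult.commute)
      ultimately show ?thesis by (simp add: nn_integral_cmult mult.assoc)
    qed
    also have "(\<integral>\<^sup>+x. g' x / ennreal t \<partial>lebesgue)
      = (\<integral>\<^sup>+x. (\<Sum>j. ennreal (c j) * (g x / ennreal t * indicator {x. ennreal (1 / 2 * t) < g x} x)) \<partial>lebesgue)"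
    proof (intro nn_integral_cong)
      fix x
      have "(\<Sum>j. ennreal (c j) * (g x / ennreal t * indicator {x. ennreal (1 / 2 * t) < g x} x))
        = (\<Sum>j\<in>{0}. ennreal (c j) * (g x / ennreal t * indicator {x. ennreal (1 / 2 * t) < g x} x))"
        by (intro suminf_finite) (auto simp: c_def)
      then show "g' x / ennreal t = (\<Sum>j. ennreal (c j) * (g x / ennreal t * indicator {x. ennreal (1 / 2 * t) < g x} x))"
        by (simp add: c_def g'_def split: split_indicator)
    qed
    finally show "emeasure lebesgue {x. ennreal t < ball_maximal g x} \<le> ennreal (2 * 5 ^ DIM('a)) *
      (\<integral>\<^sup>+x. (\<Sum>j. ennreal (c j) * (g x / ennreal t * indicator {x. ennreal (1 / 2 * t) < g x} x)) \<partial>lebesgue)" .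
  qed (auto simp: c_def)
  also have "(\<Sum>j. ennreal (c j * (1 / 2) powr (1 - s))) = (\<Sum>j\<in>{0}. ennreal (c j * (1 / 2) powr (1 - s)))"
    by (intro suminf_finite) (auto simp: c_def)
  also have "\<dots> = ennreal ((1 / 2) powr (1 - s))" by (simp add: c_def)
  also have "ennreal (2 * 5 ^ DIM('a)) * ennreal ((1 / 2) powr (1 - s)) * ennreal (s / (s - 1))
      = ennreal (2 * 5 ^ DIM('a) * (1 / 2) powr (1 - s) * (s / (s - 1)))"
  proof -
    have "ennreal (x * y * z) = ennreal x * ennreal y * ennreal z" if "0 \<le> x" "0 \<le> y" "0 \<le> z" for x y z
      using that by (simp add: ennreal_mult)
    from this[of "2 * 5 ^ DIM('a)" "(1 / 2) powr (1 - s)" "s / (s - 1)"] show ?thesis using s by simp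
  qed
  finally show ?thesis .
qed

section \<open>The Young function and its dual in dyadic form\<close>

locale young =
  fixes A :: "real \<Rightarrow> real" and p p' :: real
  assumes A: "young_function A" "doubling A" and p: "1 < p" and conj: "1 / p + 1 / p' = 1"
    and int: "\<exists>c>0. (\<integral>\<^sup>+t\<in>{c..}. ennreal ((t / A t) powr (p' - 1) / t) \<partial>lborel) < top"
begin

lemma p': "1 < p'" "p' = p / (p - 1)" "(p - 1) * p' = p"
proof -
  have "p' \<noteq> 0" using conj p by auto
  then have "p' + p = p * p'" using conj p by (simp add: field_simps)
  then have *: "p' * (p - 1) = p" by (simp add: algebra_simps)
  then show "p' = p / (p - 1)" "(p - 1) * p' = p" using p by (simp_all add: field_simps)
  then show "1 < p'" using p by simp
qed

lemma A_mono: "0 \<le> x \<Longrightarrow> x \<le> y \<Longrightarrow> A x \<le> A y"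
  using A(1) by (auto simp: young_function_def mono_on_def)

lemma A_0: "A 0 = 0"
  using A(1) by (simp add: young_function_def)

lemma A_nonneg: "0 \<le> x \<Longrightarrow> 0 \<le> A x"
  using A_mono[of 0 x] A_0 by simp

text \<open>Doubling would spread a zero at x to all 2 ^ k * x, which contradicts the divergence of
  A.\<close>

lemma A_pos: assumes "0 < x" shows "0 < A x"
proof (rule ccontr)
  assume "\<not> 0 < A x"
  then have zero: "A x = 0" using A_nonneg[of x] assms by simp
  obtain C where C: "0 < C" "\<And>t. 0 < t \<Longrightarrow> A (2 * t) \<le> C * A t" using A(2) by (auto simp: doubling_def)
  have z: "A (2 ^ k * x) = 0" for k
  proof (induction k)
    case (Suc k)
    have "A (2 ^ Suc k * x) \<le> C * A (2 ^ k * x)" using C(2)[of "2 ^ k * x"] assms by (simp add: mult.assoc)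
    then show ?case using Suc A_nonneg[of "2 ^ Suc k * x"] assms by simp
  qed (simp add: zero)
  have "filterlim A at_top at_top" using A(1) by (simp add: young_function_def)
  then have "eventually (\<lambda>t. 1 \<le> A t) at_top" by (simp add: filterlim_at_top)
  then obtain N where N: "\<And>t. N \<le> t \<Longrightarrow> 1 \<le> A t" by (auto simp: eventually_at_top_linorder)
  obtain k where "N / x < 2 ^ k" using real_arch_pow[of 2] by auto
  then have "N \<le> 2 ^ k * x" using assms by (simp add: field_simps)
  then show False using N[of "2 ^ k * x"] z[of k] by simp
qed

text \<open>Convexity on the segment from 0, where A vanishes.\<close>

lemma A_scale: assumes "0 < s" "s \<le> t" shows "A s / s \<le> A t / t"
proof -
  have "convex_on {0..} A" using A(1) by (simp add: young_function_def)
  then have "A ((1 - s / t) *\<^sub>R 0 + (s / t) *\<^sub>R t) \<le> (1 - s / t) * A 0 + (s / t) * A t"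
    using assms by (intro convex_onD) auto
  then have "A s \<le> (s / t) * A t" using assms by (simp add: A_0)
  then show ?thesis using assms by (simp add: field_simps)
qed

lemma A_lower: "0 \<le> u \<Longrightarrow> u \<le> 1 + A u / A 1"
proof (cases "u \<le> 1")
  case True
  assume "0 \<le> u"
  then show ?thesis using True A_nonneg[of u] A_pos[of 1] by (intro add_increasing2) auto
next
  case False
  then have "A 1 * u \<le> A u" using A_scale[of 1 u] by (simp add: field_simps)
  then show ?thesis using A_pos[of 1] by (simp add: field_simps add_increasing)
qed

text \<open>A is constrained on the nonnegative reals only; composition with the positive part makes
  it continuous everywhere.\<close>

lemma measurable_A [measurable]: "(\<lambda>x. A (max 0 x)) \<in> borel_measurable borel"
proof (rule borel_measurable_continuous_onI)
  have "continuous_on {0..} A" using A(1) by (simp add: young_function_def)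
  then show "continuous_on UNIV (\<lambda>x. A (max 0 x))"
    by (rule continuous_on_compose2) (auto intro!: continuous_intros)
qed

text \<open>
  \<open>dual v t\<close> stands for the complementary function of \<open>s \<mapsto> A (s\<^sup>p)\<close> at \<open>v / t\<close>. If \<open>2\<^sup>i < u \<le> 2\<^sup>i\<^sup>+\<^sup>1\<close> then
  \<open>u\<^sup>1\<^sup>/\<^sup>p\<close> is at most the weight of index \<open>i + 1\<close>, so \<open>u\<^sup>1\<^sup>/\<^sup>p v\<close> exceeds \<open>A (2\<^sup>i)\<close> only if \<open>v\<close> exceeds the cutoff of
  that index. Index 0 deals with \<open>u \<le> 1\<close>.
\<close>

definition "wt j = (case j of 0 \<Rightarrow> 1 | Suc i \<Rightarrow> 2 powr ((real i + 1) / p))"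

definition "cutoff j = (case j of 0 \<Rightarrow> 1 | Suc i \<Rightarrow> A (2 ^ i) / 2 powr ((real i + 1) / p))"

definition dual :: "ennreal \<Rightarrow> real \<Rightarrow> ennreal" where
  "dual v t = (\<Sum>j. ennreal (wt j) * (v / ennreal t * indicator {v. ennreal (cutoff j * t) < v} v))"

lemma wt_nonneg: "0 \<le> wt j" and cutoff_pos: "0 < cutoff j"
  by (auto simp: wt_def cutoff_def A_pos split: nat.split)

text \<open>The integral condition in dyadic form: up to the factor \<open>2 powr (p' - 1)\<close>,
  the term of index i + 1 is the power p' - 1 of 2 ^ i / A (2 ^ i). As t / A t decreases, this power
  is at most twice the integral over the dyadic interval ending at 2 ^ i.\<close>

lemma young_bound_summable: "(\<Sum>j. ennreal (wt j * cutoff j powr (1 - p'))) < top"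
proof -
  let ?g = "\<lambda>t. ennreal ((t / A t) powr (p' - 1) / t)"
  define b where "b i = (2 ^ i / A (2 ^ i)) powr (p' - 1)" for i
  have b0: "0 \<le> b i" for i by (simp add: b_def)
  have wc: "wt (Suc i) * cutoff (Suc i) powr (1 - p') = 2 powr (p' - 1) * b i" for i
  proof -
    have Ai: "0 < A (2 ^ i)" by (rule A_pos) simp
    have pp: "p' / p = p' - 1" using p'(3) p by (simp add: field_simps)
    have "wt (Suc i) * cutoff (Suc i) powr (1 - p')
        = 2 powr ((real i + 1) / p) * (A (2 ^ i) powr (1 - p') / 2 powr ((real i + 1) / p * (1 - p')))"
      using Ai by (simp add: wt_def cutoff_def powr_divide powr_powr)
    also have "\<dots> = 2 powr ((real i + 1) / p - (real i + 1) / p * (1 - p')) * A (2 ^ i) powr (1 - p')"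
      by (simp add: powr_diff)
    also have "(real i + 1) / p - (real i + 1) / p * (1 - p') = (real i + 1) * (p' / p)"
      by (simp add: algebra_simps diff_divide_distrib add_divide_distrib)
    also have "2 powr ((real i + 1) * (p' / p)) * A (2 ^ i) powr (1 - p') = 2 powr (p' - 1) * b i"
      unfolding pp b_def using Ai
      by (simp add: powr_divide powr_diff powr_add powr_mult algebra_simps powr_realpow[symmetric] powr_powr)
    finally show ?thesis .
  qed
  obtain c where c: "0 < c" "(\<integral>\<^sup>+t\<in>{c..}. ?g t \<partial>lborel) < top" using int by blast
  \<comment> \<open>The condition covers only intervals to the right of c; the finitely many earlier
    terms are restored by the index shift at the end.\<close>
  obtain m where m: "c < 2 ^ m" using real_arch_pow[of 2] by auto
  have low: "ennreal (1 / 2 * b (Suc (i + m))) \<le> (\<integral>\<^sup>+t\<in>{2 ^ (i + m)<..2 ^ Suc (i + m)}. ?g t \<partial>lborel)" for i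
  proof -
    let ?u = "2 ^ (i + m) :: real"
    have "ennreal (b (Suc (i + m)) / 2 ^ Suc (i + m)) * emeasure lborel {?u<..2 * ?u}
      = (\<integral>\<^sup>+t. ennreal (b (Suc (i + m)) / 2 ^ Suc (i + m)) * indicator {?u<..2 * ?u} t \<partial>lborel)"
      by (simp add: nn_integral_cmult_indicator)
    also have "\<dots> \<le> (\<integral>\<^sup>+t\<in>{?u<..2 * ?u}. ?g t \<partial>lborel)"
    proof (intro nn_integral_mono)
      fix t :: real
      show "ennreal (b (Suc (i + m)) / 2 ^ Suc (i + m)) * indicator {?u<..2 * ?u} t \<le> ?g t * indicator {?u<..2 * ?u} t"
      proof (cases "t \<in> {?u<..2 * ?u}")
        case True
        have t: "0 < t" using True by (auto intro: less_trans[of 0 ?u])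
        have "A t / t \<le> A (2 * ?u) / (2 * ?u)" using True t by (intro A_scale) auto
        then have "inverse (A (2 * ?u) / (2 * ?u)) \<le> inverse (A t / t)"
          using A_pos[OF t] t by (intro le_imp_inverse_le) auto
        then have "2 * ?u / A (2 * ?u) \<le> t / A t" by simp
        then have "b (Suc (i + m)) \<le> (t / A t) powr (p' - 1)"
          unfolding b_def using p'(1) A_pos[of "2 * ?u"] by (intro powr_mono2) auto
        then have "b (Suc (i + m)) / 2 ^ Suc (i + m) \<le> (t / A t) powr (p' - 1) / t"
          using True t b0 by (intro frac_le) auto
        then show ?thesis using True by (simp add: ennreal_leI)
      qed simp
    qed
    also have "emeasure lborel {?u<..2 * ?u} = ennreal ?u" by simp
    also have "ennreal (b (Suc (i + m)) / 2 ^ Suc (i + m)) * ennreal ?u = ennreal (1 / 2 * b (Suc (i + m)))"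
      using b0 by (simp flip: ennreal_mult)
    finally show ?thesis by simp
  qed
  have "(\<Sum>i. ennreal (1 / 2 * b (Suc (i + m)))) \<le> (\<Sum>i. \<integral>\<^sup>+t\<in>{2 ^ (i + m)<..2 ^ Suc (i + m)}. ?g t \<partial>lborel)"
    by (intro suminf_le low) auto
  also have "\<dots> = (\<integral>\<^sup>+i. (\<integral>\<^sup>+t\<in>{2 ^ (i + m)<..2 ^ Suc (i + m)}. ?g t \<partial>lborel) \<partial>count_space UNIV)"
    by (simp add: nn_integral_count_space_nat)
  also have "\<dots> = (\<integral>\<^sup>+i. (\<integral>\<^sup>+t\<in>{2 ^ (i + m)<..2 ^ Suc (i + m)}. ennreal ((t / A (max 0 t)) powr (p' - 1) / t) \<partial>lborel) \<partial>count_space UNIV)"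
  proof (intro nn_integral_cong)
    fix i :: nat and t :: real
    show "?g t * indicator {2 ^ (i + m)<..2 ^ Suc (i + m)} t
      = ennreal ((t / A (max 0 t)) powr (p' - 1) / t) * indicator {2 ^ (i + m)<..2 ^ Suc (i + m)} t"
      using zero_less_power[of "2::real" "i + m"]
      by (cases "t \<in> {2 ^ (i + m)<..2 ^ Suc (i + m)}") (auto simp: max_def)
  qed
  also have "\<dots> = (\<integral>\<^sup>+t\<in>(\<Union>i. {2 ^ (i + m)<..2 ^ Suc (i + m)}). ennreal ((t / A (max 0 t)) powr (p' - 1) / t) \<partial>lborel)"
  proof (intro nn_integral_disjoint_UN)
    show "disjoint_family (\<lambda>i. {2 ^ (i + m)<..2 ^ Suc (i + m)} :: real set)"
      unfolding disjoint_family_on_def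
    proof (intro ballI impI)
      fix i j :: nat assume "i \<noteq> j"
      then have "(2::real) ^ Suc (i + m) \<le> 2 ^ (j + m) \<or> (2::real) ^ Suc (j + m) \<le> 2 ^ (i + m)"
        by (cases "i < j") (auto intro!: power_increasing simp del: power_Suc)
      then show "{2 ^ (i + m)<..2 ^ Suc (i + m)} \<inter> {2 ^ (j + m)<..2 ^ Suc (j + m)} = ({} :: real set)"
        by auto
    qed
  qed auto
  also have "\<dots> \<le> (\<integral>\<^sup>+t\<in>{c..}. ?g t \<partial>lborel)"
  proof (intro nn_integral_mono)
    fix t :: real
    have "c \<le> t" if "2 ^ (i + m) < t" for i
    proof -
      have "(2::real) ^ m \<le> 2 ^ (i + m)" by (intro power_increasing) auto
      then show ?thesis using that m by linarith
    qed
    then show "ennreal ((t / A (max 0 t)) powr (p' - 1) / t) * indicator (\<Union>i. {2 ^ (i + m)<..2 ^ Suc (i + m)}) t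
        \<le> ?g t * indicator {c..} t"
      using c by (auto simp: max_def split: split_indicator)
  qed
  also have "\<dots> < top" by (rule c)
  finally have fin: "(\<Sum>i. ennreal (1 / 2 * b (Suc (i + m)))) < top" .
  have "summable (\<lambda>i. 1 / 2 * b (i + Suc m))"
    using fin b0 by (intro summable_suminf_not_top) auto
  then have "summable (\<lambda>i. b (i + Suc m))" by simp
  then have "summable b" by (rule summable_iff_shift[THEN iffD1])
  then have "summable (\<lambda>i. wt (Suc i) * cutoff (Suc i) powr (1 - p'))"
    unfolding wc by (rule summable_mult)
  then have "summable (\<lambda>i. wt i * cutoff i powr (1 - p'))" by (subst (asm) summable_Suc_iff)
  then show ?thesis
    using wt_nonneg by (subst suminf_ennreal2) auto
qed

text \<open>Either v / t is at most the cutoff of the dyadic index of u, and the product is at most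
  A (2 ^ i) \<le> A u (or at most 1 if u \<le> 1), or it is larger, and the term of that index in
  \<open>dual\<close> already dominates.\<close>

lemma weighted_young:
  assumes u: "0 \<le> u" and t: "0 < t"
  shows "ennreal (u powr (1 / p)) * (v / ennreal t) \<le> 1 + ennreal (A u) + dual v t"
proof -
  have iff: "ennreal (cutoff j * t) < v \<longleftrightarrow> ennreal (cutoff j) < v / ennreal t" for j
    using cutoff_pos[of j] t
    by (cases v) (auto simp: divide_ennreal ennreal_less_iff field_simps ennreal_top_divide)
  have dual_ge: "ennreal (wt j) * (v / ennreal t) \<le> dual v t" if "ennreal (cutoff j) < v / ennreal t" for j
    using nth_le_suminf[of "\<lambda>j. ennreal (wt j) * (v / ennreal t * indicator {v. ennreal (cutoff j * t) < v} v)" j] that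
    by (simp add: dual_def iff)
  show ?thesis
  proof (cases "u \<le> 1")
    case True
    have "u powr (1 / p) \<le> 1" using True u p powr_mono2[of "1 / p" u 1] by simp
    then have le: "ennreal (u powr (1 / p)) * (v / ennreal t) \<le> 1 * (v / ennreal t)"
      by (intro mult_right_mono) auto
    show ?thesis
    proof (cases "v / ennreal t \<le> 1")
      case True
      then have "1 * (v / ennreal t) \<le> 1 + ennreal (A u) + dual v t"
        by (simp add: add.assoc add_increasing2)
      with le show ?thesis by (rule order_trans)
    next
      case False
      then have "1 * (v / ennreal t) \<le> dual v t"
        using dual_ge[of 0] by (simp add: wt_def cutoff_def)
      also have "\<dots> \<le> 1 + ennreal (A u) + dual v t" by simp
      finally show ?thesis using le by (rule order_trans[rotated])
    qed
  next
    case False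
    obtain m where m: "u < 2 ^ m" using real_arch_pow[of 2] by auto
    define k where "k = (LEAST k. u \<le> 2 ^ k)"
    have k: "u \<le> 2 ^ k" unfolding k_def by (rule LeastI[of _ m]) (use m in simp)
    have "k \<noteq> 0" using k False by (intro notI) simp
    then obtain i where i: "k = Suc i" by (cases k) auto
    have "\<not> u \<le> 2 ^ i" using not_less_Least[of i "\<lambda>k. u \<le> 2 ^ k"] i by (simp add: k_def)
    then have Ai: "A (2 ^ i) \<le> A u" by (intro A_mono) auto
    have "u powr (1 / p) \<le> (2 ^ Suc i) powr (1 / p)" using k i u p by (intro powr_mono2) auto
    also have "\<dots> = wt (Suc i)"
    proof -
      have "(2::real) ^ Suc i = 2 powr (real i + 1)" by (simp add: powr_add powr_realpow)
      then show ?thesis by (simp only: wt_def powr_powr) simp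
    qed
    finally have uw: "u powr (1 / p) \<le> wt (Suc i)" .
    then have le: "ennreal (u powr (1 / p)) * (v / ennreal t) \<le> ennreal (wt (Suc i)) * (v / ennreal t)"
      by (intro mult_right_mono ennreal_leI) auto
    show ?thesis
    proof (cases "v / ennreal t \<le> ennreal (cutoff (Suc i))")
      case True
      then have "ennreal (wt (Suc i)) * (v / ennreal t) \<le> ennreal (wt (Suc i)) * ennreal (cutoff (Suc i))"
        by (rule mult_left_mono) simp
      also have "\<dots> = ennreal (A (2 ^ i))"
        using wt_nonneg[of "Suc i"] cutoff_pos[of "Suc i"] by (simp add: wt_def cutoff_def flip: ennreal_mult)
      also have "\<dots> \<le> ennreal (A u)" by (intro ennreal_leI Ai)
      also have "\<dots> \<le> 1 + ennreal (A u) + dual v t" by (simp add: add_increasing add_increasing2)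
      finally show ?thesis using le by (rule order_trans[rotated])
    next
      case False
      then have "ennreal (wt (Suc i)) * (v / ennreal t) \<le> dual v t" by (intro dual_ge) simp
      also have "\<dots> \<le> 1 + ennreal (A u) + dual v t" by simp
      finally show ?thesis using le by (rule order_trans[rotated])
    qed
  qed
qed

end

section \<open>Generalised Hoelder inequality on cells\<close>

text \<open>The cube circumscribed about \<open>bigball\<close>, with side equal to the diameter of
  the ball. Luxemburg norms are taken over cubes, the means of F over balls.\<close>

definition bigcube :: "real \<Rightarrow> nat \<times> (int ^ 'n) \<Rightarrow> (real ^ 'n) set" where
  "bigcube L c = cbox (center L c - (\<chi> i. 6 * (CARD('n) * side L c) / 2))
     (center L c + (\<chi> i. 6 * (CARD('n) * side L c) / 2))"

definition cube_ratio :: "'n itself \<Rightarrow> real" where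
  "cube_ratio _ = (6 * CARD('n)) ^ CARD('n)"

lemma bigcube_lebesgue [simp]: "bigcube L c \<in> sets lebesgue"
  by (simp add: bigcube_def)

lemma emeasure_bigcube:
  fixes c :: "nat \<times> (int ^ 'n)"
  assumes "0 < L"
  shows "emeasure lebesgue (bigcube L c) = ennreal (cube_ratio TYPE('n) * side L c ^ CARD('n))"
proof -
  have "0 \<le> 6 * (CARD('n) * side L c)" using side_pos[OF assms, of c] by simp
  from emeasure_cbox_cube(1)[OF this, of "center L c"]
  have "emeasure lborel (bigcube L c) = ennreal ((6 * (CARD('n) * side L c)) ^ CARD('n))"
    by (simp only: bigcube_def)
  moreover have "(6 * (CARD('n) * side L c)) ^ CARD('n) = cube_ratio TYPE('n) * side L c ^ CARD('n)"
    by (simp add: cube_ratio_def power_mult_distrib)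
  ultimately show ?thesis by (simp add: emeasure_completion bigcube_def)
qed

lemma bigcube_in_cubes:
  fixes c :: "nat \<times> (int ^ 'n)"
  assumes "0 < L" shows "bigcube L c \<in> cubes"
proof -
  define a where "a = center L c - (\<chi> i. 6 * (CARD('n) * side L c) / 2)"
  define l where "l = 6 * (CARD('n) * side L c)"
  have "center L c + (\<chi> i. 6 * (CARD('n) * side L c) / 2) = a + (\<chi> i. l)"
    by (simp add: vec_eq_iff a_def l_def)
  then have "bigcube L c = cbox a (a + (\<chi> i. l))" by (simp only: bigcube_def a_def)
  moreover have "0 < l" using side_pos[OF assms, of c] by (simp add: l_def)
  ultimately show ?thesis unfolding cubes_def by blast
qed

lemma bigball_subset_bigcube:
  fixes c :: "nat \<times> (int ^ 'n)"
  shows "bigball L c \<subseteq> bigcube L c"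
proof
  fix x :: "real ^ 'n" assume "x \<in> bigball L c"
  then have n: "norm (x - center L c) < 3 * (CARD('n) * side L c)"
    by (simp add: bigball_def dist_norm norm_minus_commute)
  have "\<bar>x $ i - center L c $ i\<bar> \<le> 3 * (CARD('n) * side L c)" for i
    using component_le_norm_cart[of "x - center L c" i] n by simp
  then have "center L c $ i - 6 * (CARD('n) * side L c) / 2 \<le> x $ i \<and> x $ i \<le> center L c $ i + 6 * (CARD('n) * side L c) / 2" for i
    by (smt (verit, best) field_sum_of_halves)
  then show "x \<in> bigcube L c" by (simp add: bigcube_def mem_box_cart)
qed

text \<open>The infimum lies strictly below s, so some s' < s is admissible, and monotonicity passes
  this on to s. With the strict inequality the question whether the infimum is attained does not
  arise.\<close>

lemma less_luxemburgD:
  assumes lt: "luxemburg_norm A Q w < ennreal s" and mono: "\<And>x y. 0 \<le> x \<Longrightarrow> x \<le> y \<Longrightarrow> A x \<le> A y"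
    and V: "emeasure lebesgue Q = ennreal V" "0 < V"
  shows "(\<integral>\<^sup>+y\<in>Q. ennreal (A (\<bar>w y\<bar> / s)) \<partial>lebesgue) \<le> ennreal V"
proof -
  obtain s' where s': "0 < s'" "ennreal s' < ennreal s"
    "(\<integral>\<^sup>+y\<in>Q. ennreal (A (\<bar>w y\<bar> / s')) \<partial>lebesgue) / emeasure lebesgue Q \<le> 1"
    using lt unfolding luxemburg_norm_def Inf_less_iff by auto
  have "(\<integral>\<^sup>+y\<in>Q. ennreal (A (\<bar>w y\<bar> / s)) \<partial>lebesgue) \<le> (\<integral>\<^sup>+y\<in>Q. ennreal (A (\<bar>w y\<bar> / s')) \<partial>lebesgue)"
  proof (intro nn_integral_mono mult_right_mono ennreal_leI mono)
    fix y
    show "\<bar>w y\<bar> / s \<le> \<bar>w y\<bar> / s'" using s' by (intro divide_left_mono) (auto simp: ennreal_less_iff)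
    show "0 \<le> \<bar>w y\<bar> / s" using s' by (auto simp: ennreal_less_iff)
  qed simp
  also have "\<dots> = (\<integral>\<^sup>+y\<in>Q. ennreal (A (\<bar>w y\<bar> / s')) \<partial>lebesgue) / ennreal V * ennreal V"
    by (rule ennreal_divide_mult_cancel[OF V(2), symmetric])
  also have "\<dots> \<le> 1 * ennreal V" using s'(3) unfolding V(1) by (rule mult_right_mono) simp
  finally show ?thesis by simp
qed

text \<open>The factors 1 / p and 1 / p' are dropped; if an argument is infinite, so is the
  right-hand side.\<close>

lemma ennreal_Young:
  assumes "1 < p" "1 / p + 1 / p' = 1"
  shows "x * y \<le> epowr x p + epowr y p'"
proof -
  have "p' \<noteq> 0" using assms by auto
  then have "p' * (p - 1) = p" using assms by (simp add: field_simps)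
  then have p': "1 < p'" using assms
    by (smt (verit, best) mult_le_cancel_right1 mult_less_cancel_right1)
  show ?thesis
  proof (cases x; cases y)
    fix a b assume *: "x = ennreal a" "0 \<le> a" "y = ennreal b" "0 \<le> b"
    have "a * b \<le> a powr p / p + b powr p' / p'"
      using assms p' * by (intro Youngs_inequality) auto
    also have "\<dots> \<le> a powr p + b powr p'"
      using assms p' by (intro add_mono) (auto simp: divide_le_eq mult_le_cancel_left1)
    finally show ?thesis using * by (simp add: epowr_ennreal ennreal_leI flip: ennreal_mult ennreal_plus)
  qed simp_all
qed

context young
begin

text \<open>
  \<open>weight_bound\<close> is a countable supremum, hence measurable, and lies below the Orlicz maximal function, whose
  measurability is never needed.
\<close>

definition weight_bound :: "real \<Rightarrow> (real ^ 'n \<Rightarrow> real) \<Rightarrow> real ^ 'n \<Rightarrow> ennreal" where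
  "weight_bound L w x = (SUP d. luxemburg_norm A (bigcube L d) w * indicator (bigcube L d) x)"

text \<open>The Luxemburg norm of v over the cell with respect to \<open>dual\<close>, written as a
  supremum of inadmissible t. As \<open>dual\<close> decreases in t this agrees with the infimum of
  the admissible ones, and a value above t hands over a witness.\<close>

definition dual_norm :: "real \<Rightarrow> (real ^ 'n \<Rightarrow> ennreal) \<Rightarrow> nat \<times> (int ^ 'n) \<Rightarrow> ennreal" where
  "dual_norm L v d = (SUP t\<in>{t. 0 < t \<and> 1 < cell_average L (\<lambda>y. dual (v y) t) d}. ennreal t)"

lemma measurable_weight_bound [measurable]: "weight_bound L w \<in> borel_measurable lebesgue"
proof -
  have [measurable]: "(\<lambda>x. indicator (bigcube L d) x :: ennreal) \<in> borel_measurable lebesgue" for d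
    by (intro borel_measurable_indicator) simp
  have "(\<lambda>x. SUP d. luxemburg_norm A (bigcube L d) w * indicator (bigcube L d) x) \<in> borel_measurable lebesgue"
    by (intro borel_measurable_SUP) auto
  then show ?thesis by (simp add: weight_bound_def[abs_def])
qed

lemma weight_bound_upper: "x \<in> bigcube L d \<Longrightarrow> luxemburg_norm A (bigcube L d) w \<le> weight_bound L w x"
  unfolding weight_bound_def by (intro SUP_upper2[of d]) auto

lemma weight_bound_le: "0 < L \<Longrightarrow> weight_bound L w x \<le> orlicz_maximal A w x"
  unfolding weight_bound_def
proof (rule SUP_least)
  fix d assume L: "0 < L"
  show "luxemburg_norm A (bigcube L d) w * indicator (bigcube L d) x \<le> orlicz_maximal A w x"
    using bigcube_in_cubes[OF L, of d]
    by (cases "x \<in> bigcube L d") (auto simp: orlicz_maximal_def intro!: SUP_upper)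
qed

lemma measurable_dual [measurable (raw)]:
  assumes [measurable]: "v \<in> borel_measurable M"
  shows "(\<lambda>x. dual (v x) t) \<in> borel_measurable M"
  unfolding dual_def indicator_def by measurable

lemma dual_antimono: "0 < t \<Longrightarrow> t \<le> t' \<Longrightarrow> dual v t' \<le> dual v t"
  unfolding dual_def
proof (intro suminf_le mult_left_mono)
  fix j assume t: "0 < t" "t \<le> t'"
  have "ennreal (cutoff j * t) \<le> ennreal (cutoff j * t')"
    using t cutoff_pos[of j] by (intro ennreal_leI mult_left_mono) auto
  moreover have "v / ennreal t' \<le> v / ennreal t" using t
    by (cases v) (auto simp: divide_ennreal ennreal_top_divide intro!: ennreal_leI divide_left_mono)
  ultimately show "v / ennreal t' * indicator {v. ennreal (cutoff j * t') < v} v \<le> v / ennreal t * indicator {v. ennreal (cutoff j * t) < v} v"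
    by (auto split: split_indicator)
qed auto

lemma cell_average_le_one:
  assumes "dual_norm L v d < ennreal t" "0 < t"
  shows "cell_average L (\<lambda>y. dual (v y) t) d \<le> 1"
proof (rule ccontr)
  assume "\<not> ?thesis"
  then have "ennreal t \<le> dual_norm L v d" unfolding dual_norm_def using assms by (intro SUP_upper) auto
  then show False using assms by simp
qed

definition "C2 = (\<Sum>j. wt j * cutoff j powr (1 - p')) * (p' / (p' - 1))"

lemma C2_eq: "(\<Sum>j. ennreal (wt j * cutoff j powr (1 - p'))) * ennreal (p' / (p' - 1)) = ennreal C2"
  and C2_nonneg: "0 \<le> C2"
proof -
  have s: "summable (\<lambda>j. wt j * cutoff j powr (1 - p'))"
    using young_bound_summable wt_nonneg by (intro summable_suminf_not_top) auto
  have nn: "0 \<le> wt j * cutoff j powr (1 - p')" for j using wt_nonneg by simp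
  have "(\<Sum>j. ennreal (wt j * cutoff j powr (1 - p'))) = ennreal (\<Sum>j. wt j * cutoff j powr (1 - p'))"
    using nn s by (rule suminf_ennreal2)
  then show "(\<Sum>j. ennreal (wt j * cutoff j powr (1 - p'))) * ennreal (p' / (p' - 1)) = ennreal C2"
    using p'(1) suminf_nonneg[OF s nn] unfolding C2_def by (subst ennreal_mult) simp_all
  show "0 \<le> C2" using p'(1) suminf_nonneg[OF s nn] by (simp add: C2_def)
qed

text \<open>If the dual norm of a cell exceeds t, the average of \<open>dual (v y) t\<close> over
  the cell exceeds 1, hence the ball maximal function exceeds 1 / \<open>ball_ratio\<close> there.
  The weak-type bound for the latter is then literally a superposition of truncations of v / t, as
  in \<open>strong_type_from_weak\<close>, with the series of
  \<open>young_bound_summable\<close>.\<close>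

lemma cell_maximal_dual_norm_bound:
  fixes v :: "real ^ 'n \<Rightarrow> ennreal"
  assumes L: "0 < L" and [measurable]: "v \<in> borel_measurable lebesgue"
  shows "(\<integral>\<^sup>+x. epowr (cell_maximal L (dual_norm L v) x) p' \<partial>lebesgue)
    \<le> ennreal (5 ^ CARD('n) * ball_ratio TYPE('n) * C2) * (\<integral>\<^sup>+x. epowr (v x) p' \<partial>lebesgue)"
proof -
  let ?S = "cell_maximal L (dual_norm L v)" and ?B = "5 ^ CARD('n) * ball_ratio TYPE('n)"
  have R: "0 < ball_ratio TYPE('n)" by (rule ball_ratio_pos)
  have "(\<integral>\<^sup>+x. epowr (?S x) p' \<partial>lebesgue) \<le> ennreal ?B * (\<Sum>j. ennreal (wt j * cutoff j powr (1 - p'))) *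
      ennreal (p' / (p' - 1)) * (\<integral>\<^sup>+x. epowr (v x) p' \<partial>lebesgue)"
  proof (rule strong_type_from_weak[OF p'(1)])
    show "?S \<in> borel_measurable lebesgue" by (intro borel_measurable_lebesgueI measurable_cell_maximal)
    fix t :: real assume t: "0 < t"
    let ?g = "\<lambda>y. dual (v y) t"
    have "{x. ennreal t < ?S x} \<subseteq> {x. ennreal (1 / ball_ratio TYPE('n)) < ball_maximal ?g x}"
    proof clarify
      fix x assume "ennreal t < ?S x"
      then obtain d where d: "x \<in> cell L d" "ennreal t < dual_norm L v d"
        unfolding less_cell_maximal_iff by blast
      then obtain t' where t': "0 < t'" "1 < cell_average L (\<lambda>y. dual (v y) t') d" "ennreal t < ennreal t'"
        unfolding dual_norm_def less_SUP_iff by auto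
      have "t \<le> t'" using t t' by (simp add: ennreal_less_iff)
      let ?V = "side L d ^ CARD('n)"
      have V: "0 < ?V" using side_pos[OF L, of d] by simp
      have em: "emeasure lebesgue (cell L d) = ennreal ?V" using emeasure_cell[OF L, of d] by (simp add: emeasure_completion)
      have "1 < cell_average L (\<lambda>y. dual (v y) t') d" by (rule t')
      also have "\<dots> \<le> (\<integral>\<^sup>+y\<in>bigball L d. ?g y \<partial>lebesgue) / ennreal ?V"
        unfolding cell_average_def em using cell_subset_bigball[OF L, of d] dual_antimono[OF t \<open>t \<le> t'\<close>]
        by (intro divide_right_mono_ennreal nn_integral_mono) (auto split: split_indicator)
      also have "\<dots> = ennreal (ball_ratio TYPE('n)) * ((\<integral>\<^sup>+y\<in>bigball L d. ?g y \<partial>lebesgue) / emeasure lebesgue (bigball L d))"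
      proof (cases "\<integral>\<^sup>+y\<in>bigball L d. ?g y \<partial>lebesgue")
        case (real J)
        then show ?thesis using R V
          by (simp add: emeasure_bigball[OF L] divide_ennreal field_simps flip: ennreal_mult)
      next
        case top
        then show ?thesis using R V by (simp add: emeasure_bigball[OF L] ennreal_top_divide ennreal_mult_top)
      qed
      also have "\<dots> \<le> ennreal (ball_ratio TYPE('n)) * ball_maximal ?g x"
        unfolding bigball_def using d(1) cell_subset_bigball[OF L, of d] side_pos[OF L, of d]
        by (intro mult_left_mono ball_maximal_upper) (auto simp: bigball_def)
      finally have "1 < ennreal (ball_ratio TYPE('n)) * ball_maximal ?g x" .
      then show "ennreal (1 / ball_ratio TYPE('n)) < ball_maximal ?g x"
        using R by (cases "ball_maximal ?g x") (auto simp: ennreal_less_iff field_simps simp flip: ennreal_mult ennreal_1)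
    qed
    moreover have "{x \<in> space lebesgue. ennreal (1 / ball_ratio TYPE('n)) < ball_maximal ?g x} \<in> sets lebesgue"
      by measurable
    ultimately have "emeasure lebesgue {x. ennreal t < ?S x} \<le> emeasure lebesgue {x. ennreal (1 / ball_ratio TYPE('n)) < ball_maximal ?g x}"
      by (intro emeasure_mono) auto
    also have "\<dots> \<le> ennreal (5 ^ DIM(real ^ 'n) / (1 / ball_ratio TYPE('n))) * (\<integral>\<^sup>+x. ?g x \<partial>lebesgue)"
      using R by (intro ball_maximal_weak_type) auto
    also have "\<dots> = ennreal ?B * (\<integral>\<^sup>+x. (\<Sum>j. ennreal (wt j) * (v x / ennreal t * indicator {x. ennreal (cutoff j * t) < v x} x)) \<partial>lebesgue)"
      by (simp add: dual_def indicator_def)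
    finally show "emeasure lebesgue {x. ennreal t < ?S x} \<le> ennreal ?B *
      (\<integral>\<^sup>+x. (\<Sum>j. ennreal (wt j) * (v x / ennreal t * indicator {x. ennreal (cutoff j * t) < v x} x)) \<partial>lebesgue)" .
  qed (auto simp: wt_nonneg cutoff_pos)
  also have "ennreal ?B * (\<Sum>j. ennreal (wt j * cutoff j powr (1 - p'))) * ennreal (p' / (p' - 1)) = ennreal (?B * C2)"
    unfolding mult.assoc[of "ennreal ?B"] C2_eq using R C2_nonneg by (simp add: ennreal_mult)
  finally show ?thesis .
qed

text \<open>After division by \<open>s powr (1 / p) * t\<close> the integrand is bounded by
  \<open>weighted_young\<close> with u = w / s. Relative to the measure of the cell the three terms
  contribute 1, \<open>cube_ratio\<close> and 1; the middle one uses admissibility of s on the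
  larger cube.\<close>

lemma cell_average_le:
  fixes w :: "real ^ 'n \<Rightarrow> real"
  assumes L: "0 < L" and [measurable]: "v \<in> borel_measurable lebesgue" "w \<in> borel_measurable lebesgue"
    and w: "\<And>x. 0 \<le> w x" and s: "luxemburg_norm A (bigcube L d) w < ennreal s" and t: "0 < t" "dual_norm L v d < ennreal t"
  shows "cell_average L (\<lambda>x. ennreal (w x powr (1 / p)) * v x) d \<le> ennreal ((2 + cube_ratio TYPE('n)) * s powr (1 / p) * t)"
proof -
  let ?V = "side L d ^ CARD('n)"
  let ?h = "\<lambda>x. ennreal (w x powr (1 / p)) * v x"
  have V: "0 < ?V" using side_pos[OF L, of d] by simp
  have cr: "0 < cube_ratio TYPE('n)" by (simp add: cube_ratio_def)
  have s0: "0 < s" using s by (metis ennreal_0 ennreal_less_zero_iff ennreal_lessI less_eq_real_def not_less zero_le ennreal_neg)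
  have em: "emeasure lebesgue (cell L d) = ennreal ?V" using emeasure_cell[OF L, of d] by (simp add: emeasure_completion)
  have sub: "cell L d \<subseteq> bigcube L d" using cell_subset_bigball[OF L, of d] bigball_subset_bigcube by blast
  have [measurable]: "(\<lambda>x. indicator (bigcube L d) x :: ennreal) \<in> borel_measurable lebesgue"
    "(\<lambda>x. indicator (cell L d) x :: ennreal) \<in> borel_measurable lebesgue"
    by (auto intro!: borel_measurable_indicator)
  have [measurable]: "(\<lambda>x. ennreal (A (\<bar>w x\<bar> / s))) \<in> borel_measurable lebesgue"
  proof -
    have "A (\<bar>w x\<bar> / s) = A (max 0 (\<bar>w x\<bar> / s))" for x using s0 by (simp add: max_def)
    then show ?thesis by simp
  qed
  have pt: "?h x / ennreal (s powr (1 / p) * t) \<le> 1 + ennreal (A (\<bar>w x\<bar> / s)) + dual (v x) t" for x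
  proof -
    have "?h x / ennreal (s powr (1 / p) * t) = ennreal ((w x / s) powr (1 / p)) * (v x / ennreal t)"
      using s0 t(1) w by (cases "v x")
        (auto simp: divide_ennreal powr_divide ennreal_mult_top ennreal_top_divide simp flip: ennreal_mult)
    also have "\<dots> \<le> 1 + ennreal (A (w x / s)) + dual (v x) t"
      using s0 t w by (intro weighted_young) auto
    finally show ?thesis using w by simp
  qed
  have "(\<integral>\<^sup>+x\<in>cell L d. ?h x / ennreal (s powr (1 / p) * t) \<partial>lebesgue) \<le>
      (\<integral>\<^sup>+x. indicator (cell L d) x + ennreal (A (\<bar>w x\<bar> / s)) * indicator (bigcube L d) x + dual (v x) t * indicator (cell L d) x \<partial>lebesgue)"
    using pt sub by (intro nn_integral_mono) (auto split: split_indicator)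
  also have "\<dots> = emeasure lebesgue (cell L d) + (\<integral>\<^sup>+x\<in>bigcube L d. ennreal (A (\<bar>w x\<bar> / s)) \<partial>lebesgue)
      + (\<integral>\<^sup>+x\<in>cell L d. dual (v x) t \<partial>lebesgue)"
    by (simp add: nn_integral_add)
  also have "\<dots> \<le> ennreal ?V + ennreal (cube_ratio TYPE('n) * ?V) + 1 * ennreal ?V"
  proof (intro add_mono)
    show "emeasure lebesgue (cell L d) \<le> ennreal ?V" by (simp add: em)
    show "(\<integral>\<^sup>+x\<in>bigcube L d. ennreal (A (\<bar>w x\<bar> / s)) \<partial>lebesgue) \<le> ennreal (cube_ratio TYPE('n) * ?V)"
      using V cr by (intro less_luxemburgD[OF s A_mono emeasure_bigcube[OF L]]) auto
    show "(\<integral>\<^sup>+x\<in>cell L d. dual (v x) t \<partial>lebesgue) \<le> 1 * ennreal ?V"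
      unfolding em[symmetric] cell_average_times[OF L, symmetric] using cell_average_le_one[OF t(2,1)]
      by (rule mult_right_mono) simp
  qed
  also have "\<dots> = ennreal ((2 + cube_ratio TYPE('n)) * ?V)"
    using V cr by (simp add: algebra_simps flip: ennreal_plus)
  finally have le: "(\<integral>\<^sup>+x\<in>cell L d. ?h x / ennreal (s powr (1 / p) * t) \<partial>lebesgue) \<le> ennreal ((2 + cube_ratio TYPE('n)) * ?V)" .
  let ?k = "s powr (1 / p) * t"
  have k: "0 < ?k" using s0 t by simp
  have "(\<integral>\<^sup>+x\<in>cell L d. ?h x \<partial>lebesgue) = (\<integral>\<^sup>+x. ennreal ?k * (?h x / ennreal ?k * indicator (cell L d) x) \<partial>lebesgue)"
    using ennreal_divide_mult_cancel[OF k] by (simp add: mult.assoc[symmetric] mult.commute[of "ennreal ?k"])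
  also have "\<dots> = ennreal ?k * (\<integral>\<^sup>+x\<in>cell L d. ?h x / ennreal ?k \<partial>lebesgue)"
    by (rule nn_integral_cmult) measurable
  also have "\<dots> \<le> ennreal ?k * ennreal ((2 + cube_ratio TYPE('n)) * ?V)"
    by (rule mult_left_mono[OF le]) simp
  finally have "(\<integral>\<^sup>+x\<in>cell L d. ?h x \<partial>lebesgue) / ennreal ?V \<le> ennreal ?k * ennreal ((2 + cube_ratio TYPE('n)) * ?V) / ennreal ?V"
    by (rule divide_right_mono_ennreal)
  also have "\<dots> = ennreal ((2 + cube_ratio TYPE('n)) * s powr (1 / p) * t)"
    using k V cr t side_pos[OF L, of d] by (simp add: divide_ennreal mult_ac flip: ennreal_mult)
  finally show ?thesis by (simp add: cell_average_def em)
qed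

text \<open>The previous bound holds strictly above the Luxemburg norm and strictly above the dual
  norm; here the parameters decrease to the former and to \<open>S\<close>.\<close>

lemma cell_average_le_limit:
  fixes w :: "real ^ 'n \<Rightarrow> real"
  assumes L: "0 < L" and m: "v \<in> borel_measurable lebesgue" "w \<in> borel_measurable lebesgue"
    and w: "\<And>x. 0 \<le> w x" and fin: "luxemburg_norm A (bigcube L d) w < top" and S: "dual_norm L v d \<le> S" "S < top"
  shows "cell_average L (\<lambda>x. ennreal (w x powr (1 / p)) * v x) d
    \<le> ennreal (2 + cube_ratio TYPE('n)) * epowr (luxemburg_norm A (bigcube L d) w) (1 / p) * S"
proof -
  let ?C = "2 + cube_ratio TYPE('n)"
  have C: "0 < ?C" by (simp add: cube_ratio_def add_pos_pos)
  obtain l where l: "luxemburg_norm A (bigcube L d) w = ennreal l" "0 \<le> l" using fin by (metis ennreal_cases less_irrefl)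
  obtain \<sigma> where \<sigma>: "S = ennreal \<sigma>" "0 \<le> \<sigma>" using S by (metis ennreal_cases less_irrefl)
  have le: "cell_average L (\<lambda>x. ennreal (w x powr (1 / p)) * v x) d \<le> ennreal (?C * (l + e) powr (1 / p) * (\<sigma> + e))"
    if "0 < e" for e
    using that l \<sigma> S(1) by (intro cell_average_le L m w) (auto simp: ennreal_less_iff intro: le_less_trans)
  have "((\<lambda>e. ennreal (?C * (l + e) powr (1 / p) * (\<sigma> + e))) \<longlongrightarrow> ennreal (?C * (l + 0) powr (1 / p) * (\<sigma> + 0))) (at_right 0)"
    using l(2) p by (intro tendsto_ennrealI tendsto_intros tendsto_powr') (auto simp: eventually_at_filter)
  then have "cell_average L (\<lambda>x. ennreal (w x powr (1 / p)) * v x) d \<le> ennreal (?C * (l + 0) powr (1 / p) * (\<sigma> + 0))"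
    by (rule tendsto_lowerbound) (auto simp: eventually_at_filter intro!: always_eventually le)
  then show ?thesis using l \<sigma> C by (simp add: epowr_ennreal ennreal_mult)
qed

text \<open>The Luxemburg norm is a constant, and at each point of the ball it is at most
  \<open>weight_bound\<close>, because the ball lies in the cube. It can thus be moved into the
  average; the exponent r / p there becomes 1 / p under the root.\<close>

lemma ball_mean_le_maximal:
  fixes F :: "real ^ 'n \<Rightarrow> ennreal"
  assumes L: "0 < L" and r: "0 < r" and x: "x \<in> cell L d" and [measurable]: "F \<in> borel_measurable lebesgue"
  shows "ball_mean L F r d * epowr (luxemburg_norm A (bigcube L d) w) (1 / p)
    \<le> epowr (ball_maximal (\<lambda>y. epowr (F y) r * epowr (weight_bound L w y) (r / p)) x) (1 / r)"
proof -
  let ?l = "luxemburg_norm A (bigcube L d) w" and ?V = "emeasure lebesgue (bigball L d)"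
  have [measurable]: "(\<lambda>x. indicator (bigball L d) x :: ennreal) \<in> borel_measurable lebesgue"
    by (intro borel_measurable_indicator) simp
  have "(\<integral>\<^sup>+y\<in>bigball L d. epowr (F y) r \<partial>lebesgue) / ?V * epowr ?l (r / p)
      = (\<integral>\<^sup>+y. epowr (F y) r * indicator (bigball L d) y * epowr ?l (r / p) \<partial>lebesgue) / ?V"
  proof -
    have "(\<integral>\<^sup>+y. epowr (F y) r * indicator (bigball L d) y * epowr ?l (r / p) \<partial>lebesgue)
        = (\<integral>\<^sup>+y\<in>bigball L d. epowr (F y) r \<partial>lebesgue) * epowr ?l (r / p)"
      by (rule nn_integral_multc) measurable
    then show ?thesis by (simp add: divide_ennreal_def mult_ac)
  qed
  also have "\<dots> \<le> (\<integral>\<^sup>+y\<in>bigball L d. epowr (F y) r * epowr (weight_bound L w y) (r / p) \<partial>lebesgue) / ?V"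
    using bigball_subset_bigcube[of L d] r p
    by (intro divide_right_mono_ennreal nn_integral_mono)
       (auto intro!: mult_left_mono epowr_mono weight_bound_upper split: split_indicator)
  also have "\<dots> \<le> ball_maximal (\<lambda>y. epowr (F y) r * epowr (weight_bound L w y) (r / p)) x"
    using x cell_subset_bigball[OF L, of d] side_pos[OF L, of d] unfolding bigball_def
    by (intro ball_maximal_upper) auto
  finally have "epowr ((\<integral>\<^sup>+y\<in>bigball L d. epowr (F y) r \<partial>lebesgue) / ?V * epowr ?l (r / p)) (1 / r)
      \<le> epowr (ball_maximal (\<lambda>y. epowr (F y) r * epowr (weight_bound L w y) (r / p)) x) (1 / r)"
    using r by (intro epowr_mono) auto
  then show ?thesis using r by (simp add: epowr_mult epowr_epowr ball_mean_def)
qed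

end

section \<open>The weighted inequality\<close>

lemma mult_liminf_le: "ennreal c * liminf u \<le> liminf (\<lambda>n. ennreal c * u n)"
proof (cases "0 < c")
  case True
  have iff: "y < ennreal c * z \<longleftrightarrow> y / ennreal c < z" for y z
    using True by (cases y; cases z)
      (auto simp: divide_ennreal ennreal_less_iff field_simps ennreal_top_divide ennreal_mult_top simp flip: ennreal_mult)
  show ?thesis
    unfolding le_Liminf_iff iff
  proof (intro allI impI)
    fix y assume "y / ennreal c < liminf u"
    then show "eventually (\<lambda>n. y / ennreal c < u n) sequentially"
      using le_Liminf_iff[of "liminf u" sequentially u] by simp
  qed
qed (simp add: ennreal_neg)

text \<open>The truncation height tends to infinity, so it disappears in the limit even where the
  value is infinite.\<close>

lemma le_liminf_min:
  fixes a :: ennreal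
  assumes "a \<le> liminf u"
  shows "a \<le> liminf (\<lambda>m. min (u m) (of_nat m))"
  unfolding le_Liminf_iff
proof (intro allI impI)
  fix y assume y: "y < a"
  have "y < top" using y by (simp add: less_le_trans[OF _ top_greatest])
  then obtain N where "y < of_nat N" using ennreal_Ex_less_of_nat by blast
  then have "eventually (\<lambda>m. y < of_nat m) sequentially"
    unfolding eventually_sequentially by (intro exI[of _ N]) (auto intro: less_le_trans simp: of_nat_mono)
  moreover have "eventually (\<lambda>m. y < u m) sequentially"
    using assms y unfolding le_Liminf_iff by blast
  ultimately show "eventually (\<lambda>m. y < min (u m) (of_nat m)) sequentially"
    by eventually_elim simp
qed

context young
begin

definition "weak_const (n :: 'n itself) = 5 ^ CARD('n) * ball_ratio n * C2"

definition "strong_const (n :: 'n itself) s = 2 * 5 ^ CARD('n) * (1 / 2) powr (1 - s) * (s / (s - 1))"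

text \<open>Chosen so that \<kappa> * (2 + \<open>cube_ratio\<close>) * \<open>weak_const\<close>
  times the power p' of this scale is at most 1 / 2; the summand 1 keeps the denominator
  positive.\<close>

definition "absorb_scale (n :: 'n itself) \<kappa> = (1 / (2 * (\<kappa> * (2 + cube_ratio n) * weak_const n + 1))) powr (1 / p')"

text \<open>Twice the coefficient that remains when half of the left-hand side is absorbed; the
  final 1 ensures positivity.\<close>

definition "weighted_const (n :: 'n itself) \<kappa> r =
  2 * (\<kappa> * (2 + cube_ratio n) * ((1 / absorb_scale n \<kappa>) powr p * strong_const n (p / r))) + 1"

lemma weighted_const_pos:
  assumes "1 < r" "r < p" "0 \<le> \<kappa>"
  shows "0 < weighted_const TYPE('n::finite) \<kappa> r"
proof -
  have "0 \<le> strong_const TYPE('n) (p / r)" using assms by (simp add: strong_const_def)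
  then show ?thesis using assms by (simp add: weighted_const_def cube_ratio_def add_nonneg_pos)
qed

lemma weighted_bound_of_bilinear_bound:
  fixes F G :: "real ^ 'n \<Rightarrow> ennreal" and w :: "real ^ 'n \<Rightarrow> real"
  assumes r: "1 < r" "r < p" and K: "0 \<le> \<kappa>" and L: "0 < L"
    and [measurable]: "F \<in> borel_measurable lebesgue" "G \<in> borel_measurable lebesgue" "w \<in> borel_measurable lebesgue"
    and w: "\<forall>x. 0 \<le> w x" and wfin: "(\<integral>\<^sup>+x\<in>cell L c. ennreal (w x) \<partial>lebesgue) < top" and M: "M < top"
    and bil: "\<And>h. h \<in> borel_measurable lebesgue \<Longrightarrow> (\<integral>\<^sup>+x\<in>cell L c. G x * h x \<partial>lebesgue) \<le> ennreal \<kappa> *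
      (\<integral>\<^sup>+x\<in>cell L c. cell_maximal L (\<lambda>d. ball_mean L F r d * cell_average L h d) x \<partial>lebesgue)"
    and Xfin: "(\<integral>\<^sup>+x. epowr (F x) p * weight_bound L w x \<partial>lebesgue) < top"
  shows "(\<integral>\<^sup>+x\<in>cell L c. epowr (min (G x) M) p * ennreal (w x) \<partial>lebesgue)
    \<le> ennreal (weighted_const TYPE('n) \<kappa> r) * (\<integral>\<^sup>+x. epowr (F x) p * weight_bound L w x \<partial>lebesgue)"
proof -
  define C1 where "C1 = strong_const TYPE('n) (p / r)"
  define C3 where "C3 = weak_const TYPE('n)"
  define Cq where "Cq = 2 + cube_ratio TYPE('n)"
  define \<eta> where "\<eta> = absorb_scale TYPE('n) \<kappa>"
  define C where "C = weighted_const TYPE('n) \<kappa> r"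
  have pr: "1 < p / r" using r by simp
  have C1: "0 \<le> C1" using pr r p by (simp add: C1_def strong_const_def)
  have C3: "0 \<le> C3" using C2_nonneg ball_ratio_pos[where 'n = 'n] by (simp add: C3_def weak_const_def)
  have Cq: "0 \<le> Cq" by (simp add: Cq_def cube_ratio_def)
  have D: "0 \<le> \<kappa> * Cq * C3" using K Cq C3 by simp
  have \<eta>_eq: "\<eta> = (1 / (2 * (\<kappa> * Cq * C3 + 1))) powr (1 / p')"
    by (simp add: \<eta>_def absorb_scale_def Cq_def C3_def)
  have \<eta>: "0 < \<eta>" using D by (simp add: \<eta>_eq)
  have absorb: "\<kappa> * Cq * (\<eta> powr p' * C3) \<le> 1 / 2"
  proof -
    have "\<eta> powr p' = 1 / (2 * (\<kappa> * Cq * C3 + 1))"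
      using p'(1) D by (simp add: \<eta>_eq powr_powr)
    then have "\<kappa> * Cq * (\<eta> powr p' * C3) = (\<kappa> * Cq * C3) * (1 / (2 * (\<kappa> * Cq * C3 + 1)))" by simp
    moreover have "z * (1 / (2 * (z + 1))) \<le> 1 / 2" if "0 \<le> z" for z :: real
      using that by (simp add: field_simps)
    ultimately show ?thesis using D by metis
  qed
  have C: "0 < C" unfolding C_def using r K by (rule weighted_const_pos)
  define X where "X = (\<integral>\<^sup>+x. epowr (F x) p * weight_bound L w x \<partial>lebesgue)"
  define g where "g x = min (G x) M" for x
  define Y where "Y = (\<integral>\<^sup>+x\<in>cell L c. epowr (g x) p * ennreal (w x) \<partial>lebesgue)"
  \<comment> \<open>Normalised so that, on the cell, the power p' of v is g ^ p * w, by (p - 1) * p'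
    = p, while h becomes g ^ (p - 1) * w.\<close>
  define v where "v x = epowr (g x) (p - 1) * ennreal (w x powr (1 / p')) * indicator (cell L c) x" for x
  define h where "h x = ennreal (w x powr (1 / p)) * v x" for x
  define S1 where "S1 x = epowr (ball_maximal (\<lambda>y. epowr (F y) r * epowr (weight_bound L w y) (r / p)) x) (1 / r)" for x
  define S2 where "S2 = cell_maximal L (dual_norm L v)"
  have [measurable]: "(\<lambda>x. indicator (cell L c) x :: ennreal) \<in> borel_measurable lebesgue"
    by (intro borel_measurable_indicator) simp
  have [measurable]: "g \<in> borel_measurable lebesgue" unfolding g_def[abs_def] by measurable
  have [measurable]: "v \<in> borel_measurable lebesgue" unfolding v_def[abs_def] by measurable
  have [measurable]: "h \<in> borel_measurable lebesgue" unfolding h_def[abs_def] by measurable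
  have [measurable]: "S1 \<in> borel_measurable lebesgue" unfolding S1_def[abs_def] by measurable
  have [measurable]: "S2 \<in> borel_measurable lebesgue"
    unfolding S2_def by (intro borel_measurable_lebesgueI measurable_cell_maximal)
  have ww: "ennreal (w x powr (1 / p)) * ennreal (w x powr (1 / p')) = ennreal (w x)" for x
    using w conj by (cases "w x = 0") (auto simp: less_le simp flip: ennreal_mult powr_add)
  have gg: "epowr (g x) p = g x * epowr (g x) (p - 1)" for x
    using epowr_add[of "g x" 1 "p - 1"] by simp
  have vY: "(\<integral>\<^sup>+x. epowr (v x) p' \<partial>lebesgue) = Y"
    unfolding Y_def
  proof (intro nn_integral_cong)
    fix x
    show "epowr (v x) p' = epowr (g x) p * ennreal (w x) * indicator (cell L c) x"
      using p' w by (auto simp: v_def epowr_mult epowr_epowr epowr_ennreal powr_powr split: split_indicator)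
  qed
  \<comment> \<open>The truncation height and the integrability of w over the cell make Y finite;
    otherwise half of it could not be subtracted.\<close>
  have Yfin: "Y < top"
  proof -
    have "Y \<le> (\<integral>\<^sup>+x. epowr M p * (ennreal (w x) * indicator (cell L c) x) \<partial>lebesgue)"
      unfolding Y_def g_def mult.assoc using p by (intro nn_integral_mono mult_right_mono epowr_mono) auto
    also have "\<dots> = epowr M p * (\<integral>\<^sup>+x\<in>cell L c. ennreal (w x) \<partial>lebesgue)"
      by (rule nn_integral_cmult) measurable
    also have "\<dots> < top" using M wfin by (simp add: ennreal_mult_less_top)
    finally show ?thesis .
  qed
  have Yh: "Y \<le> (\<integral>\<^sup>+x\<in>cell L c. G x * h x \<partial>lebesgue)"
    unfolding Y_def
  proof (intro nn_integral_mono)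
    fix x
    show "epowr (g x) p * ennreal (w x) * indicator (cell L c) x \<le> G x * h x * indicator (cell L c) x"
    proof (cases "x \<in> cell L c")
      case True
      then have "h x = epowr (g x) (p - 1) * ennreal (w x)"
        unfolding h_def v_def ww[of x, symmetric] by (simp add: mult_ac)
      moreover have "g x \<le> G x" by (simp add: g_def)
      ultimately show ?thesis using True by (simp add: gg mult.assoc mult_right_mono)
    qed simp
  qed
  have S1X: "(\<integral>\<^sup>+x. epowr (S1 x) p \<partial>lebesgue) \<le> ennreal C1 * X"
  proof -
    have "(\<integral>\<^sup>+x. epowr (S1 x) p \<partial>lebesgue) =
      (\<integral>\<^sup>+x. epowr (ball_maximal (\<lambda>y. epowr (F y) r * epowr (weight_bound L w y) (r / p)) x) (p / r) \<partial>lebesgue)"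
      by (simp add: S1_def epowr_epowr)
    also have "\<dots> \<le> ennreal C1 * (\<integral>\<^sup>+x. epowr (epowr (F x) r * epowr (weight_bound L w x) (r / p)) (p / r) \<partial>lebesgue)"
      using ball_maximal_strong_type[OF _ pr, of "\<lambda>y. epowr (F y) r * epowr (weight_bound L w y) (r / p)"]
      by (simp add: C1_def strong_const_def)
    also have "(\<integral>\<^sup>+x. epowr (epowr (F x) r * epowr (weight_bound L w x) (r / p)) (p / r) \<partial>lebesgue) = X"
      unfolding X_def using pr r p by (intro nn_integral_cong) (simp add: epowr_mult epowr_epowr)
    finally show ?thesis .
  qed
  have S2Y: "(\<integral>\<^sup>+x. epowr (S2 x) p' \<partial>lebesgue) \<le> ennreal C3 * Y"
    unfolding S2_def C3_def weak_const_def vY[symmetric] by (rule cell_maximal_dual_norm_bound[OF L]) measurable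
  \<comment> \<open>A cube of infinite Luxemburg norm makes \<open>weight_bound\<close> infinite on
    the ball, so finiteness of X forces F to vanish there almost everywhere. Such cells then drop
    out of the maximal function by 0 * top = 0.\<close>
  have zero: "ball_mean L F r d = 0" if top: "luxemburg_norm A (bigcube L d) w = top" for d
  proof -
    have "AE x in lebesgue. epowr (F x) p * weight_bound L w x \<noteq> \<infinity>"
      using Xfin by (intro nn_integral_PInf_AE) auto
    then have "AE x in lebesgue. epowr (F x) r * indicator (bigball L d) x = 0"
    proof eventually_elim
      case (elim x)
      show ?case
      proof (cases "x \<in> bigball L d")
        case True
        then have "x \<in> bigcube L d" using bigball_subset_bigcube by blast
        from weight_bound_upper[OF this, of w] have "weight_bound L w x = top" using top by (simp add: top_unique)
        then have "epowr (F x) p = 0" using elim by (auto simp: ennreal_mult_top split: if_splits)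
        then show ?thesis by simp
      qed simp
    qed
    then have "(\<integral>\<^sup>+x. epowr (F x) r * indicator (bigball L d) x \<partial>lebesgue) = (\<integral>\<^sup>+x. 0 \<partial>(lebesgue :: (real ^ 'n) measure))"
      by (rule nn_integral_cong_AE)
    then show ?thesis by (simp add: ball_mean_def)
  qed
  have "(\<integral>\<^sup>+x. epowr (S2 x) p' \<partial>lebesgue) < top"
    using Yfin by (intro le_less_trans[OF S2Y]) (simp add: ennreal_mult_less_top)
  \<comment> \<open>\<open>cell_average_le_limit\<close> needs a finite bound for the dual norm;
    finiteness of Y provides it almost everywhere.\<close>
  then have "AE x in lebesgue. epowr (S2 x) p' \<noteq> \<infinity>"
    by (intro nn_integral_PInf_AE) auto
  then have pt: "AE x in lebesgue. cell_maximal L (\<lambda>d. ball_mean L F r d * cell_average L h d) x \<le> ennreal Cq * (S1 x * S2 x)"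
  proof eventually_elim
    case (elim x)
    then have S2x: "S2 x < top" by (simp add: less_top)
    show ?case
    proof (rule cell_maximal_least)
      fix d assume x: "x \<in> cell L d"
      let ?l = "luxemburg_norm A (bigcube L d) w"
      show "ball_mean L F r d * cell_average L h d \<le> ennreal Cq * (S1 x * S2 x)"
      proof (cases "?l = top")
        case False
        have "cell_average L h d \<le> ennreal Cq * epowr ?l (1 / p) * S2 x"
          unfolding h_def[abs_def] Cq_def using L w False S2x cell_maximal_upper[OF x, of "dual_norm L v"]
          by (intro cell_average_le_limit) (auto simp: S2_def less_top)
        then have "ball_mean L F r d * cell_average L h d \<le> ball_mean L F r d * (ennreal Cq * epowr ?l (1 / p) * S2 x)"
          by (rule mult_left_mono) simp
        also have "\<dots> = ennreal Cq * ((ball_mean L F r d * epowr ?l (1 / p)) * S2 x)" by (simp add: mult_ac)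
        also have "\<dots> \<le> ennreal Cq * (S1 x * S2 x)"
          unfolding S1_def using r by (intro mult_left_mono mult_right_mono ball_mean_le_maximal[OF L _ x]) auto
        finally show ?thesis .
      qed (simp add: zero)
    qed
  qed
  have "Y \<le> ennreal \<kappa> * (\<integral>\<^sup>+x\<in>cell L c. cell_maximal L (\<lambda>d. ball_mean L F r d * cell_average L h d) x \<partial>lebesgue)"
    using Yh bil[of h] by (intro order_trans[OF Yh bil]) measurable
  also have "\<dots> \<le> ennreal \<kappa> * (\<integral>\<^sup>+x. ennreal Cq * (ennreal ((1 / \<eta>) powr p) * epowr (S1 x) p + ennreal (\<eta> powr p') * epowr (S2 x) p') \<partial>lebesgue)"
  proof (intro mult_left_mono nn_integral_mono_AE)
    show "AE x in lebesgue. cell_maximal L (\<lambda>d. ball_mean L F r d * cell_average L h d) x * indicator (cell L c) x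
      \<le> ennreal Cq * (ennreal ((1 / \<eta>) powr p) * epowr (S1 x) p + ennreal (\<eta> powr p') * epowr (S2 x) p')"
      using pt
    proof eventually_elim
      case (elim x)
      \<comment> \<open>\<eta> and its inverse are inserted so that the term with \<open>S2\<close>
        carries the small factor \<open>\<eta> powr p'\<close>.\<close>
      have "S1 x * S2 x = (ennreal (1 / \<eta>) * ennreal \<eta>) * (S1 x * S2 x)"
        using \<eta> by (simp flip: ennreal_mult)
      also have "\<dots> = (ennreal (1 / \<eta>) * S1 x) * (ennreal \<eta> * S2 x)" by (simp only: mult_ac)
      also have "\<dots> \<le> epowr (ennreal (1 / \<eta>) * S1 x) p + epowr (ennreal \<eta> * S2 x) p'"
        using p conj by (rule ennreal_Young)
      also have "\<dots> = ennreal ((1 / \<eta>) powr p) * epowr (S1 x) p + ennreal (\<eta> powr p') * epowr (S2 x) p'"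
        using p p'(1) \<eta> by (simp add: epowr_mult epowr_ennreal)
      finally have "ennreal Cq * (S1 x * S2 x) \<le> ennreal Cq * (ennreal ((1 / \<eta>) powr p) * epowr (S1 x) p + ennreal (\<eta> powr p') * epowr (S2 x) p')"
        by (rule mult_left_mono) simp
      with elim show ?case by (auto split: split_indicator intro: order_trans)
    qed
  qed simp
  also have "\<dots> = ennreal \<kappa> * (ennreal Cq * (ennreal ((1 / \<eta>) powr p) * (\<integral>\<^sup>+x. epowr (S1 x) p \<partial>lebesgue) + ennreal (\<eta> powr p') * (\<integral>\<^sup>+x. epowr (S2 x) p' \<partial>lebesgue)))"
    by (simp add: nn_integral_cmult nn_integral_add)
  also have "\<dots> \<le> ennreal \<kappa> * (ennreal Cq * (ennreal ((1 / \<eta>) powr p) * (ennreal C1 * X) + ennreal (\<eta> powr p') * (ennreal C3 * Y)))"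
    by (intro mult_left_mono add_mono S1X S2Y) auto
  finally have main: "Y \<le> ennreal \<kappa> * (ennreal Cq * (ennreal ((1 / \<eta>) powr p) * (ennreal C1 * X) + ennreal (\<eta> powr p') * (ennreal C3 * Y)))" .
  obtain y where y: "Y = ennreal y" "0 \<le> y" using Yfin by (metis ennreal_cases less_irrefl)
  obtain \<xi> where \<xi>: "X = ennreal \<xi>" "0 \<le> \<xi>" using Xfin X_def by (metis ennreal_cases less_irrefl)
  have "ennreal y \<le> ennreal (\<kappa> * (Cq * ((1 / \<eta>) powr p * (C1 * \<xi>) + \<eta> powr p' * (C3 * y))))"
    using main K Cq C1 C3 y(2) \<xi>(2) unfolding y(1) \<xi>(1)
    by (simp add: ennreal_mult' ennreal_mult'' add_nonneg_nonneg)
  then have "y \<le> \<kappa> * (Cq * ((1 / \<eta>) powr p * (C1 * \<xi>) + \<eta> powr p' * (C3 * y)))"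
    using K Cq C1 C3 y(2) \<xi>(2) by (subst (asm) ennreal_le_iff) (auto intro!: mult_nonneg_nonneg add_nonneg_nonneg)
  also have "\<dots> = (\<kappa> * Cq * ((1 / \<eta>) powr p * C1)) * \<xi> + (\<kappa> * Cq * (\<eta> powr p' * C3)) * y"
    by (simp add: algebra_simps)
  also have "\<dots> \<le> (\<kappa> * Cq * ((1 / \<eta>) powr p * C1)) * \<xi> + 1 / 2 * y"
    using absorb y(2) by (intro add_left_mono mult_right_mono) auto
  finally have "y \<le> 2 * (\<kappa> * Cq * ((1 / \<eta>) powr p * C1)) * \<xi>" by simp
  also have "\<dots> \<le> C * \<xi>" unfolding C_def weighted_const_def C1_def Cq_def \<eta>_def using \<xi>(2) by (intro mult_right_mono) auto
  finally have "Y \<le> ennreal C * X"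
    using y \<xi> C by (simp add: ennreal_leI flip: ennreal_mult)
  then show ?thesis by (simp add: Y_def X_def g_def C_def)
qed

text \<open>The linear lower bound \<open>A_lower\<close> turns admissibility of s into a bound for
  the mean of w by s * (1 + 1 / A 1).\<close>

lemma luxemburg_lower:
  fixes w :: "real ^ 'n \<Rightarrow> real"
  assumes [measurable]: "w \<in> borel_measurable lebesgue" "Q \<in> sets lebesgue" and w: "\<And>x. 0 \<le> w x"
    and V: "emeasure lebesgue Q = ennreal V" "0 < V"
  shows "(\<integral>\<^sup>+x\<in>Q. ennreal (w x) \<partial>lebesgue) / ennreal (V * (1 + 1 / A 1)) \<le> luxemburg_norm A Q w"
  unfolding luxemburg_norm_def
proof (rule Inf_greatest)
  fix l assume "l \<in> {ennreal s |s. 0 < s \<and> (\<integral>\<^sup>+y\<in>Q. ennreal (A (\<bar>w y\<bar> / s)) \<partial>lebesgue) / emeasure lebesgue Q \<le> 1}"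
  then obtain s where s: "l = ennreal s" "0 < s"
    "(\<integral>\<^sup>+y\<in>Q. ennreal (A (\<bar>w y\<bar> / s)) \<partial>lebesgue) / emeasure lebesgue Q \<le> 1" by blast
  have A1: "0 < A 1" by (rule A_pos) simp
  have [measurable]: "(\<lambda>x. ennreal (A (\<bar>w x\<bar> / s))) \<in> borel_measurable lebesgue"
  proof -
    have "A (\<bar>w x\<bar> / s) = A (max 0 (\<bar>w x\<bar> / s))" for x using s by (simp add: max_def)
    then show ?thesis by simp
  qed
  have "(\<integral>\<^sup>+y\<in>Q. ennreal (A (\<bar>w y\<bar> / s)) \<partial>lebesgue) = (\<integral>\<^sup>+y\<in>Q. ennreal (A (\<bar>w y\<bar> / s)) \<partial>lebesgue) / ennreal V * ennreal V"
    by (rule ennreal_divide_mult_cancel[OF V(2), symmetric])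
  also have "\<dots> \<le> 1 * ennreal V" using s(3) unfolding V(1) by (rule mult_right_mono) simp
  finally have adm: "(\<integral>\<^sup>+y\<in>Q. ennreal (A (\<bar>w y\<bar> / s)) \<partial>lebesgue) \<le> ennreal V" by simp
  have pt: "ennreal (w x) \<le> ennreal s + ennreal (s / A 1) * ennreal (A (\<bar>w x\<bar> / s))" for x
  proof -
    have "w x / s \<le> 1 + A (w x / s) / A 1" using w s by (intro A_lower) simp
    then have "w x \<le> s + s / A 1 * A (w x / s)" using s by (simp add: field_simps)
    then have "ennreal (w x) \<le> ennreal (s + s / A 1 * A (w x / s))" by (rule ennreal_leI)
    also have "\<dots> = ennreal s + ennreal (s / A 1 * A (w x / s))"
      using s A1 w A_nonneg[of "w x / s"] by (intro ennreal_plus) auto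
    also have "ennreal (s / A 1 * A (w x / s)) = ennreal (s / A 1) * ennreal (A (\<bar>w x\<bar> / s))"
      using s A1 w A_nonneg[of "w x / s"] by (subst ennreal_mult) auto
    finally show ?thesis .
  qed
  have "(\<integral>\<^sup>+x\<in>Q. ennreal (w x) \<partial>lebesgue) \<le> (\<integral>\<^sup>+x. ennreal s * indicator Q x + ennreal (s / A 1) * (ennreal (A (\<bar>w x\<bar> / s)) * indicator Q x) \<partial>lebesgue)"
    using pt by (intro nn_integral_mono) (auto split: split_indicator)
  also have "\<dots> = ennreal s * ennreal V + ennreal (s / A 1) * (\<integral>\<^sup>+y\<in>Q. ennreal (A (\<bar>w y\<bar> / s)) \<partial>lebesgue)"
    by (subst nn_integral_add) (auto simp: nn_integral_cmult nn_integral_cmult_indicator V)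
  also have "\<dots> \<le> ennreal s * ennreal V + ennreal (s / A 1) * ennreal V"
    by (intro add_left_mono mult_left_mono adm) simp
  also have "\<dots> = ennreal (s * (V * (1 + 1 / A 1)))"
    using s V A1 by (simp add: algebra_simps flip: ennreal_mult ennreal_plus)
  finally have "(\<integral>\<^sup>+x\<in>Q. ennreal (w x) \<partial>lebesgue) / ennreal (V * (1 + 1 / A 1)) \<le> ennreal (s * (V * (1 + 1 / A 1))) / ennreal (V * (1 + 1 / A 1))"
    by (rule divide_right_mono_ennreal)
  also have "\<dots> = l"
  proof -
    have "0 < 1 + 1 / A 1" using A1 by (simp add: add_pos_pos)
    then show ?thesis using s V by (subst divide_ennreal) auto
  qed
  finally show "(\<integral>\<^sup>+x\<in>Q. ennreal (w x) \<partial>lebesgue) / ennreal (V * (1 + 1 / A 1)) \<le> l" .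
qed

end

section \<open>Weights, and a local lower bound for the Orlicz maximal function\<close>

lemma weight_measurable:
  assumes "weight w"
  shows "w \<in> borel_measurable lebesgue"
proof (rule borel_measurable_LIMSEQ_real)
  show "(\<lambda>x. indicator (cball 0 (real m)) x *\<^sub>R w x) \<in> borel_measurable lebesgue" for m
    using assms borel_measurable_integrable[of lebesgue "\<lambda>x. indicator (cball 0 (real m)) x *\<^sub>R w x"]
    by (auto simp: weight_def set_integrable_def)
  show "(\<lambda>m. indicator (cball 0 (real m)) x *\<^sub>R w x) \<longlonglongrightarrow> w x" for x
  proof (rule tendsto_eventually)
    obtain N where "norm x \<le> real N" using real_arch_simple by blast
    then show "eventually (\<lambda>m. indicator (cball 0 (real m)) x *\<^sub>R w x = w x) sequentially"
      unfolding eventually_sequentially by (intro exI[of _ N]) auto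
  qed
qed

lemma weight_locally_finite:
  assumes "weight w" "bounded S"
  shows "(\<integral>\<^sup>+x\<in>S. ennreal (w x) \<partial>lebesgue) < top"
proof -
  obtain a where a: "S \<subseteq> cball 0 a" using bounded_subset_ballD[OF assms(2), of 0] ball_subset_cball by blast
  have "set_integrable lebesgue (cball 0 a) w" using assms(1) by (auto simp: weight_def)
  then have "(\<integral>\<^sup>+x. ennreal (norm (indicator (cball 0 a) x *\<^sub>R w x)) \<partial>lebesgue) < \<infinity>"
    by (simp add: set_integrable_def integrable_iff_bounded)
  moreover have "(\<integral>\<^sup>+x\<in>S. ennreal (w x) \<partial>lebesgue) \<le> (\<integral>\<^sup>+x. ennreal (norm (indicator (cball 0 a) x *\<^sub>R w x)) \<partial>lebesgue)"
    using a assms(1) by (intro nn_integral_mono) (auto simp: weight_def split: split_indicator)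
  ultimately show ?thesis by (simp add: le_less_trans)
qed

text \<open>One cube containing both the given ball and a ball on which w has positive integral
  serves all points at once; its Luxemburg norm is bounded below by a multiple of the mean of
  w.\<close>

lemma (in young) orlicz_maximal_lower:
  fixes w :: "real ^ 'n \<Rightarrow> real"
  assumes w: "weight w" and nz: "\<not> (AE x in lebesgue. w x = 0)"
  shows "\<exists>k>0. \<forall>x\<in>ball 0 R. ennreal k \<le> orlicz_maximal A w x"
proof -
  have [measurable]: "w \<in> borel_measurable lebesgue" using w by (rule weight_measurable)
  let ?I = "\<lambda>m::nat. \<integral>\<^sup>+x\<in>ball 0 (real m). ennreal (w x) \<partial>lebesgue"
  have "\<exists>m. ?I m \<noteq> 0"
  proof (rule ccontr)
    assume "\<nexists>m. ?I m \<noteq> 0"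
    have "AE x in lebesgue. ennreal (w x) * indicator (ball 0 (real m)) x = 0" for m
    proof (subst nn_integral_0_iff_AE[symmetric])
      show "(\<lambda>x. ennreal (w x) * indicator (ball 0 (real m)) x) \<in> borel_measurable lebesgue"
        by (intro borel_measurable_times_ennreal borel_measurable_indicator) auto
      show "?I m = 0" using \<open>\<nexists>m. ?I m \<noteq> 0\<close> by simp
    qed
    then have "AE x in lebesgue. \<forall>m. ennreal (w x) * indicator (ball 0 (real m)) x = 0"
      unfolding AE_all_countable by blast
    then have "AE x in lebesgue. w x = 0"
    proof eventually_elim
      case (elim x)
      obtain m where "norm x < real m" using reals_Archimedean2 by blast
      with elim have "ennreal (w x) = 0" by (auto dest: spec[of _ m])
      then show ?case using w by (simp add: weight_def ennreal_eq_0_iff antisym)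
    qed
    with nz show False by simp
  qed
  then obtain m where m: "?I m \<noteq> 0" by blast
  define s where "s = 2 * max (max R (real m)) 1"
  let ?h = "(\<chi> i. s / 2) :: real ^ 'n"
  let ?Q = "cbox (0 - ?h) (0 + ?h)"
  have s: "0 < s" by (simp add: s_def)
  have em: "emeasure lebesgue ?Q = ennreal (s ^ CARD('n))"
    using emeasure_cbox_cube(1)[of s "0 :: real ^ 'n"] s by (simp add: emeasure_completion)
  have "?Q = cbox (0 - ?h) ((0 - ?h) + (\<chi> i. s))"
    by (rule arg_cong2[of _ _ _ _ cbox]) (auto simp: vec_eq_iff)
  then have Qc: "?Q \<in> cubes" unfolding cubes_def using s by blast
  have sub: "ball 0 a \<subseteq> ?Q" if "a \<le> s / 2" for a
  proof
    fix x :: "real ^ 'n" assume x: "x \<in> ball 0 a"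
    have ab: "\<bar>x $ i\<bar> \<le> s / 2" for i
      using component_le_norm_cart[of x i] x that by simp
    then have "- (s / 2) \<le> x $ i \<and> x $ i \<le> s / 2" for i using ab[of i] by linarith
    then show "x \<in> ?Q" by (simp add: mem_box_cart)
  qed
  define J where "J = (\<integral>\<^sup>+x\<in>?Q. ennreal (w x) \<partial>lebesgue)"
  have "ball 0 (real m) \<subseteq> ?Q" by (rule sub) (simp add: s_def)
  then have "?I m \<le> J" unfolding J_def
    by (intro nn_integral_mono) (auto split: split_indicator)
  then have "J \<noteq> 0" using m by auto
  moreover have "J < top" unfolding J_def by (intro weight_locally_finite w bounded_cbox)
  ultimately obtain j where j: "J = ennreal j" "0 < j"
    by (metis ennreal_cases ennreal_0 less_eq_real_def less_irrefl)
  define k where "k = j / (s ^ CARD('n) * (1 + 1 / A 1))"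
  have A1: "0 < 1 + 1 / A 1" using A_pos[of 1] by (simp add: add_pos_pos)
  have k: "0 < k" unfolding k_def using j s A1 by simp
  have "ennreal k = J / ennreal (s ^ CARD('n) * (1 + 1 / A 1))"
    unfolding k_def j(1) using j s A1 by (subst divide_ennreal) auto
  also have "\<dots> \<le> luxemburg_norm A ?Q w"
    unfolding J_def using w s em by (intro luxemburg_lower) (auto simp: weight_def)
  finally have le: "ennreal k \<le> luxemburg_norm A ?Q w" .
  have "ennreal k \<le> orlicz_maximal A w x" if "x \<in> ball 0 R" for x
  proof -
    have "ball 0 R \<subseteq> ?Q" by (rule sub) (simp add: s_def)
    then have "x \<in> ?Q" using that by blast
    then have "luxemburg_norm A ?Q w \<le> orlicz_maximal A w x"
      unfolding orlicz_maximal_def using Qc by (intro SUP_upper) simp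
    with le show ?thesis by (rule order_trans)
  qed
  then show ?thesis using k by blast
qed

text \<open>The product of c and \<psi> r carries no sign; a negative constant means the bound 0,
  since \<open>ennreal\<close> sends negative reals to 0.\<close>

lemma weak_type_bound_max:
  "weak_type_bound D q T I \<phi> r b \<Longrightarrow> weak_type_bound D q T I \<phi> r (max b 0)"
  by (cases "0 \<le> b") (auto simp: weak_type_bound_def ennreal_neg max_def)

theorem theorem6p1:
  fixes T :: "(real ^ 'n \<Rightarrow> complex) \<Rightarrow> real ^ 'n \<Rightarrow> complex"
    and D :: "(real ^ 'n \<Rightarrow> complex) set"
    and I :: "'i set" and \<phi> :: "'i \<Rightarrow> real ^ 'n \<Rightarrow> real"
    and \<psi> A :: "real \<Rightarrow> real" and q r0 p p' :: real
  assumes "calderon_zygmund D T"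
    and "\<forall>\<alpha>\<in>I. \<phi> \<alpha> \<in> borel_measurable lebesgue"
    and "1 \<le> q"
    and "1 < r0"
    and "\<exists>c>0. \<forall>r. 1 < r \<and> r \<le> r0 \<longrightarrow> weak_type_bound D q T I \<phi> r (c * \<psi> r)"
    and "1 < p" and "1 / p + 1 / p' = 1"
    and "young_function A" and "doubling A"
    and "\<exists>c>0. (\<integral>\<^sup>+t\<in>{c..}. ennreal ((t / A t) powr (p' - 1) / t) \<partial>lborel) < top"
  shows "\<exists>C::real. \<forall>f w. (\<forall>j. f j \<in> D) \<and> weight w \<longrightarrow>
    (\<integral>\<^sup>+x. epowr (modulated_seq_norm q T I \<phi> f x) p * ennreal (w x) \<partial>lebesgue)
      \<le> ennreal C * (\<integral>\<^sup>+x. epowr (seq_norm q f x) p * orlicz_maximal A w x \<partial>lebesgue)"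
proof -
  obtain K where K: "cz_kernel K" and rep: "\<And>g x. g \<in> D \<Longrightarrow> x \<notin> closure {y. g y \<noteq> 0} \<Longrightarrow>
      integrable lebesgue (\<lambda>y. K x y * g y) \<and> T g x = (LINT y|lebesgue. K x y * g y)"
    using assms(1) unfolding calderon_zygmund_def by blast
  obtain c \<delta> where c\<delta>: "0 < \<delta>" and sm: "\<And>x x' y. norm (x - x') < norm (x - y) / 2 \<Longrightarrow>
        norm (K x y - K x' y) + norm (K y x - K y x')
          \<le> c * (norm (x - x') powr \<delta> / norm (x - y) powr (real CARD('n) + \<delta>))"
    using K unfolding cz_kernel_def by blast
  interpret young A p p'
    using assms by unfold_locales
  interpret modulated_cz T D I \<phi> q K "max c 0" \<delta>
  proof
    show "cz_domain D" using assms(1) by (simp add: calderon_zygmund_def)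
    show "T (\<lambda>y. g y + h y) x = T g x + T h x" if "g \<in> D" "h \<in> D" for g h x
      using assms(1) that by (simp add: calderon_zygmund_def)
    show "norm (K x y - K x' y) \<le> max c 0 * (norm (x - x') powr \<delta> / norm (x - y) powr (real CARD('n) + \<delta>))"
      if "norm (x - x') < norm (x - y) / 2" for x x' y
    proof -
      have "norm (K x y - K x' y) \<le> c * (norm (x - x') powr \<delta> / norm (x - y) powr (real CARD('n) + \<delta>))"
        using sm[OF that] norm_ge_zero[of "K y x - K y x'"] by linarith
      also have "\<dots> \<le> max c 0 * (norm (x - x') powr \<delta> / norm (x - y) powr (real CARD('n) + \<delta>))"
        by (intro mult_right_mono) auto
      finally show ?thesis .
    qed
  qed (use assms rep c\<delta> in auto)
  \<comment> \<open>At most r0, where the hypothesis applies, and below p, so that the maximal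
    function can be used with exponent p / r > 1; the midpoint of 1 and p stays above 1.\<close>
  define r where "r = min r0 ((1 + p) / 2)"
  have r: "1 < r" "r \<le> r0" "r < p" using assms(4,6) by (auto simp: r_def min_def)
  obtain b0 where "weak_type_bound D q T I \<phi> r b0" using assms(5) r by blast
  then obtain b where b: "0 \<le> b" "weak_type_bound D q T I \<phi> r b"
    using weak_type_bound_max by (metis max.cobounded2)
  define \<kappa> where "\<kappa> = 2 * K3 r b"
  have \<kappa>: "0 \<le> \<kappa>" "2 * ennreal (K3 r b) = ennreal \<kappa>"
    using K_pos(3)[of b r] b(1) by (simp_all add: \<kappa>_def ennreal_mult')
  \<comment> \<open>Fixed before f, w and the size of the cells. Positivity keeps an infinite
    right-hand side infinite after multiplication.\<close>
  define C where "C = weighted_const TYPE('n) \<kappa> r"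
  have C: "0 < C" unfolding C_def using r(1,3) \<kappa>(1) by (rule weighted_const_pos)
  have "(\<integral>\<^sup>+x. epowr (modulated_seq_norm q T I \<phi> f x) p * ennreal (w x) \<partial>lebesgue)
      \<le> ennreal C * (\<integral>\<^sup>+x. epowr (seq_norm q f x) p * orlicz_maximal A w x \<partial>lebesgue)"
    if fD: "\<And>j. f j \<in> D" and w: "weight w" for f w
  proof -
    let ?X = "\<integral>\<^sup>+x. epowr (seq_norm q f x) p * orlicz_maximal A w x \<partial>lebesgue"
    have [measurable]: "w \<in> borel_measurable lebesgue" using w by (rule weight_measurable)
    have sm [measurable]: "seq_norm q f \<in> borel_measurable lebesgue" by (rule seq_norm_measurable[OF fD])
    have w0: "0 \<le> w x" for x using w by (simp add: weight_def)
    consider "?X = top" | "AE x in lebesgue. w x = 0" | "?X < top" "\<not> (AE x in lebesgue. w x = 0)"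
      using less_top by blast
    then show ?thesis
    proof cases
      case 1
      then show ?thesis using C by (simp add: ennreal_mult_top)
    next
      case 2
      then have "(\<integral>\<^sup>+x. epowr (modulated_seq_norm q T I \<phi> f x) p * ennreal (w x) \<partial>lebesgue) = (\<integral>\<^sup>+x. 0 \<partial>(lebesgue :: (real ^ 'n) measure))"
        by (intro nn_integral_cong_AE) auto
      then show ?thesis by simp
    next
      case 3
      have finball: "(\<integral>\<^sup>+x\<in>ball 0 R. epowr (seq_norm q f x) r \<partial>lebesgue) < top" for R
      proof -
        obtain k where k: "0 < k" "\<And>x. x \<in> ball 0 R \<Longrightarrow> ennreal k \<le> orlicz_maximal A w x"
          using orlicz_maximal_lower[OF w 3(2)] by blast
        have [measurable]: "(\<lambda>x. indicator (ball 0 R) x :: ennreal) \<in> borel_measurable (lebesgue :: (real ^ 'n) measure)"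
          by (intro borel_measurable_indicator) simp
        have "ennreal k * (\<integral>\<^sup>+x\<in>ball 0 R. epowr (seq_norm q f x) p \<partial>lebesgue)
            = (\<integral>\<^sup>+x. ennreal k * (epowr (seq_norm q f x) p * indicator (ball 0 R) x) \<partial>lebesgue)"
          by (rule nn_integral_cmult[symmetric]) measurable
        also have "\<dots> \<le> ?X"
          using k(2) by (intro nn_integral_mono) (auto simp: mult.commute intro!: mult_right_mono split: split_indicator)
        also have "\<dots> < top" by (rule 3)
        finally have Fp: "(\<integral>\<^sup>+x\<in>ball 0 R. epowr (seq_norm q f x) p \<partial>lebesgue) < top"
          using k(1) by (auto simp: ennreal_mult_less_top)
        \<comment> \<open>On a ball of finite measure this lets local integrability pass from
          exponent p to r.\<close>
        have pt: "epowr y r \<le> 1 + epowr y p" for y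
        proof (cases "y \<le> 1")
          case True
          then have "epowr y r \<le> 1" using epowr_mono[of y 1 r] r by simp
          then show ?thesis by (simp add: add_increasing2)
        next
          case False
          have "epowr y r * 1 \<le> epowr y r * epowr y (p - r)"
            using False r epowr_mono[of 1 y "p - r"] by (intro mult_left_mono) auto
          also have "\<dots> = epowr y p" using epowr_add[of y r "p - r"] by simp
          finally show ?thesis by (simp add: add_increasing)
        qed
        have "(\<integral>\<^sup>+x\<in>ball 0 R. epowr (seq_norm q f x) r \<partial>lebesgue)
          \<le> (\<integral>\<^sup>+x. indicator (ball 0 R) x + epowr (seq_norm q f x) p * indicator (ball 0 R) x \<partial>lebesgue)"
          using pt by (intro nn_integral_mono) (auto split: split_indicator)
        also have "\<dots> = emeasure lebesgue (ball 0 R :: (real ^ 'n) set) + (\<integral>\<^sup>+x\<in>ball 0 R. epowr (seq_norm q f x) p \<partial>lebesgue)"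
          by (subst nn_integral_add) auto
        also have "\<dots> < top"
        proof -
          have "emeasure lebesgue (ball 0 R :: (real ^ 'n) set) \<noteq> top"
            by (rule fmeasurableD2[OF lmeasurable_ball])
          then show ?thesis using Fp by (simp add: less_top)
        qed
        finally show ?thesis .
      qed
      have fin: "(\<integral>\<^sup>+x\<in>bigball L d. epowr (seq_norm q f x) r \<partial>lebesgue) < top" for L and d :: "nat \<times> (int ^ 'n)"
      proof -
        let ?R = "norm (center L d) + 3 * (CARD('n) * side L d)"
        have "bigball L d \<subseteq> ball 0 ?R"
        proof
          fix x assume "x \<in> bigball L d"
          then show "x \<in> ball 0 ?R" using norm_triangle_sub[of x "center L d"]
            by (simp add: bigball_def dist_norm norm_minus_commute)
        qed
        then have "(\<integral>\<^sup>+x\<in>bigball L d. epowr (seq_norm q f x) r \<partial>lebesgue) \<le> (\<integral>\<^sup>+x\<in>ball 0 ?R. epowr (seq_norm q f x) r \<partial>lebesgue)"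
          by (intro nn_integral_mono) (auto split: split_indicator)
        then show ?thesis using finball[of ?R] by (rule le_less_trans)
      qed
      define root where "root = (0 :: nat, 0 :: int ^ 'n)"
      define L where "L m = real m + 1" for m :: nat
      have L: "0 < L m" for m by (simp add: L_def)
      have ball: "bigball (L m) root = ball 0 (3 * (CARD('n) * L m))" for m
        by (simp add: bigball_def center_def side_def root_def vec_eq_iff zero_vec_def)
      \<comment> \<open>Truncation height, ball and cell grow with the same m, so a single limit
        removes all three.\<close>
      define u where "u m x = epowr (min (G f (bigball (L m) root) x) (of_nat m)) p * ennreal (w x) * indicator (cell (L m) root) x" for m x
      have Gm [measurable]: "G f (bigball (L m) root) \<in> borel_measurable lebesgue" for m
        using r by (intro G_weak_type(1)[where f = f, OF fD bigball_lebesgue _ b fin]) simp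
      have WX: "(\<integral>\<^sup>+x. epowr (seq_norm q f x) p * weight_bound (L m) w x \<partial>lebesgue) \<le> ?X" for m
        by (intro nn_integral_mono mult_left_mono weight_bound_le L) simp
      have um: "(\<integral>\<^sup>+x. u m x \<partial>lebesgue) \<le> ennreal C * ?X" for m
      proof -
        have "bounded (cell (L m) root)"
          using cell_subset_bigball[OF L, of m root] bounded_ball bounded_subset unfolding bigball_def by blast
        then have "(\<integral>\<^sup>+x. u m x \<partial>lebesgue) \<le> ennreal C * (\<integral>\<^sup>+x. epowr (seq_norm q f x) p * weight_bound (L m) w x \<partial>lebesgue)"
          unfolding u_def C_def
        proof (intro weighted_bound_of_bilinear_bound r \<kappa> L sm Gm weight_locally_finite w)
          show "of_nat m < (top :: ennreal)" by (simp add: less_top[symmetric])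
          show "(\<integral>\<^sup>+x. epowr (seq_norm q f x) p * weight_bound (L m) w x \<partial>lebesgue) < top"
            using WX 3(1) by (rule le_less_trans)
          show "(\<integral>\<^sup>+x\<in>cell (L m) root. G f (bigball (L m) root) x * h x \<partial>lebesgue) \<le> ennreal \<kappa> *
            (\<integral>\<^sup>+x\<in>cell (L m) root. cell_maximal (L m) (\<lambda>d. ball_mean (L m) (seq_norm q f) r d * cell_average (L m) h d) x \<partial>lebesgue)"
            if "h \<in> borel_measurable lebesgue" for h
            using nn_integral_G_le[where f = f, OF L fD r(1) b fin that] by (simp only: \<kappa>(2))
        qed (simp_all add: w0)
        also have "\<dots> \<le> ennreal C * ?X" by (intro mult_left_mono WX) simp
        finally show ?thesis .
      qed
      have pt: "epowr (modulated_seq_norm q T I \<phi> f x) p * ennreal (w x) \<le> liminf (\<lambda>m. u m x)" for x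
      proof -
        have "filterlim (\<lambda>m. 3 * (CARD('n) * L m)) at_top sequentially"
        proof (rule filterlim_at_top_mono[OF filterlim_real_sequentially])
          have "real m \<le> 3 * (CARD('n) * L m)" for m
          proof -
            have "1 * L m \<le> CARD('n) * L m"
              using L[of m] by (intro mult_right_mono) (auto simp: Suc_le_eq)
            moreover have "real m = L m - 1" by (simp add: L_def)
            ultimately show ?thesis using L[of m] by linarith
          qed
          then show "eventually (\<lambda>m. real m \<le> 3 * (CARD('n) * L m)) sequentially" by simp
        qed
        from modulated_seq_norm_le_liminf[where f = f, OF fD this, of x]
        have "modulated_seq_norm q T I \<phi> f x \<le> liminf (\<lambda>m. G f (bigball (L m) root) x)" by (simp add: ball)
        then have "modulated_seq_norm q T I \<phi> f x \<le> liminf (\<lambda>m. min (G f (bigball (L m) root) x) (of_nat m))"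
          by (rule le_liminf_min)
        then have "epowr (modulated_seq_norm q T I \<phi> f x) p \<le> epowr (liminf (\<lambda>m. min (G f (bigball (L m) root) x) (of_nat m))) p"
          using p by (intro epowr_mono) auto
        also have "\<dots> \<le> liminf (\<lambda>m. epowr (min (G f (bigball (L m) root) x) (of_nat m)) p)"
          using p by (intro epowr_Liminf_le) auto
        finally have "ennreal (w x) * epowr (modulated_seq_norm q T I \<phi> f x) p
            \<le> ennreal (w x) * liminf (\<lambda>m. epowr (min (G f (bigball (L m) root) x) (of_nat m)) p)"
          by (rule mult_left_mono) simp
        also have "\<dots> \<le> liminf (\<lambda>m. ennreal (w x) * epowr (min (G f (bigball (L m) root) x) (of_nat m)) p)"
          by (rule mult_liminf_le)
        also have "\<dots> = liminf (\<lambda>m. u m x)"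
        proof (rule Liminf_eq)
          \<comment> \<open>The cell of side m + 1 about 0 contains x as soon as m exceeds 2 * norm
            x; the limit inferior ignores the earlier indices.\<close>
          obtain N where N: "2 * norm x < real N" using reals_Archimedean2 by blast
          have "x \<in> cell (L m) root" if "N \<le> m" for m
          proof (rule mem_cellI[OF L])
            fix i
            have "\<bar>x $ i\<bar> < L m / 2"
              using component_le_norm_cart[of x i] N that by (simp add: L_def)
            then show "center (L m) root $ i - side (L m) root / 2 \<le> x $ i" "x $ i < center (L m) root $ i + side (L m) root / 2"
              by (auto simp: center_def side_def root_def)
          qed
          then show "eventually (\<lambda>m. ennreal (w x) * epowr (min (G f (bigball (L m) root) x) (of_nat m)) p = u m x) sequentially"
            unfolding eventually_sequentially by (intro exI[of _ N]) (auto simp: u_def mult.commute)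
        qed
        finally show ?thesis by (simp add: mult.commute)
      qed
      \<comment> \<open>Fatou's lemma is applied to \<open>u\<close>, whose measurability is
        inherited from the cut-off operators; the left-hand side enters by monotonicity
        alone.\<close>
      have [measurable]: "u m \<in> borel_measurable lebesgue" for m
      proof -
        have [measurable]: "(\<lambda>x. indicator (cell (L m) root) x :: ennreal) \<in> borel_measurable lebesgue"
          by (intro borel_measurable_indicator) simp
        show ?thesis unfolding u_def[abs_def] by measurable
      qed
      have "(\<integral>\<^sup>+x. epowr (modulated_seq_norm q T I \<phi> f x) p * ennreal (w x) \<partial>lebesgue) \<le> (\<integral>\<^sup>+x. liminf (\<lambda>m. u m x) \<partial>lebesgue)"
        by (intro nn_integral_mono pt)
      also have "\<dots> \<le> liminf (\<lambda>m. \<integral>\<^sup>+x. u m x \<partial>lebesgue)" by (intro nn_integral_liminf) measurable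
      also have "\<dots> \<le> liminf (\<lambda>m::nat. ennreal C * ?X)" by (intro Liminf_mono always_eventually allI um)
      also have "\<dots> = ennreal C * ?X" by (simp add: Liminf_const)
      finally show ?thesis .
    qed
  qed
  then show ?thesis by blast
qed

end
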